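(* Let $H\in\mathrm{Ind}_{N_n}^{G_n}\psi_k$. Suppose that $\sum_{x\in N_n\backslash G_n}H(x)W(x)=0$ for every $W\in\mathcal{W}(P(\pi),\psi_{R(\pi)}^{-1})$ and every irreducible generic $k$-representation $\pi$ of $G_n$. Then $H$ is identically zero.
   Context: Let $p$ be a prime, $q$ a power of $p$, $G_n=\mathrm{GL}_n(\mathbb{F}_q)$, $\ell\neq p$ a prime, $k=\overline{\mathbb{F}}_\ell$. Fix a nontrivial $\psi:(\mathbb{F}_q,+)\to k^\times$, viewed as a character $\psi_k$ of the upper unipotent subgroup $N_n$ via $u\mapsto\psi(\sum_iu_{i,i+1})$; $\mathrm{Ind}_{N_n}^{G_n}\psi_k=\{f:G_n\to k: f(ug)=\psi_k(u)f(g)\}$. An irreducible $k$-representation is generic if its $(N_n,\psi_k)$-coinvariants are nonzero (equivalently, its $(N_n,\psi_k^{-1})$-coinvariants are nonzero). For such $\pi$, $P(\pi)$ is its projective cover as a $k[G_n]$-module and $R(\pi)=\mathrm{End}_{k[G_n]}(P(\pi))$ (a commutative local finite-dimensional $k$-algebra acting on $P(\pi)$); the $(N_n,\psi^{-1})$-coinvariants of $P(\pi)$ form a free $R(\pi)$-module of rank one, and choosing a generator $\lambda$ of its $R(\pi)$-dual gives an $R(\pi)[G_n]$-map $P(\pi)\to\{W:G_n\to R(\pi):W(ug)=\psi^{-1}(u)W(g)\}$, $f\mapsto(g\mapsto\lambda(\overline{gf}))$, whose image is $\mathcal{W}(P(\pi),\psi^{-1}_{R(\pi)})$. The sum in the claim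 is computed in $R(\pi)\supset k$. *)

theory Defs
  imports "HOL-Algebra.Algebraic_Closure_Type" "Berlekamp_Zassenhaus.Finite_Field"
          "Jordan_Normal_Form.Matrix"
begin

definition GLn :: "nat \<Rightarrow> 'f::field mat set" where
  "GLn n = {A \<in> carrier_mat n n. invertible_mat A}"

definition Nn :: "nat \<Rightarrow> 'f::field mat set" where
  "Nn n = {A \<in> carrier_mat n n. (\<forall>i<n. A $$ (i,i) = 1) \<and> (\<forall>i<n. \<forall>j<i. A $$ (i,j) = 0)}"

definition psiN :: "('f::field \<Rightarrow> 'k::field) \<Rightarrow> nat \<Rightarrow> 'f mat \<Rightarrow> 'k" where
  "psiN \<psi> n u = \<psi> (\<Sum>i<n-1. u $$ (i, i+1))"

definition nontriv_add_char :: "('f::field \<Rightarrow> 'k::field) \<Rightarrow> bool" where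
  "nontriv_add_char \<psi> \<longleftrightarrow> (\<forall>a b. \<psi> (a + b) = \<psi> a * \<psi> b) \<and> (\<forall>a. \<psi> a \<noteq> 0) \<and> (\<exists>a. \<psi> a \<noteq> 1)"

definition in_Ind :: "nat \<Rightarrow> ('f::field \<Rightarrow> 'k::field) \<Rightarrow> ('f mat \<Rightarrow> 'k) \<Rightarrow> bool" where
  "in_Ind n \<psi> H \<longleftrightarrow> (\<forall>u\<in>Nn n. \<forall>g\<in>GLn n. H (u * g) = psiN \<psi> n u * H g)"

definition is_rep :: "nat \<Rightarrow> nat \<Rightarrow> ('f::field mat \<Rightarrow> 'k::field mat) \<Rightarrow> bool" where
  "is_rep n d \<rho> \<longleftrightarrow> (\<forall>g\<in>GLn n. \<rho> g \<in> carrier_mat d d) \<and>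
     (\<forall>g\<in>GLn n. \<forall>h\<in>GLn n. \<rho> (g * h) = \<rho> g * \<rho> h) \<and> \<rho> (1\<^sub>m n) = 1\<^sub>m d"

definition ksubspace :: "nat \<Rightarrow> 'k::field vec set \<Rightarrow> bool" where
  "ksubspace d U \<longleftrightarrow> U \<subseteq> carrier_vec d \<and> 0\<^sub>v d \<in> U \<and>
     (\<forall>v\<in>U. \<forall>w\<in>U. v + w \<in> U) \<and> (\<forall>c. \<forall>v\<in>U. c \<cdot>\<^sub>v v \<in> U)"

definition kspan :: "nat \<Rightarrow> 'k::field vec set \<Rightarrow> 'k vec set" where
  "kspan d S = \<Inter>{U. ksubspace d U \<and> S \<subseteq> U}"

definition invariant_subspace :: "nat \<Rightarrow> nat \<Rightarrow> ('f::field mat \<Rightarrow> 'k::field mat) \<Rightarrow> 'k vec set \<Rightarrow> bool" where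
  "invariant_subspace n d \<rho> U \<longleftrightarrow> ksubspace d U \<and> (\<forall>g\<in>GLn n. \<forall>v\<in>U. \<rho> g *\<^sub>v v \<in> U)"

definition irreducible_rep :: "nat \<Rightarrow> nat \<Rightarrow> ('f::field mat \<Rightarrow> 'k::field mat) \<Rightarrow> bool" where
  "irreducible_rep n d \<rho> \<longleftrightarrow> is_rep n d \<rho> \<and> d > 0 \<and>
     (\<forall>U. invariant_subspace n d \<rho> U \<longrightarrow> U = {0\<^sub>v d} \<or> U = carrier_vec d)"

text \<open>V(N_n, chi): the span of rho(u)v - chi(u)v; the (N_n,chi)-coinvariants are V / V(N_n,chi),
  where chi is the character of N_n attached to the additive character phi\<close>
definition coinv_kernel :: "nat \<Rightarrow> ('f::field \<Rightarrow> 'k::field) \<Rightarrow> nat \<Rightarrow> ('f mat \<Rightarrow> 'k mat) \<Rightarrow> 'k vec set" where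
  "coinv_kernel n \<phi> d \<rho> =
     kspan d {\<rho> u *\<^sub>v v - psiN \<phi> n u \<cdot>\<^sub>v v | u v. u \<in> Nn n \<and> v \<in> carrier_vec d}"

definition coinv_nonzero :: "nat \<Rightarrow> ('f::field \<Rightarrow> 'k::field) \<Rightarrow> nat \<Rightarrow> ('f mat \<Rightarrow> 'k mat) \<Rightarrow> bool" where
  "coinv_nonzero n \<phi> d \<rho> \<longleftrightarrow> coinv_kernel n \<phi> d \<rho> \<noteq> carrier_vec d"

definition generic_irred :: "nat \<Rightarrow> ('f::field \<Rightarrow> 'k::field) \<Rightarrow> nat \<Rightarrow> ('f mat \<Rightarrow> 'k mat) \<Rightarrow> bool" where
  "generic_irred n \<psi> d \<rho> \<longleftrightarrow> irreducible_rep n d \<rho> \<and> coinv_nonzero n \<psi> d \<rho>"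

definition gmap :: "nat \<Rightarrow> nat \<Rightarrow> ('f::field mat \<Rightarrow> 'k::field mat) \<Rightarrow> nat \<Rightarrow> ('f mat \<Rightarrow> 'k mat) \<Rightarrow> 'k mat \<Rightarrow> bool" where
  "gmap n d1 \<rho>1 d2 \<rho>2 A \<longleftrightarrow> A \<in> carrier_mat d2 d1 \<and> (\<forall>g\<in>GLn n. A * \<rho>1 g = \<rho>2 g * A)"

definition surj_mat :: "nat \<Rightarrow> nat \<Rightarrow> 'k::field mat \<Rightarrow> bool" where
  "surj_mat d1 d2 A \<longleftrightarrow> (\<forall>w\<in>carrier_vec d2. \<exists>v\<in>carrier_vec d1. A *\<^sub>v v = w)"

definition projective_rep :: "nat \<Rightarrow> nat \<Rightarrow> ('f::field mat \<Rightarrow> 'k::field mat) \<Rightarrow> bool" where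
  "projective_rep n d \<rho> \<longleftrightarrow> is_rep n d \<rho> \<and>
     (\<forall>d1 \<rho>1 d2 \<rho>2 B F. is_rep n d1 \<rho>1 \<and> is_rep n d2 \<rho>2 \<and> gmap n d1 \<rho>1 d2 \<rho>2 B \<and> surj_mat d1 d2 B
        \<and> gmap n d \<rho> d2 \<rho>2 F \<longrightarrow> (\<exists>h. gmap n d \<rho> d1 \<rho>1 h \<and> B * h = F))"

definition projective_cover :: "nat \<Rightarrow> nat \<Rightarrow> ('f::field mat \<Rightarrow> 'k::field mat) \<Rightarrow> nat \<Rightarrow> ('f mat \<Rightarrow> 'k mat) \<Rightarrow> 'k mat \<Rightarrow> bool" where
  "projective_cover n d\<pi> \<rho>\<pi> dP \<rho>P e \<longleftrightarrow> is_rep n d\<pi> \<rho>\<pi> \<and> projective_rep n dP \<rho>P \<and>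
     gmap n dP \<rho>P d\<pi> \<rho>\<pi> e \<and> surj_mat dP d\<pi> e \<and>
     (\<forall>U. invariant_subspace n dP \<rho>P U \<and> (\<forall>w\<in>carrier_vec d\<pi>. \<exists>v\<in>U. e *\<^sub>v v = w) \<longrightarrow> U = carrier_vec dP)"

definition endo_ring :: "nat \<Rightarrow> nat \<Rightarrow> ('f::field mat \<Rightarrow> 'k::field mat) \<Rightarrow> 'k mat set" where
  "endo_ring n dP \<rho>P = {A. gmap n dP \<rho>P dP \<rho>P A}"

text \<open>R-linear maps from the (N_n,phi)-coinvariants of P to R, represented as R-linear maps
  P \<rightarrow> R vanishing on P(N_n,phi)\<close>
definition coinv_dual :: "nat \<Rightarrow> ('f::field \<Rightarrow> 'k::field) \<Rightarrow> nat \<Rightarrow> ('f mat \<Rightarrow> 'k mat) \<Rightarrow> ('k vec \<Rightarrow> 'k mat) \<Rightarrow> bool" where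
  "coinv_dual n \<phi> dP \<rho>P \<Lambda> \<longleftrightarrow>
     (\<forall>v\<in>carrier_vec dP. \<Lambda> v \<in> endo_ring n dP \<rho>P) \<and>
     (\<forall>v\<in>carrier_vec dP. \<forall>w\<in>carrier_vec dP. \<Lambda> (v + w) = \<Lambda> v + \<Lambda> w) \<and>
     (\<forall>A\<in>endo_ring n dP \<rho>P. \<forall>v\<in>carrier_vec dP. \<Lambda> (A *\<^sub>v v) = A * \<Lambda> v) \<and>
     (\<forall>v\<in>coinv_kernel n \<phi> dP \<rho>P. \<Lambda> v = 0\<^sub>m dP dP)"

definition coinv_dual_generator :: "nat \<Rightarrow> ('f::field \<Rightarrow> 'k::field) \<Rightarrow> nat \<Rightarrow> ('f mat \<Rightarrow> 'k mat) \<Rightarrow> ('k vec \<Rightarrow> 'k mat) \<Rightarrow> bool" where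
  "coinv_dual_generator n \<phi> dP \<rho>P \<Lambda> \<longleftrightarrow> coinv_dual n \<phi> dP \<rho>P \<Lambda> \<and>
     (\<forall>\<mu>. coinv_dual n \<phi> dP \<rho>P \<mu> \<longrightarrow>
        (\<exists>r\<in>endo_ring n dP \<rho>P. \<forall>v\<in>carrier_vec dP. \<mu> v = r * \<Lambda> v))"

definition whittaker_model :: "nat \<Rightarrow> ('f::field \<Rightarrow> 'k::field) \<Rightarrow> nat \<Rightarrow> ('f mat \<Rightarrow> 'k mat) \<Rightarrow> ('k vec \<Rightarrow> 'k mat) \<Rightarrow> ('f mat \<Rightarrow> 'k mat) set" where
  "whittaker_model n \<phi> dP \<rho>P \<Lambda> = {(\<lambda>g. \<Lambda> (\<rho>P g *\<^sub>v f)) | f. f \<in> carrier_vec dP}"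

definition right_cosets_N :: "nat \<Rightarrow> 'f::field mat set set" where
  "right_cosets_N n = (\<lambda>g. (\<lambda>u. u * g) ` Nn n) ` GLn n"

definition coset_rep :: "'a set \<Rightarrow> 'a" where
  "coset_rep C = (SOME x. x \<in> C)"

definition sum_NG :: "nat \<Rightarrow> nat \<Rightarrow> ('f::field mat \<Rightarrow> 'k::field) \<Rightarrow> ('f mat \<Rightarrow> 'k mat) \<Rightarrow> 'k mat" where
  "sum_NG n d H W = mat d d (\<lambda>(i,j). \<Sum>C\<in>right_cosets_N n. H (coset_rep C) * W (coset_rep C) $$ (i,j))"

end

theory Submission
  imports Defs "Jordan_Normal_Form.Determinant" "HOL-Algebra.Sylow"
begin

text \<open>
  Since \<open>|N|\<close> is prime to the characteristic of \<open>k\<close>, the \<open>(N, \<psi>\<^sup>-\<^sup>1)\<close>-coinvariants of a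
  representation \<open>V\<close> are \<open>e V\<close> for an idempotent \<open>e\<close> of \<open>k[G]\<close>, and \<open>e k[G] e\<close> is commutative by
  Bruhat decomposition and Gelfand's trick. A primitive idempotent \<open>f\<close> of \<open>e k[G] e\<close> is also primitive
  in \<open>k[G]\<close>; so \<open>P = k[G] f\<close> is the projective cover of a generic irreducible representation,
  \<open>e P = f k[G] f\<close> is free of rank one over \<open>R = f k[G] f\<close>, and the generator \<open>\<Lambda>\<close> of the dual is
  \<open>v \<mapsto> e v\<close>. For \<open>h = \<Sum>\<^sub>g H(g) g\<close>, which satisfies \<open>e h = h\<close>, the hypothesis becomes \<open>h k[G] f = 0\<close>
  for all such \<open>f\<close>, hence \<open>h k[G] e = 0\<close>. The coefficient at \<open>1\<close> of \<open>h a e\<close> is that of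
  \<open>e h a = h a\<close>, so every coefficient of \<open>h\<close> vanishes.
\<close>

section \<open>Linear algebra\<close>

text \<open>The hypothesis speaks of matrix representations, so each left ideal k[G] f must be given
  coordinates, and no decomposition into indecomposables is invoked. Minimal dimension takes its
  place: among the idempotents f of e k[G] e with h k[G] f nonzero, one with k[G] f of least
  dimension is primitive. That the map onto the irreducible quotient is essential rests on Fitting's
  lemma instead of the locality of f k[G] f. Primitivity passes from e k[G] e to k[G] because f g =
  g f = g and e f = f e = f give e g = g e = g. Commutativity enters the description of the dual
  twice: for x in e k[G] f it gives f x = x f = x, which identifies e P with f P, and it makes R
  commutative, so that every mu in the dual is mu(f) times the generator. Since e is the average of
  psi(u) u over N, the group N acts on e V through psi^-1. This fits the coinvariants taken of P,
  whereas genericity is tested with psi; conjugation by a diagonal matrix of alternating signs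
  reconciles the two.\<close>

no_notation fps_nth (infixl \<open>$\<close> 75)

text \<open>If \<open>m < d\<close>, zero columns and zero rows pad \<open>A\<close> and
  \<open>B\<close> to square matrices with the same product. A one-sided inverse of a square matrix
  is two-sided, but the last row of the padded \<open>B\<close> is zero.\<close>

lemma right_inverse_dim_le:
  fixes A :: "'k::field mat"
  assumes A: "A \<in> carrier_mat d m" and B: "B \<in> carrier_mat m d" and AB: "A * B = 1\<^sub>m d"
  shows "d \<le> m"
proof (rule ccontr)
  assume "\<not> d \<le> m"
  then have md: "m < d" by simp
  define A' where "A' = mat d d (\<lambda>(i,j). if j < m then A $$ (i,j) else 0)"
  define B' where "B' = mat d d (\<lambda>(i,j). if i < m then B $$ (i,j) else 0)"
  have c: "A' \<in> carrier_mat d d" "B' \<in> carrier_mat d d" by (auto simp: A'_def B'_def)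
  have "A' * B' = 1\<^sub>m d"
  proof (rule eq_matI)
    fix i j assume "i < dim_row (1\<^sub>m d :: 'k mat)" "j < dim_col (1\<^sub>m d :: 'k mat)"
    then have ij: "i < d" "j < d" by auto
    have "(A' * B') $$ (i,j) = (\<Sum>k\<in>{0..<d}. A' $$ (i,k) * B' $$ (k,j))"
      using ij c by (simp add: scalar_prod_def)
    also have "\<dots> = (\<Sum>k\<in>{0..<m}. A $$ (i,k) * B $$ (k,j))"
      using md ij by (intro sum.mono_neutral_cong_right) (auto simp: A'_def B'_def)
    also have "\<dots> = (A * B) $$ (i,j)" using A B ij by (simp add: scalar_prod_def)
    finally show "(A' * B') $$ (i,j) = (1\<^sub>m d :: 'k mat) $$ (i,j)" using AB by simp
  qed (use c in auto)
  then have BA: "B' * A' = 1\<^sub>m d" using mat_mult_left_right_inverse[OF c] by simp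
  have "(B' * A') $$ (d-1,d-1) = (\<Sum>k\<in>{0..<d}. B' $$ (d-1,k) * A' $$ (k,d-1))"
    using md c by (simp add: scalar_prod_def)
  also have "\<dots> = 0" using md by (intro sum.neutral) (auto simp: B'_def)
  finally show False using BA md by simp
qed

lemma surj_mat_right_inverse:
  fixes A :: "'k::field mat"
  assumes A: "A \<in> carrier_mat d2 d1" and s: "surj_mat d1 d2 A"
  obtains S where "S \<in> carrier_mat d1 d2" "A * S = 1\<^sub>m d2"
proof -
  have "\<forall>j. \<exists>v\<in>carrier_vec d1. A *\<^sub>v v = unit_vec d2 j"
    using s by (auto simp: surj_mat_def)
  then obtain v where v: "\<And>j. v j \<in> carrier_vec d1" "\<And>j. A *\<^sub>v v j = unit_vec d2 j" by metis
  define S where "S = mat d1 d2 (\<lambda>(i,j). v j $ i)"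
  have S: "S \<in> carrier_mat d1 d2" by (simp add: S_def)
  have cS: "col S j = v j" if "j < d2" for j
    using that v(1)[of j] by (intro eq_vecI) (auto simp: S_def)
  have "A * S = 1\<^sub>m d2"
  proof (rule eq_matI)
    fix i j assume "i < dim_row (1\<^sub>m d2 :: 'k mat)" "j < dim_col (1\<^sub>m d2 :: 'k mat)"
    then have ij: "i < d2" "j < d2" by auto
    have "(A * S) $$ (i,j) = (A *\<^sub>v v j) $ i" using ij A S cS by simp
    then show "(A * S) $$ (i,j) = (1\<^sub>m d2 :: 'k mat) $$ (i,j)" using ij by (simp add: v(2))
  qed (use A S in auto)
  then show ?thesis using S that by blast
qed

lemma surj_mat_dim_le:
  fixes A :: "'k::field mat"
  assumes "A \<in> carrier_mat d2 d1" "surj_mat d1 d2 A"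
  shows "d2 \<le> d1"
  using surj_mat_right_inverse[OF assms] right_inverse_dim_le assms(1) by metis

lemma surj_mat_square_inj:
  fixes A :: "'k::field mat"
  assumes A: "A \<in> carrier_mat d d" "surj_mat d d A" and v: "v \<in> carrier_vec d" "A *\<^sub>v v = 0\<^sub>v d"
  shows "v = 0\<^sub>v d"
proof -
  obtain S where S: "S \<in> carrier_mat d d" "A * S = 1\<^sub>m d" using surj_mat_right_inverse[OF A] .
  then have "S * A = 1\<^sub>m d" using mat_mult_left_right_inverse A by blast
  then have "v = (S * A) *\<^sub>v v" using v by simp
  also have "\<dots> = S *\<^sub>v (A *\<^sub>v v)" using S A v by simp
  finally show ?thesis using v S by auto
qed

section \<open>Subspaces and quotients in coordinates\<close>

lemma ksubspace_minus:
  fixes U :: "'k::field vec set"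
  assumes U: "ksubspace d U" and vw: "v \<in> U" "w \<in> U"
  shows "v - w \<in> U"
proof -
  have c: "v \<in> carrier_vec d" "w \<in> carrier_vec d" using U vw by (auto simp: ksubspace_def)
  have "(-1) \<cdot>\<^sub>v w \<in> U" using U vw by (auto simp: ksubspace_def)
  then have "v + (-1) \<cdot>\<^sub>v w \<in> U" using U vw by (auto simp: ksubspace_def)
  moreover have "v + (-1) \<cdot>\<^sub>v w = v - w" using c by (intro eq_vecI) auto
  ultimately show ?thesis by simp
qed

lemma mat_mult_zero_vec: "A \<in> carrier_mat r c \<Longrightarrow> A *\<^sub>v 0\<^sub>v c = (0\<^sub>v r :: 'k::field vec)"
  by (intro eq_vecI) auto

lemma vec_minus_eq_zero:
  fixes v w :: "'k::field vec"
  assumes "v \<in> carrier_vec d" "w \<in> carrier_vec d" "v - w = 0\<^sub>v d"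
  shows "v = w"
proof (rule eq_vecI)
  fix i assume i: "i < dim_vec w"
  have "v $ i - w $ i = (v - w) $ i" using i by simp
  also have "\<dots> = 0" using assms i by (simp only: assms(3)) simp
  finally show "v $ i = w $ i" by simp
qed (use assms in auto)

lemma mat_mult_vec_eq_imp_eq:
  fixes A B :: "'k::field mat"
  assumes "A \<in> carrier_mat d m" "B \<in> carrier_mat d m"
    and "\<And>v. v \<in> carrier_vec m \<Longrightarrow> A *\<^sub>v v = B *\<^sub>v v"
  shows "A = B"
proof (rule eq_matI)
  fix i j assume ij: "i < dim_row B" "j < dim_col B"
  then have "(A *\<^sub>v unit_vec m j) $ i = (B *\<^sub>v unit_vec m j) $ i" using assms by simp
  then show "A $$ (i,j) = B $$ (i,j)" using ij assms(1,2) by simp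
qed (use assms in auto)

text \<open>The pair \<open>(B, C)\<close> is grown one vector at a time: a vector of \<open>U\<close> outside the range of \<open>B\<close>
  is first moved into the kernel of \<open>C\<close>.\<close>
lemma ksubspace_parametrization:
  fixes U :: "'k::field vec set"
  assumes U: "ksubspace m U"
  obtains d B C where "B \<in> carrier_mat m d" "C \<in> carrier_mat d m" "C * B = 1\<^sub>m d"
    "U = {B *\<^sub>v w | w. w \<in> carrier_vec d}"
proof -
  define Q where "Q = (\<lambda>d. \<exists>B C. B \<in> carrier_mat m d \<and> C \<in> carrier_mat d m \<and> C * B = 1\<^sub>m d \<and>
    (\<forall>w\<in>carrier_vec d. B *\<^sub>v w \<in> U))"
  have Uc: "U \<subseteq> carrier_vec m" using U by (auto simp: ksubspace_def)
  have "Q 0"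
  proof -
    have "(0\<^sub>m m 0 *\<^sub>v w :: 'k vec) = 0\<^sub>v m" if "w \<in> carrier_vec 0" for w
      using that by (intro eq_vecI) (auto simp: scalar_prod_def)
    then have "\<forall>w\<in>carrier_vec 0. 0\<^sub>m m 0 *\<^sub>v w \<in> U" using U by (auto simp: ksubspace_def)
    moreover have "(0\<^sub>m 0 m * 0\<^sub>m m 0 :: 'k mat) = 1\<^sub>m 0" by (intro eq_matI) auto
    ultimately show ?thesis unfolding Q_def by (intro exI[of _ "0\<^sub>m m 0"] exI[of _ "0\<^sub>m 0 m"]) auto
  qed
  \<comment> \<open>The left inverse \<open>C\<close> bounds \<open>d\<close> by \<open>m\<close>,
    so a largest \<open>d\<close> with \<open>Q d\<close> exists.\<close>
  have "\<forall>y. Q y \<longrightarrow> y < m + 1"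
  proof (intro allI impI)
    fix d assume "Q d"
    then have "d \<le> m" using right_inverse_dim_le unfolding Q_def by blast
    then show "d < m + 1" by simp
  qed
  then have "\<exists>d. Q d \<and> (\<forall>y. Q y \<longrightarrow> y \<le> d)"
    using ex_has_greatest_nat[of Q 0 "\<lambda>x. x" "m + 1"] \<open>Q 0\<close> by simp
  then obtain d where Qd: "Q d" and mx: "\<And>d'. Q d' \<Longrightarrow> d' \<le> d" by blast
  obtain B C where B: "B \<in> carrier_mat m d" and C: "C \<in> carrier_mat d m" and CB: "C * B = 1\<^sub>m d"
    and BU: "\<And>w. w \<in> carrier_vec d \<Longrightarrow> B *\<^sub>v w \<in> U" using Qd unfolding Q_def by blast
  have "u \<in> {B *\<^sub>v w | w. w \<in> carrier_vec d}" if u: "u \<in> U" for u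
  proof (rule ccontr)
    assume nin: "u \<notin> {B *\<^sub>v w | w. w \<in> carrier_vec d}"
    have uc: "u \<in> carrier_vec m" using u Uc by auto
    define x where "x = u - B *\<^sub>v (C *\<^sub>v u)"
    have xU: "x \<in> U" unfolding x_def using ksubspace_minus[OF U u BU] C uc by auto
    have xc: "x \<in> carrier_vec m" using xU Uc by auto
    have "x \<noteq> 0\<^sub>v m"
    proof
      assume x0: "x = 0\<^sub>v m"
      have "u = B *\<^sub>v (C *\<^sub>v u)"
        using x0 uc B C unfolding x_def by - (rule vec_minus_eq_zero[of _ m], auto)
      moreover have "C *\<^sub>v u \<in> carrier_vec d" using C uc by auto
      ultimately show False using nin by blast
    qed
    then obtain i where i: "i < m" "x $ i \<noteq> 0" using xc
      by (metis carrier_vecD eq_vecI index_zero_vec(1) index_zero_vec(2))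
    have CBC: "C *\<^sub>v (B *\<^sub>v (C *\<^sub>v u)) = C *\<^sub>v u"
    proof -
      have "C *\<^sub>v (B *\<^sub>v (C *\<^sub>v u)) = (C * B) *\<^sub>v (C *\<^sub>v u)" using B C uc by simp
      then show ?thesis using CB C uc by simp
    qed
    have Cx: "C *\<^sub>v x = 0\<^sub>v d"
      unfolding x_def using CBC B C uc by (simp add: mult_minus_distrib_mat_vec[of _ d m])
    \<comment> \<open>Row \<open>i\<close> of the projection \<open>1 - B * C\<close>, scaled by the
      nonzero entry \<open>x $ i\<close>. The projection kills the columns of \<open>B\<close> and
      fixes \<open>x\<close>, so this functional vanishes on \<open>B\<close> and is 1 at
      \<open>x\<close>: it is the new row of the left inverse.\<close>
    define \<phi> where "\<phi> = mat 1 m (\<lambda>(_,j). ((1\<^sub>m m - B * C) $$ (i,j)) / x $ i)"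
    have M: "1\<^sub>m m - B * C \<in> carrier_mat m m" using B C by (auto simp: minus_carrier_mat)
    have rw: "row \<phi> 0 = (1 / x $ i) \<cdot>\<^sub>v row (1\<^sub>m m - B * C) i"
      using i M B C by (intro eq_vecI) (auto simp: \<phi>_def)
    have MB: "(1\<^sub>m m - B * C) * B = 0\<^sub>m m d"
    proof -
      have "(1\<^sub>m m - B * C) * B = 1\<^sub>m m * B - (B * C) * B"
        using B C by (intro minus_mult_distrib_mat) auto
      also have "(B * C) * B = B" using B C CB by simp
      finally show ?thesis using B by auto
    qed
    have Mx: "(1\<^sub>m m - B * C) *\<^sub>v x = x"
    proof -
      have "(1\<^sub>m m - B * C) *\<^sub>v x = 1\<^sub>m m *\<^sub>v x - (B * C) *\<^sub>v x"
        using B C xc by (intro minus_mult_distrib_mat_vec) auto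
      also have "(B * C) *\<^sub>v x = 0\<^sub>v m" using B C xc Cx by (simp add: mat_mult_zero_vec)
      finally show ?thesis using xc by auto
    qed
    have phiB: "row \<phi> 0 \<bullet> col B j = 0" if "j < d" for j
    proof -
      have "row \<phi> 0 \<bullet> col B j = (1 / x $ i) * (row (1\<^sub>m m - B * C) i \<bullet> col B j)"
        unfolding rw using M B i by (intro smult_scalar_prod_distrib[of _ m]) (auto simp: row_carrier_vec)
      also have "row (1\<^sub>m m - B * C) i \<bullet> col B j = ((1\<^sub>m m - B * C) * B) $$ (i,j)"
        using M B i that by simp
      finally show ?thesis using MB i that by simp
    qed
    have phix: "row \<phi> 0 \<bullet> x = 1"
    proof -
      have "row \<phi> 0 \<bullet> x = (1 / x $ i) * (row (1\<^sub>m m - B * C) i \<bullet> x)"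
        unfolding rw using M B i xc by (intro smult_scalar_prod_distrib[of _ m]) (auto simp: row_carrier_vec)
      also have "row (1\<^sub>m m - B * C) i \<bullet> x = ((1\<^sub>m m - B * C) *\<^sub>v x) $ i"
        using M B i by simp
      finally show ?thesis using Mx i by simp
    qed
    define B' where "B' = mat m (Suc d) (\<lambda>(r,j). if j < d then B $$ (r,j) else x $ r)"
    define C' where "C' = mat (Suc d) m (\<lambda>(r,j). if r < d then C $$ (r,j) else \<phi> $$ (0,j))"
    have B': "B' \<in> carrier_mat m (Suc d)" and C': "C' \<in> carrier_mat (Suc d) m"
      by (auto simp: B'_def C'_def)
    have colB: "col B' j = (if j < d then col B j else x)" if "j < Suc d" for j
      using that B xc by (intro eq_vecI) (auto simp: B'_def)
    have rowC: "row C' j = (if j < d then row C j else row \<phi> 0)" if "j < Suc d" for j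
      using that C by (intro eq_vecI) (auto simp: C'_def \<phi>_def)
    have "C' * B' = 1\<^sub>m (Suc d)"
    proof (rule eq_matI)
      fix r s assume "r < dim_row (1\<^sub>m (Suc d) :: 'k mat)" "s < dim_col (1\<^sub>m (Suc d) :: 'k mat)"
      then have rs: "r < Suc d" "s < Suc d" by auto
      have e: "(C' * B') $$ (r,s) = row C' r \<bullet> col B' s" using B' C' rs by simp
      have CBrs: "row C r \<bullet> col B s = (1\<^sub>m d :: 'k mat) $$ (r,s)" if "r < d" "s < d"
        using CB B C that by (metis index_mult_mat(1) carrier_matD)
      have Cxr: "row C r \<bullet> x = 0" if "r < d"
        using Cx C that by (metis carrier_matD(1) index_mult_mat_vec index_zero_vec(1))
      show "(C' * B') $$ (r,s) = (1\<^sub>m (Suc d) :: 'k mat) $$ (r,s)"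
        using rs CBrs Cxr phiB phix unfolding e by (auto simp: colB rowC)
    qed (use B' C' in auto)
    moreover have "B' *\<^sub>v w \<in> U" if w: "w \<in> carrier_vec (Suc d)" for w
    proof -
      define w' where "w' = vec d (\<lambda>j. w $ j)"
      have "B' *\<^sub>v w = B *\<^sub>v w' + (w $ d) \<cdot>\<^sub>v x"
        using w B xc by (intro eq_vecI) (auto simp: B'_def w'_def scalar_prod_def)
      moreover have "B *\<^sub>v w' \<in> U" by (rule BU) (simp add: w'_def)
      ultimately show ?thesis using U xU by (auto simp: ksubspace_def)
    qed
    ultimately have "Q (Suc d)" using B' C' unfolding Q_def by blast
    then show False using mx by fastforce
  qed
  then have "U = {B *\<^sub>v w | w. w \<in> carrier_vec d}" using BU by auto
  then show ?thesis using that B C CB by blast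
qed

text \<open>\<open>1 - B * C\<close> is a projection with kernel \<open>U\<close>, so its image is a
  complement of \<open>U\<close> and serves as the quotient. Coordinates on that image give both the
  quotient map \<open>Q\<close> and a section \<open>S\<close> of it.\<close>

lemma ksubspace_quotient:
  fixes U :: "'k::field vec set"
  assumes U: "ksubspace m U"
  obtains d Q S where "Q \<in> carrier_mat d m" "S \<in> carrier_mat m d" "Q * S = 1\<^sub>m d"
    "\<And>v. v \<in> carrier_vec m \<Longrightarrow> Q *\<^sub>v v = 0\<^sub>v d \<longleftrightarrow> v \<in> U"
proof -
  obtain r B C where B: "B \<in> carrier_mat m r" and C: "C \<in> carrier_mat r m" and CB: "C * B = 1\<^sub>m r"
    and UB: "U = {B *\<^sub>v w | w. w \<in> carrier_vec r}" using ksubspace_parametrization[OF U] .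
  define M where "M = 1\<^sub>m m - B * C"
  have M: "M \<in> carrier_mat m m" using B C by (auto simp: M_def minus_carrier_mat)
  have Mv: "M *\<^sub>v v = v - B *\<^sub>v (C *\<^sub>v v)" if "v \<in> carrier_vec m" for v
  proof -
    have "M *\<^sub>v v = 1\<^sub>m m *\<^sub>v v - (B * C) *\<^sub>v v"
      unfolding M_def using B C that by (intro minus_mult_distrib_mat_vec) auto
    then show ?thesis using B C that by simp
  qed
  have BCB: "B *\<^sub>v (C *\<^sub>v (B *\<^sub>v w)) = B *\<^sub>v w" if "w \<in> carrier_vec r" for w
  proof -
    have "C *\<^sub>v (B *\<^sub>v w) = (C * B) *\<^sub>v w" using B C that by simp
    then show ?thesis using CB that by simp
  qed
  have MU: "M *\<^sub>v v = 0\<^sub>v m \<longleftrightarrow> v \<in> U" if v: "v \<in> carrier_vec m" for v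
  proof
    assume "M *\<^sub>v v = 0\<^sub>v m"
    then have "v - B *\<^sub>v (C *\<^sub>v v) = 0\<^sub>v m" using Mv v by simp
    then have "v = B *\<^sub>v (C *\<^sub>v v)" using v B C by - (rule vec_minus_eq_zero[of _ m], auto)
    moreover have "C *\<^sub>v v \<in> carrier_vec r" using C v by auto
    ultimately show "v \<in> U" unfolding UB by blast
  next
    assume "v \<in> U"
    then show "M *\<^sub>v v = 0\<^sub>v m" using Mv[OF v] BCB B unfolding UB by auto
  qed
  define U' where "U' = {M *\<^sub>v v | v. v \<in> carrier_vec m}"
  have kU': "ksubspace m U'"
    unfolding ksubspace_def
  proof (intro conjI ballI allI)
    show "U' \<subseteq> carrier_vec m" using M by (auto simp: U'_def)
    show "0\<^sub>v m \<in> U'"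
      unfolding U'_def using M by (intro CollectI exI[of _ "0\<^sub>v m"]) (simp add: mat_mult_zero_vec)
  next
    fix v w assume "v \<in> U'" "w \<in> U'"
    then obtain a b where "a \<in> carrier_vec m" "b \<in> carrier_vec m" "v = M *\<^sub>v a" "w = M *\<^sub>v b"
      by (auto simp: U'_def)
    then have "v + w = M *\<^sub>v (a + b)" "a + b \<in> carrier_vec m"
      using M by (auto simp: mult_add_distrib_mat_vec)
    then show "v + w \<in> U'" unfolding U'_def by blast
  next
    fix c v assume "v \<in> U'"
    then obtain a where "a \<in> carrier_vec m" "v = M *\<^sub>v a" by (auto simp: U'_def)
    then have "c \<cdot>\<^sub>v v = M *\<^sub>v (c \<cdot>\<^sub>v a)" "c \<cdot>\<^sub>v a \<in> carrier_vec m" using M by (auto simp: mult_mat_vec)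
    then show "c \<cdot>\<^sub>v v \<in> U'" unfolding U'_def by blast
  qed
  obtain d B' C' where B': "B' \<in> carrier_mat m d" and C': "C' \<in> carrier_mat d m"
    and CB': "C' * B' = 1\<^sub>m d" and U'B: "U' = {B' *\<^sub>v w | w. w \<in> carrier_vec d}"
    using ksubspace_parametrization[OF kU'] .
  have MM: "M *\<^sub>v (M *\<^sub>v v) = M *\<^sub>v v" if v: "v \<in> carrier_vec m" for v
  proof -
    have BU: "B *\<^sub>v (C *\<^sub>v v) \<in> U" unfolding UB using C v by auto
    have c: "B *\<^sub>v (C *\<^sub>v v) \<in> carrier_vec m" using B C v by auto
    have "M *\<^sub>v (M *\<^sub>v v) = M *\<^sub>v v - M *\<^sub>v (B *\<^sub>v (C *\<^sub>v v))"
      using M v c by (subst Mv[OF v]) (rule mult_minus_distrib_mat_vec)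
    also have "M *\<^sub>v (B *\<^sub>v (C *\<^sub>v v)) = 0\<^sub>v m" using MU[OF c] BU by simp
    finally show ?thesis using M v by auto
  qed
  have MB: "M * B' = B'"
  proof (rule mat_mult_vec_eq_imp_eq[of _ m d])
    fix w :: "'k vec" assume w: "w \<in> carrier_vec d"
    then have "B' *\<^sub>v w \<in> U'" unfolding U'B by auto
    then obtain v where v: "v \<in> carrier_vec m" "B' *\<^sub>v w = M *\<^sub>v v" by (auto simp: U'_def)
    have "(M * B') *\<^sub>v w = M *\<^sub>v (B' *\<^sub>v w)" using M B' w by simp
    then show "(M * B') *\<^sub>v w = B' *\<^sub>v w" using v MM by simp
  qed (use M B' in auto)
  define Q where "Q = C' * M"
  have Q: "Q \<in> carrier_mat d m" using C' M by (auto simp: Q_def)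
  have "Q * B' = 1\<^sub>m d" unfolding Q_def using C' M B' MB CB' by simp
  moreover have "Q *\<^sub>v v = 0\<^sub>v d \<longleftrightarrow> v \<in> U" if v: "v \<in> carrier_vec m" for v
  proof -
    have e: "Q *\<^sub>v v = C' *\<^sub>v (M *\<^sub>v v)" unfolding Q_def using C' M v by simp
    have "M *\<^sub>v v \<in> U'" using v by (auto simp: U'_def)
    then obtain w where w: "w \<in> carrier_vec d" "M *\<^sub>v v = B' *\<^sub>v w" by (auto simp: U'B)
    have "Q *\<^sub>v v = (C' * B') *\<^sub>v w" using e w B' C' by simp
    then have "Q *\<^sub>v v = w" using CB' w by simp
    then have "Q *\<^sub>v v = 0\<^sub>v d \<Longrightarrow> M *\<^sub>v v = 0\<^sub>v m" using w B' by auto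
    moreover have "M *\<^sub>v v = 0\<^sub>v m \<Longrightarrow> Q *\<^sub>v v = 0\<^sub>v d" using e C' by auto
    ultimately show ?thesis using MU[OF v] by blast
  qed
  ultimately show ?thesis using that Q B' by blast
qed

lemma finite_carrier_mat: "finite (carrier_mat r c :: 'f::finite mat set)"
proof -
  have "carrier_mat r c \<subseteq> (\<lambda>f. mat r c f) ` (PiE ({..<r} \<times> {..<c}) (\<lambda>_. UNIV :: 'f set))"
  proof
    fix A :: "'f mat" assume A: "A \<in> carrier_mat r c"
    define f where "f = restrict (\<lambda>ij. A $$ ij) ({..<r} \<times> {..<c})"
    have "A = mat r c f" using A by (intro eq_matI) (auto simp: f_def)
    moreover have "f \<in> PiE ({..<r} \<times> {..<c}) (\<lambda>_. UNIV)" by (auto simp: f_def)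
    ultimately show "A \<in> (\<lambda>f. mat r c f) ` (PiE ({..<r} \<times> {..<c}) (\<lambda>_. UNIV))" by blast
  qed
  then show ?thesis by (rule finite_subset) (intro finite_imageI finite_PiE, auto)
qed

lemma ksubspace_sum:
  fixes U :: "'k::field vec set"
  assumes U: "ksubspace d U" and "finite T" and "\<And>g. g \<in> T \<Longrightarrow> F g \<in> U"
  shows "vec d (\<lambda>i. \<Sum>g\<in>T. F g $ i) \<in> U"
  using assms(2,3)
proof (induction T rule: finite_induct)
  case empty
  have "vec d (\<lambda>i. 0) = (0\<^sub>v d :: 'k vec)" by auto
  then show ?case using U by (simp add: ksubspace_def)
next
  case (insert g T)
  have "F g \<in> U" "F g \<in> carrier_vec d" using insert U by (auto simp: ksubspace_def)
  moreover have "vec d (\<lambda>i. \<Sum>g\<in>insert g T. F g $ i) = F g + vec d (\<lambda>i. \<Sum>g\<in>T. F g $ i)"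
    using insert \<open>F g \<in> carrier_vec d\<close> by (intro eq_vecI) auto
  ultimately show ?case using insert U by (simp add: ksubspace_def)
qed

lemma mat_mult_vec_sum:
  fixes A :: "'k::field mat"
  assumes A: "A \<in> carrier_mat r d" and F: "\<And>g. g \<in> T \<Longrightarrow> F g \<in> carrier_vec d"
  shows "A *\<^sub>v vec d (\<lambda>i. \<Sum>g\<in>T. F g $ i) = vec r (\<lambda>i. \<Sum>g\<in>T. (A *\<^sub>v F g) $ i)"
proof (rule eq_vecI)
  fix i assume "i < dim_vec (vec r (\<lambda>i. \<Sum>g\<in>T. (A *\<^sub>v F g) $ i))"
  then have i: "i < r" by simp
  have "(A *\<^sub>v vec d (\<lambda>i. \<Sum>g\<in>T. F g $ i)) $ i = (\<Sum>j\<in>{0..<d}. \<Sum>g\<in>T. A $$ (i,j) * F g $ j)"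
    using A i by (simp add: scalar_prod_def sum_distrib_left)
  also have "\<dots> = (\<Sum>g\<in>T. \<Sum>j\<in>{0..<d}. A $$ (i,j) * F g $ j)" by (rule sum.swap)
  also have "\<dots> = (\<Sum>g\<in>T. (A *\<^sub>v F g) $ i)"
  proof (rule sum.cong[OF refl])
    fix g assume "g \<in> T"
    then have "F g \<in> carrier_vec d" by (rule F)
    then show "(\<Sum>j\<in>{0..<d}. A $$ (i,j) * F g $ j) = (A *\<^sub>v F g) $ i"
      using A i by (simp add: scalar_prod_def)
  qed
  finally show "(A *\<^sub>v vec d (\<lambda>i. \<Sum>g\<in>T. F g $ i)) $ i = vec r (\<lambda>i. \<Sum>g\<in>T. (A *\<^sub>v F g) $ i) $ i"
    using i by simp
qed (use A in auto)

lemma kspan_ksubspace: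
  fixes S :: "'k::field vec set"
  assumes "S \<subseteq> carrier_vec d"
  shows "ksubspace d (kspan d S)"
proof -
  have "ksubspace d (carrier_vec d :: 'k vec set)" by (simp add: ksubspace_def)
  then have "kspan d S \<subseteq> carrier_vec d" using assms unfolding kspan_def by blast
  then show ?thesis unfolding ksubspace_def kspan_def by blast
qed

lemma kspan_superset: "S \<subseteq> kspan d S"
  unfolding kspan_def by blast

lemma kspan_minimal: "ksubspace d U \<Longrightarrow> S \<subseteq> U \<Longrightarrow> kspan d S \<subseteq> U"
  unfolding kspan_def by blast

section \<open>The group algebra of the general linear group\<close>

locale gl =
  fixes n :: nat and ty :: "'f::{finite,field} itself"
begin

abbreviation G :: "'f mat set" where "G \<equiv> GLn n"

lemma G_carrier: "g \<in> G \<Longrightarrow> g \<in> carrier_mat n n"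
  by (simp add: GLn_def)

lemma finite_G [simp, intro]: "finite G"
  by (rule finite_subset[OF _ finite_carrier_mat[of n n]]) (auto simp: GLn_def)

lemma G_I:
  assumes "A \<in> carrier_mat n n" "B \<in> carrier_mat n n" "A * B = 1\<^sub>m n"
  shows "(A :: 'f mat) \<in> G"
  using assms mat_mult_left_right_inverse[OF assms]
  unfolding GLn_def invertible_mat_def inverts_mat_def by auto

lemma G_inverse_ex:
  assumes g: "g \<in> G"
  shows "\<exists>h\<in>G. g * h = 1\<^sub>m n \<and> h * g = 1\<^sub>m n"
proof -
  have gc: "g \<in> carrier_mat n n" using g by (rule G_carrier)
  obtain B where B: "g * B = 1\<^sub>m n" "B * g = 1\<^sub>m (dim_row B)"
    using g gc unfolding GLn_def invertible_mat_def inverts_mat_def by auto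
  have "dim_col (g * B) = n" "dim_col (B * g) = dim_row B" using B by simp_all
  then have Bc: "B \<in> carrier_mat n n" using gc by auto
  then have "B \<in> G" using G_I[of B g] B gc by auto
  then show ?thesis using B Bc by auto
qed

lemma G_one [simp, intro]: "1\<^sub>m n \<in> G"
  by (rule G_I[of _ "1\<^sub>m n"]) auto

lemma G_assoc: "a \<in> G \<Longrightarrow> b \<in> G \<Longrightarrow> c \<in> G \<Longrightarrow> (a * b) * c = a * (b * c)"
  by (rule assoc_mult_mat[of _ n n _ n _ n]) (auto intro: G_carrier)

lemma G_mult [simp, intro]:
  assumes a: "a \<in> G" and b: "b \<in> G"
  shows "a * b \<in> G"
proof -
  obtain a' b' where i: "a' \<in> G" "a * a' = 1\<^sub>m n" "b' \<in> G" "b * b' = 1\<^sub>m n"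
    using G_inverse_ex a b by meson
  have c: "a \<in> carrier_mat n n" "b \<in> carrier_mat n n" "a' \<in> carrier_mat n n" "b' \<in> carrier_mat n n"
    using a b i by (auto intro: G_carrier)
  have "(a * b) * (b' * a') = a * (b * (b' * a'))"
    using c by (intro assoc_mult_mat[of _ n n _ n _ n]) auto
  also have "b * (b' * a') = (b * b') * a'"
    using c by (intro assoc_mult_mat[symmetric, of _ n n _ n _ n]) auto
  finally have "(a * b) * (b' * a') = 1\<^sub>m n" using i c by simp
  then show ?thesis using c by (intro G_I[of _ "b' * a'"]) auto
qed

definition ginv :: "'f mat \<Rightarrow> 'f mat" where
  "ginv g = (SOME h. h \<in> G \<and> g * h = 1\<^sub>m n \<and> h * g = 1\<^sub>m n)"

lemma ginv:
  assumes "g \<in> G"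
  shows ginv_G [simp, intro]: "ginv g \<in> G" and ginv_right [simp]: "g * ginv g = 1\<^sub>m n"
    and ginv_left [simp]: "ginv g * g = 1\<^sub>m n"
proof -
  have "\<exists>h. h \<in> G \<and> g * h = 1\<^sub>m n \<and> h * g = 1\<^sub>m n" using G_inverse_ex[OF assms] by auto
  from someI_ex[OF this]
  show "ginv g \<in> G" "g * ginv g = 1\<^sub>m n" "ginv g * g = 1\<^sub>m n" unfolding ginv_def by auto
qed

lemma G_one_left [simp]: "g \<in> G \<Longrightarrow> 1\<^sub>m n * g = g"
  by (auto dest: G_carrier)

lemma G_one_right [simp]: "g \<in> G \<Longrightarrow> g * 1\<^sub>m n = g"
  by (auto dest: G_carrier)

lemma ginv_cancel_left [simp]: "g \<in> G \<Longrightarrow> x \<in> G \<Longrightarrow> ginv g * (g * x) = x"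
  by (simp add: G_assoc[symmetric])

lemma ginv_cancel_left' [simp]: "g \<in> G \<Longrightarrow> x \<in> G \<Longrightarrow> g * (ginv g * x) = x"
  by (simp add: G_assoc[symmetric])

lemma ginv_cancel_right [simp]: "g \<in> G \<Longrightarrow> x \<in> G \<Longrightarrow> (x * g) * ginv g = x"
  by (simp add: G_assoc)

lemma ginv_cancel_right' [simp]: "g \<in> G \<Longrightarrow> x \<in> G \<Longrightarrow> (x * ginv g) * g = x"
  by (simp add: G_assoc)

lemma ginv_unique: "g \<in> G \<Longrightarrow> h \<in> G \<Longrightarrow> g * h = 1\<^sub>m n \<Longrightarrow> ginv g = h"
  by (metis ginv_cancel_left G_one_right ginv_G)

lemma ginv_ginv [simp]: "g \<in> G \<Longrightarrow> ginv (ginv g) = g"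
  by (rule ginv_unique) auto

lemma ginv_mult: "g \<in> G \<Longrightarrow> h \<in> G \<Longrightarrow> ginv (g * h) = ginv h * ginv g"
  by (rule ginv_unique) (auto simp: G_assoc)

lemma sum_G_left: "g \<in> G \<Longrightarrow> (\<Sum>x\<in>G. F (g * x)) = sum F G"
  by (rule sum.reindex_bij_witness[of _ "\<lambda>x. ginv g * x" "\<lambda>x. g * x"]) auto

lemma sum_G_right: "g \<in> G \<Longrightarrow> (\<Sum>x\<in>G. F (x * g)) = sum F G"
  by (rule sum.reindex_bij_witness[of _ "\<lambda>x. x * ginv g" "\<lambda>x. x * g"]) auto

lemma sum_G_inv: "(\<Sum>x\<in>G. F (ginv x)) = sum F G"
  by (rule sum.reindex_bij_witness[of _ ginv ginv]) auto

text \<open>Elements of the group algebra are functions on all matrices; a product always vanishes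
  outside \<open>G\<close>, so its laws hold as equalities of functions, and only the unit laws need \<open>supp\<close>.\<close>

definition conv :: "('f mat \<Rightarrow> 'k::field) \<Rightarrow> ('f mat \<Rightarrow> 'k) \<Rightarrow> 'f mat \<Rightarrow> 'k" (infixl \<open>\<star>\<close> 70) where
  "a \<star> b = (\<lambda>x. if x \<in> G then \<Sum>h\<in>G. a h * b (ginv h * x) else 0)"

definition supp :: "('f mat \<Rightarrow> 'k::field) \<Rightarrow> bool" where
  "supp a \<longleftrightarrow> (\<forall>x. x \<notin> G \<longrightarrow> a x = 0)"

definition dl :: "'f mat \<Rightarrow> 'f mat \<Rightarrow> 'k::field" where
  "dl g = (\<lambda>x. if x = g then 1 else 0)"

lemma supp_conv [simp, intro]: "supp (a \<star> b)"
  by (simp add: supp_def conv_def)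

lemma conv_assoc: "(a \<star> b) \<star> c = a \<star> (b \<star> c)"
proof
  fix x
  show "((a \<star> b) \<star> c) x = (a \<star> (b \<star> c)) x"
  proof (cases "x \<in> G")
    case x: True
    have "((a \<star> b) \<star> c) x = (\<Sum>h\<in>G. \<Sum>k\<in>G. a k * b (ginv k * h) * c (ginv h * x))"
      using x by (simp add: conv_def sum_distrib_right)
    also have "\<dots> = (\<Sum>k\<in>G. \<Sum>h\<in>G. a k * b (ginv k * h) * c (ginv h * x))" by (rule sum.swap)
    also have "\<dots> = (\<Sum>k\<in>G. \<Sum>h\<in>G. a k * b h * c (ginv h * (ginv k * x)))"
    proof (rule sum.cong[OF refl])
      fix k assume k: "k \<in> G"
      have "(\<Sum>h\<in>G. a k * b (ginv k * h) * c (ginv h * x)) =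
        (\<Sum>h\<in>G. a k * b (ginv k * (k * h)) * c (ginv (k * h) * x))"
        by (rule sum_G_left[OF k, symmetric])
      also have "\<dots> = (\<Sum>h\<in>G. a k * b h * c (ginv h * (ginv k * x)))"
        using k x by (intro sum.cong) (auto simp: ginv_mult G_assoc)
      finally show "(\<Sum>h\<in>G. a k * b (ginv k * h) * c (ginv h * x)) =
        (\<Sum>h\<in>G. a k * b h * c (ginv h * (ginv k * x)))" .
    qed
    also have "\<dots> = (a \<star> (b \<star> c)) x"
      using x by (simp add: conv_def sum_distrib_left mult.assoc)
    finally show ?thesis .
  qed (simp add: conv_def)
qed

lemma conv_add_left: "(\<lambda>x. a x + b x) \<star> c = (\<lambda>x. (a \<star> c) x + (b \<star> c) x)"
  by (simp add: conv_def fun_eq_iff distrib_left distrib_right sum.distrib)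

lemma conv_add_right: "c \<star> (\<lambda>x. a x + b x) = (\<lambda>x. (c \<star> a) x + (c \<star> b) x)"
  by (simp add: conv_def fun_eq_iff distrib_left distrib_right sum.distrib)

lemma conv_diff_left: "(\<lambda>x. a x - b x) \<star> c = (\<lambda>x. (a \<star> c) x - (b \<star> c) x)"
  by (simp add: conv_def fun_eq_iff left_diff_distrib right_diff_distrib sum_subtractf)

lemma conv_diff_right: "c \<star> (\<lambda>x. a x - b x) = (\<lambda>x. (c \<star> a) x - (c \<star> b) x)"
  by (simp add: conv_def fun_eq_iff left_diff_distrib right_diff_distrib sum_subtractf)

lemma conv_sum_left: "(\<lambda>x. \<Sum>j\<in>J. c j * a j x) \<star> b = (\<lambda>x. \<Sum>j\<in>J. c j * (a j \<star> b) x)"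
proof
  fix x show "((\<lambda>x. \<Sum>j\<in>J. c j * a j x) \<star> b) x = (\<Sum>j\<in>J. c j * (a j \<star> b) x)"
    by (auto simp: conv_def sum_distrib_left sum_distrib_right mult.assoc intro: sum.swap)
qed

lemma conv_sum_right: "b \<star> (\<lambda>x. \<Sum>j\<in>J. c j * a j x) = (\<lambda>x. \<Sum>j\<in>J. c j * (b \<star> a j) x)"
proof
  fix x show "(b \<star> (\<lambda>x. \<Sum>j\<in>J. c j * a j x)) x = (\<Sum>j\<in>J. c j * (b \<star> a j) x)"
    by (auto simp: conv_def sum_distrib_left sum_distrib_right mult_ac intro: sum.swap)
qed

lemma conv_zero_left [simp]: "(\<lambda>x. 0) \<star> a = (\<lambda>x. 0)"
  by (simp add: conv_def fun_eq_iff)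

lemma conv_zero_right [simp]: "a \<star> (\<lambda>x. 0) = (\<lambda>x. 0)"
  by (simp add: conv_def fun_eq_iff)

lemma conv_dl_left: "g \<in> G \<Longrightarrow> x \<in> G \<Longrightarrow> (dl g \<star> a) x = a (ginv g * x)"
  by (simp add: conv_def dl_def if_distrib[of "\<lambda>t. t * _"] cong: if_cong)

lemma conv_one_left:
  assumes "supp a"
  shows "dl (1\<^sub>m n) \<star> a = a"
proof
  fix x
  have "ginv (1\<^sub>m n) = 1\<^sub>m n" by (rule ginv_unique) auto
  then show "(dl (1\<^sub>m n) \<star> a) x = a x"
    using assms conv_dl_left[of "1\<^sub>m n" x a] by (cases "x \<in> G") (auto simp: supp_def conv_def)
qed

section \<open>Action of the group algebra on representations\<close>

definition ract :: "nat \<Rightarrow> ('f mat \<Rightarrow> 'k::field mat) \<Rightarrow> ('f mat \<Rightarrow> 'k) \<Rightarrow> 'k mat" where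
  "ract d \<rho> a = mat d d (\<lambda>(i,j). \<Sum>g\<in>G. a g * \<rho> g $$ (i,j))"

lemma ract_carrier [simp, intro]: "ract d \<rho> a \<in> carrier_mat d d"
  by (simp add: ract_def)

lemma is_repD:
  assumes "is_rep n d \<rho>"
  shows "g \<in> G \<Longrightarrow> \<rho> g \<in> carrier_mat d d" "g \<in> G \<Longrightarrow> h \<in> G \<Longrightarrow> \<rho> (g * h) = \<rho> g * \<rho> h"
    "\<rho> (1\<^sub>m n) = 1\<^sub>m d"
  using assms by (auto simp: is_rep_def)

lemma ract_conv:
  assumes r: "is_rep n d \<rho>"
  shows "ract d \<rho> (a \<star> b) = ract d \<rho> a * ract d \<rho> b"
proof (rule eq_matI)
  fix i j assume "i < dim_row (ract d \<rho> a * ract d \<rho> b)" "j < dim_col (ract d \<rho> a * ract d \<rho> b)"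
  then have ij: "i < d" "j < d" by (auto simp: ract_def)
  have "ract d \<rho> (a \<star> b) $$ (i,j) = (\<Sum>x\<in>G. \<Sum>h\<in>G. a h * b (ginv h * x) * \<rho> x $$ (i,j))"
    using ij by (simp add: ract_def conv_def sum_distrib_right)
  also have "\<dots> = (\<Sum>h\<in>G. \<Sum>x\<in>G. a h * b (ginv h * x) * \<rho> x $$ (i,j))" by (rule sum.swap)
  also have "\<dots> = (\<Sum>h\<in>G. \<Sum>y\<in>G. \<Sum>k<d. a h * b y * (\<rho> h $$ (i,k) * \<rho> y $$ (k,j)))"
  proof (rule sum.cong[OF refl])
    fix h assume h: "h \<in> G"
    have "(\<Sum>x\<in>G. a h * b (ginv h * x) * \<rho> x $$ (i,j)) =
      (\<Sum>y\<in>G. a h * b (ginv h * (h * y)) * \<rho> (h * y) $$ (i,j))"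
      by (rule sum_G_left[OF h, symmetric])
    also have "\<dots> = (\<Sum>y\<in>G. \<Sum>k<d. a h * b y * (\<rho> h $$ (i,k) * \<rho> y $$ (k,j)))"
    proof (rule sum.cong[OF refl])
      fix y assume y: "y \<in> G"
      have "\<rho> h \<in> carrier_mat d d" "\<rho> y \<in> carrier_mat d d" "\<rho> (h * y) = \<rho> h * \<rho> y"
        using is_repD(1,2)[OF r] h y by blast+
      then have "\<rho> (h * y) $$ (i,j) = (\<Sum>k<d. \<rho> h $$ (i,k) * \<rho> y $$ (k,j))"
        using ij by (simp add: scalar_prod_def lessThan_atLeast0)
      then show "a h * b (ginv h * (h * y)) * \<rho> (h * y) $$ (i,j) =
        (\<Sum>k<d. a h * b y * (\<rho> h $$ (i,k) * \<rho> y $$ (k,j)))"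
        using h y by (simp add: sum_distrib_left)
    qed
    finally show "(\<Sum>x\<in>G. a h * b (ginv h * x) * \<rho> x $$ (i,j)) =
      (\<Sum>y\<in>G. \<Sum>k<d. a h * b y * (\<rho> h $$ (i,k) * \<rho> y $$ (k,j)))" .
  qed
  also have "\<dots> = (\<Sum>h\<in>G. \<Sum>k<d. \<Sum>y\<in>G. a h * b y * (\<rho> h $$ (i,k) * \<rho> y $$ (k,j)))"
    by (rule sum.cong[OF refl], rule sum.swap)
  also have "\<dots> = (\<Sum>k<d. \<Sum>h\<in>G. \<Sum>y\<in>G. a h * b y * (\<rho> h $$ (i,k) * \<rho> y $$ (k,j)))"
    by (rule sum.swap)
  also have "\<dots> = (\<Sum>k<d. (\<Sum>h\<in>G. a h * \<rho> h $$ (i,k)) * (\<Sum>y\<in>G. b y * \<rho> y $$ (k,j)))"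
    by (intro sum.cong refl) (simp add: sum_product mult_ac)
  also have "\<dots> = (ract d \<rho> a * ract d \<rho> b) $$ (i,j)"
    using ij by (simp add: ract_def scalar_prod_def lessThan_atLeast0)
  finally show "ract d \<rho> (a \<star> b) $$ (i,j) = (ract d \<rho> a * ract d \<rho> b) $$ (i,j)" .
qed (auto simp: ract_def)

lemma ract_dl:
  assumes r: "is_rep n d \<rho>" and g: "g \<in> G"
  shows "ract d \<rho> (dl g) = \<rho> g"
  using is_repD(1)[OF r g] g
  by (intro eq_matI) (auto simp: ract_def dl_def if_distrib[of "\<lambda>t. t * _"] cong: if_cong)

lemma ract_one: "is_rep n d \<rho> \<Longrightarrow> ract d \<rho> (dl (1\<^sub>m n)) = 1\<^sub>m d"
  using ract_dl[of d \<rho> "1\<^sub>m n"] by (simp add: is_repD(3))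

lemma ract_zero: "ract d \<rho> (\<lambda>x. 0) = 0\<^sub>m d d"
  by (intro eq_matI) (auto simp: ract_def)

lemma ract_diff: "ract d \<rho> (\<lambda>x. a x - b x) = ract d \<rho> a - ract d \<rho> b"
  by (intro eq_matI) (auto simp: ract_def algebra_simps sum_subtractf)

lemma ract_vec:
  assumes r: "is_rep n d \<rho>" and v: "v \<in> carrier_vec d"
  shows "ract d \<rho> a *\<^sub>v v = vec d (\<lambda>i. \<Sum>g\<in>G. (a g \<cdot>\<^sub>v (\<rho> g *\<^sub>v v)) $ i)"
proof (rule eq_vecI)
  fix i assume "i < dim_vec (vec d (\<lambda>i. \<Sum>g\<in>G. (a g \<cdot>\<^sub>v (\<rho> g *\<^sub>v v)) $ i))"
  then have i: "i < d" by simp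
  have "(ract d \<rho> a *\<^sub>v v) $ i = (\<Sum>j<d. \<Sum>g\<in>G. a g * \<rho> g $$ (i,j) * v $ j)"
    using i v by (simp add: ract_def scalar_prod_def lessThan_atLeast0 sum_distrib_right)
  also have "\<dots> = (\<Sum>g\<in>G. \<Sum>j<d. a g * \<rho> g $$ (i,j) * v $ j)" by (rule sum.swap)
  also have "\<dots> = (\<Sum>g\<in>G. (a g \<cdot>\<^sub>v (\<rho> g *\<^sub>v v)) $ i)"
  proof (rule sum.cong[OF refl])
    fix g assume "g \<in> G"
    then have "\<rho> g \<in> carrier_mat d d" using is_repD[OF r] by auto
    then show "(\<Sum>j<d. a g * \<rho> g $$ (i,j) * v $ j) = (a g \<cdot>\<^sub>v (\<rho> g *\<^sub>v v)) $ i"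
      using i v by (simp add: scalar_prod_def lessThan_atLeast0 sum_distrib_left mult.assoc)
  qed
  finally show "(ract d \<rho> a *\<^sub>v v) $ i = vec d (\<lambda>i. \<Sum>g\<in>G. (a g \<cdot>\<^sub>v (\<rho> g *\<^sub>v v)) $ i) $ i"
    using i by simp
qed (simp add: ract_def)

lemma ract_invariant:
  assumes r: "is_rep n d \<rho>" and U: "invariant_subspace n d \<rho> U" and v: "v \<in> U"
  shows "ract d \<rho> a *\<^sub>v v \<in> U"
proof -
  have kU: "ksubspace d U" using U by (simp add: invariant_subspace_def)
  have vc: "v \<in> carrier_vec d" using kU v by (auto simp: ksubspace_def)
  show ?thesis
    unfolding ract_vec[OF r vc]
    by (rule ksubspace_sum[OF kU]) (use U kU v in \<open>auto simp: invariant_subspace_def ksubspace_def\<close>)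
qed

lemma gmap_ract:
  assumes r: "is_rep n d1 \<rho>1" "is_rep n d2 \<rho>2" and A: "gmap n d1 \<rho>1 d2 \<rho>2 A"
  shows "A * ract d1 \<rho>1 a = ract d2 \<rho>2 a * A"
proof (rule eq_matI)
  have Ac: "A \<in> carrier_mat d2 d1" using A by (simp add: gmap_def)
  fix i j assume "i < dim_row (ract d2 \<rho>2 a * A)" "j < dim_col (ract d2 \<rho>2 a * A)"
  then have ij: "i < d2" "j < d1" using Ac by (auto simp: ract_def)
  have "(A * ract d1 \<rho>1 a) $$ (i,j) = (\<Sum>k<d1. \<Sum>g\<in>G. a g * (A $$ (i,k) * \<rho>1 g $$ (k,j)))"
    using ij Ac by (simp add: ract_def scalar_prod_def lessThan_atLeast0 sum_distrib_left mult_ac)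
  also have "\<dots> = (\<Sum>g\<in>G. \<Sum>k<d1. a g * (A $$ (i,k) * \<rho>1 g $$ (k,j)))" by (rule sum.swap)
  also have "\<dots> = (\<Sum>g\<in>G. \<Sum>k<d2. a g * (\<rho>2 g $$ (i,k) * A $$ (k,j)))"
  proof (rule sum.cong[OF refl])
    fix g assume g: "g \<in> G"
    have c: "\<rho>1 g \<in> carrier_mat d1 d1" "\<rho>2 g \<in> carrier_mat d2 d2" using r g by (auto simp: is_rep_def)
    have "(A * \<rho>1 g) $$ (i,j) = (\<rho>2 g * A) $$ (i,j)" using A g by (simp add: gmap_def)
    then show "(\<Sum>k<d1. a g * (A $$ (i,k) * \<rho>1 g $$ (k,j))) =
      (\<Sum>k<d2. a g * (\<rho>2 g $$ (i,k) * A $$ (k,j)))"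
      using c ij Ac by (simp add: scalar_prod_def lessThan_atLeast0 sum_distrib_left[symmetric])
  qed
  also have "\<dots> = (\<Sum>k<d2. \<Sum>g\<in>G. a g * (\<rho>2 g $$ (i,k) * A $$ (k,j)))" by (rule sum.swap)
  also have "\<dots> = (ract d2 \<rho>2 a * A) $$ (i,j)"
    using ij Ac by (simp add: ract_def scalar_prod_def lessThan_atLeast0 sum_distrib_right mult.assoc)
  finally show "(A * ract d1 \<rho>1 a) $$ (i,j) = (ract d2 \<rho>2 a * A) $$ (i,j)" .
qed (use A in \<open>auto simp: gmap_def ract_def\<close>)

lemma gmap_ract_vec:
  assumes r: "is_rep n d1 \<rho>1" "is_rep n d2 \<rho>2" and A: "gmap n d1 \<rho>1 d2 \<rho>2 A"
    and v: "v \<in> carrier_vec d1"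
  shows "A *\<^sub>v (ract d1 \<rho>1 a *\<^sub>v v) = ract d2 \<rho>2 a *\<^sub>v (A *\<^sub>v v)"
proof -
  have Ac: "A \<in> carrier_mat d2 d1" using A by (simp add: gmap_def)
  have "A *\<^sub>v (ract d1 \<rho>1 a *\<^sub>v v) = (A * ract d1 \<rho>1 a) *\<^sub>v v"
    using Ac v by (intro assoc_mult_mat_vec[symmetric]) auto
  also have "\<dots> = ract d2 \<rho>2 a *\<^sub>v (A *\<^sub>v v)"
    unfolding gmap_ract[OF assms(1-3)] using Ac v by (intro assoc_mult_mat_vec) auto
  finally show ?thesis .
qed

lemma ract_conv_vec:
  assumes "is_rep n d \<rho>" "v \<in> carrier_vec d"
  shows "ract d \<rho> (a \<star> b) *\<^sub>v v = ract d \<rho> a *\<^sub>v (ract d \<rho> b *\<^sub>v v)"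
  unfolding ract_conv[OF assms(1)] using assms(2) by (intro assoc_mult_mat_vec) auto

end

section \<open>Commutativity of the Gelfand-Graev Hecke algebra\<close>

lemma inj_selfmap_surj:
  fixes \<sigma> :: "nat \<Rightarrow> nat"
  assumes "inj_on \<sigma> {..<n}" "\<And>i. i < n \<Longrightarrow> \<sigma> i < n"
  shows "\<sigma> ` {..<n} = {..<n}"
  using assms by (intro card_subset_eq) (auto simp: card_image)

text \<open>A permutation all of whose ascents are consecutive is a reversed sequence of increasing
  intervals, so its graph is symmetric about the antidiagonal.\<close>
lemma consecutive_ascents_symmetric:
  fixes \<sigma> :: "nat \<Rightarrow> nat" and t :: "nat \<Rightarrow> 'a"
  assumes inj: "inj_on \<sigma> {..<n}" and less: "\<And>i. i < n \<Longrightarrow> \<sigma> i < n"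
    and step: "\<And>i. i + 1 < n \<Longrightarrow> \<sigma> (i+1) < \<sigma> i \<or> (\<sigma> (i+1) = \<sigma> i + 1 \<and> t (i+1) = t i)"
    and i: "i < n"
  shows "\<sigma> (n - 1 - \<sigma> i) = n - 1 - i" "t (n - 1 - \<sigma> i) = t i"
proof -
  define Cs where "Cs = (\<lambda>k. \<sigma> (k+1) = \<sigma> k + 1 \<and> t (k+1) = t k)"
  have injD: "\<And>a b. a < n \<Longrightarrow> b < n \<Longrightarrow> \<sigma> a = \<sigma> b \<Longrightarrow> a = b" using inj by (auto dest: inj_onD)
  \<comment> \<open>Along a stretch of consecutive ascents \<open>\<sigma>\<close> is a translation
    and \<open>t\<close> is constant.\<close>
  have run: "\<sigma> (a + x) = \<sigma> a + x \<and> t (a + x) = t a"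
    if "\<And>k. a \<le> k \<Longrightarrow> k < b \<Longrightarrow> Cs k" "a + x \<le> b" for a b x
    using that(2)
  proof (induction x)
    case (Suc x)
    then have "Cs (a + x)" using that(1) by simp
    then show ?case using Suc by (simp add: Cs_def)
  qed simp
  \<comment> \<open>Two positions either lie in one stretch of consecutive ascents or are in
    decreasing order: leaving a stretch means dropping below all its values.\<close>
  have later: "(\<forall>k. a \<le> k \<longrightarrow> k < b \<longrightarrow> Cs k) \<or> \<sigma> b < \<sigma> a" if "a \<le> b" "b < n" for a b
    using that
  proof (induction b rule: nat_induct_at_least)
    case (Suc b)
    show ?case
    proof (cases "\<forall>k. a \<le> k \<longrightarrow> k < b \<longrightarrow> Cs k")
      case all: True
      show ?thesis
      proof (cases "Cs b")
        case True
        then show ?thesis using all by (auto simp: less_Suc_eq)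
      next
        case False
        then have lt: "\<sigma> (Suc b) < \<sigma> b" using step[of b] Suc by (auto simp: Cs_def)
        have rb: "\<sigma> (a + x) = \<sigma> a + x" if "x \<le> b - a" for x
          using run[of a b x] all that Suc by auto
        \<comment> \<open>The values from \<open>\<sigma> a\<close> to \<open>\<sigma> b\<close> are
          all taken on the positions \<open>a\<close> to \<open>b\<close>, so a value smaller than
          \<open>\<sigma> b\<close> at a new position has to fall below
          \<open>\<sigma> a\<close>.\<close>
        have "\<sigma> (Suc b) < \<sigma> a"
        proof (rule ccontr)
          assume ge: "\<not> \<sigma> (Suc b) < \<sigma> a"
          define x where "x = \<sigma> (Suc b) - \<sigma> a"
          have "\<sigma> b = \<sigma> a + (b - a)" using rb[of "b - a"] Suc by simp
          then have "x \<le> b - a" using lt by (simp add: x_def)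
          then have "\<sigma> (a + x) = \<sigma> a + x" by (rule rb)
          also have "\<dots> = \<sigma> (Suc b)" using ge by (simp add: x_def)
          finally have "\<sigma> (a + x) = \<sigma> (Suc b)" .
          then have "a + x = Suc b" using injD[of "a + x" "Suc b"] Suc \<open>x \<le> b - a\<close> by auto
          then show False using \<open>x \<le> b - a\<close> Suc by simp
        qed
        then show ?thesis by simp
      qed
    next
      case False
      then have lt: "\<sigma> b < \<sigma> a" using Suc by auto
      have ne: "\<sigma> (Suc b) \<noteq> \<sigma> a" using injD[of "Suc b" a] Suc by auto
      show ?thesis using step[of b] Suc lt ne by auto
    qed
  qed auto
  \<comment> \<open>\<open>s\<close> is the start of the maximal stretch through \<open>i\<close>;
    \<open>e\<close> below is its end.\<close>
  have "\<exists>s\<le>i. (\<forall>k. s \<le> k \<longrightarrow> k < i \<longrightarrow> Cs k) \<and> (s = 0 \<or> \<not> Cs (s - 1))"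
  proof (induction i)
    case (Suc i)
    then obtain s where s: "s \<le> i" "\<And>k. s \<le> k \<Longrightarrow> k < i \<Longrightarrow> Cs k" "s = 0 \<or> \<not> Cs (s - 1)" by blast
    show ?case
    proof (cases "Cs i")
      case True
      then show ?thesis using s by (intro exI[of _ s]) (auto simp: less_Suc_eq)
    next
      case False
      then show ?thesis by (intro exI[of _ "Suc i"]) auto
    qed
  qed auto
  then obtain s where s: "s \<le> i" "\<And>k. s \<le> k \<Longrightarrow> k < i \<Longrightarrow> Cs k" "s = 0 \<or> \<not> Cs (s - 1)" by blast
  have "i \<le> n - 1" using i by simp
  then have "\<exists>e. i \<le> e \<and> e \<le> n - 1 \<and> (\<forall>k. i \<le> k \<longrightarrow> k < e \<longrightarrow> Cs k) \<and> (e = n - 1 \<or> \<not> Cs e)"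
  proof (induction i rule: inc_induct)
    case (step m)
    then obtain e where e: "Suc m \<le> e" "e \<le> n - 1" "\<And>k. Suc m \<le> k \<Longrightarrow> k < e \<Longrightarrow> Cs k"
      "e = n - 1 \<or> \<not> Cs e" by blast
    show ?case
    proof (cases "Cs m")
      case True
      have "Cs k" if "m \<le> k" "k < e" for k
        using that True e(3)[of k] by (cases "k = m") auto
      then show ?thesis using e by (intro exI[of _ e]) auto
    next
      case False
      then show ?thesis using step by (intro exI[of _ m]) auto
    qed
  qed (intro exI[of _ "n - 1"], auto)
  then obtain e where e: "i \<le> e" "e \<le> n - 1" "\<And>k. i \<le> k \<Longrightarrow> k < e \<Longrightarrow> Cs k"
    "e = n - 1 \<or> \<not> Cs e" by blast
  have en: "e < n" using e i by simp
  have all: "Cs k" if "s \<le> k" "k < e" for k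
    using s(2)[of k] e(3)[of k] that by (cases "k < i") auto
  have R: "\<sigma> (s + x) = \<sigma> s + x" "t (s + x) = t s" if "s + x \<le> e" for x
    using run[of s e x] all that by auto
  have after: "\<sigma> j < \<sigma> s" if "e < j" "j < n" for j
    using later[of s j] that s(1) e(1,4) en by auto
  have before: "\<sigma> e < \<sigma> j" if "j < s" for j
  proof -
    have "\<not> Cs (s - 1)" using s(3) that by auto
    moreover have "j \<le> s - 1" "s - 1 < e" using that s(1) e(1) by auto
    ultimately show ?thesis using later[of j e] en that by (meson le_trans less_imp_le)
  qed
  have se: "\<sigma> e = \<sigma> s + (e - s)" using R(1)[of "e - s"] s e by simp
  \<comment> \<open>Positions before the stretch take larger values than the stretch and positions
    after it take smaller ones. Counting the values above \<open>\<sigma> e\<close> therefore gives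
    \<open>s = n - 1 - \<sigma> e\<close>, which is the reflection of the stretch in the
    antidiagonal.\<close>
  have "\<sigma> ` {..<s} = {\<sigma> e<..<n}"
  proof
    show "\<sigma> ` {..<s} \<subseteq> {\<sigma> e<..<n}" using before less s(1) i by auto
    show "{\<sigma> e<..<n} \<subseteq> \<sigma> ` {..<s}"
    proof
      fix y assume y: "y \<in> {\<sigma> e<..<n}"
      then have "y \<in> \<sigma> ` {..<n}" using inj_selfmap_surj[OF inj less] by auto
      then obtain j where j: "j < n" "y = \<sigma> j" by auto
      have "j < s"
      proof (rule ccontr)
        assume "\<not> j < s"
        show False
        proof (cases "j \<le> e")
          case True
          then have "\<sigma> j = \<sigma> s + (j - s)" using R(1)[of "j - s"] \<open>\<not> j < s\<close> by simp
          then show False using se y j True by auto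
        next
          case False
          then show False using after[of j] se y j by auto
        qed
      qed
      then show "y \<in> \<sigma> ` {..<s}" using j by auto
    qed
  qed
  moreover have "inj_on \<sigma> {..<s}" by (rule inj_on_subset[OF inj]) (use s(1) i in auto)
  then have "card (\<sigma> ` {..<s}) = s" by (simp add: card_image)
  ultimately have "s = n - 1 - \<sigma> e" by simp
  then have ve: "\<sigma> e + s + 1 = n" using less[OF en] by simp
  have si: "\<sigma> i = \<sigma> s + (i - s)" "t i = t s" using R[of "i - s"] s e by auto
  have i': "n - 1 - \<sigma> i = s + (e - i)" using ve se si s e by simp
  show "\<sigma> (n - 1 - \<sigma> i) = n - 1 - i" unfolding i' using R(1)[of "e - i"] s e ve se by simp
  show "t (n - 1 - \<sigma> i) = t i" unfolding i' using R(2)[of "e - i"] s e si by simp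
qed

context gl
begin

section \<open>The unipotent subgroup, its character and the antidiagonal reflection\<close>

abbreviation N :: "'f mat set" where "N \<equiv> Nn n"

lemma N_carrier: "u \<in> N \<Longrightarrow> u \<in> carrier_mat n n"
  by (simp add: Nn_def)

lemma finite_N [simp, intro]: "finite N"
  by (rule finite_subset[OF _ finite_carrier_mat[of n n]]) (auto simp: Nn_def)

lemma N_G [simp, intro]:
  assumes u: "u \<in> N"
  shows "u \<in> G"
proof -
  have uc: "u \<in> carrier_mat n n" using u by (rule N_carrier)
  have "det u = prod_list (diag_mat u)"
    using u uc by (intro det_upper_triangular) (auto simp: Nn_def upper_triangular_def)
  also have "diag_mat u = map (\<lambda>_. 1) [0..<n]"
    using u uc by (auto simp: diag_mat_def Nn_def)
  finally have "det u = 1" by (simp add: prod_list_replicate map_replicate_const)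
  then have "u \<in> Units (ring_mat TYPE('f) n ())" using det_non_zero_imp_unit[OF uc] by simp
  then obtain B where "B \<in> carrier_mat n n" "u * B = 1\<^sub>m n"
    by (auto simp: Units_def ring_mat_def)
  then show ?thesis using G_I uc by blast
qed

lemma N_one [simp, intro]: "1\<^sub>m n \<in> N"
  by (auto simp: Nn_def)

lemma N_mult_entry:
  assumes u: "u \<in> N" and v: "v \<in> N" and ij: "i < n" "j < n"
  shows "(u * v) $$ (i,j) = (\<Sum>k\<in>{i..j}. u $$ (i,k) * v $$ (k,j))"
proof -
  have "(u * v) $$ (i,j) = (\<Sum>k\<in>{0..<n}. u $$ (i,k) * v $$ (k,j))"
    using N_carrier[OF u] N_carrier[OF v] ij by (simp add: scalar_prod_def)
  also have "\<dots> = (\<Sum>k\<in>{i..j}. u $$ (i,k) * v $$ (k,j))"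
    using u v ij by (intro sum.mono_neutral_right) (auto simp: Nn_def not_le)
  finally show ?thesis .
qed

lemma N_mult [simp, intro]:
  assumes u: "u \<in> N" and v: "v \<in> N"
  shows "u * v \<in> N"
proof -
  have "u * v \<in> carrier_mat n n" using N_carrier[OF u] N_carrier[OF v] by auto
  moreover have "(u * v) $$ (i,i) = 1" if "i < n" for i
    using N_mult_entry[OF u v that that] u v that by (simp add: Nn_def)
  moreover have "(u * v) $$ (i,j) = 0" if "i < n" "j < i" for i j
    using N_mult_entry[OF u v, of i j] that by simp
  ultimately show ?thesis by (auto simp: Nn_def)
qed

text \<open>Left multiplication by \<open>u\<close> is an injective self-map of the finite set
  \<open>N\<close>, hence hits the identity. No inverse of a triangular matrix has to be
  computed.\<close>

lemma N_inv [simp, intro]: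
  assumes u: "u \<in> N"
  shows "ginv u \<in> N"
proof -
  have "inj_on (\<lambda>x. u * x) N"
    using u by (metis (no_types, lifting) N_G ginv_cancel_left inj_onI)
  then have "(\<lambda>x. u * x) ` N = N"
    using u by (intro card_subset_eq) (auto simp: card_image)
  then obtain x where "x \<in> N" "u * x = 1\<^sub>m n" using N_one by (metis (no_types, lifting) imageE)
  then show ?thesis using ginv_unique[of u x] u by auto
qed

text \<open>In the product of unitriangular matrices only the indices \<open>i\<close> and
  \<open>i + 1\<close> contribute to the entry \<open>(i, i+1)\<close>, so superdiagonals
  add.\<close>

lemma psiN_mult:
  assumes add: "\<And>a b. \<psi> (a + b) = \<psi> a * \<psi> b" and u: "u \<in> N" and v: "v \<in> N"
  shows "psiN \<psi> n (u * v) = psiN \<psi> n u * psiN \<psi> n v"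
proof -
  have "(u * v) $$ (i,i+1) = u $$ (i,i+1) + v $$ (i,i+1)" if "i < n - 1" for i
  proof -
    have e: "{i..i+1} = {i,i+1}" by auto
    show ?thesis using N_mult_entry[OF u v, of i "i+1"] that u v unfolding e by (simp add: Nn_def)
  qed
  then have "(\<Sum>i<n-1. (u * v) $$ (i,i+1)) = (\<Sum>i<n-1. u $$ (i,i+1)) + (\<Sum>i<n-1. v $$ (i,i+1))"
    by (simp add: sum.distrib)
  then show ?thesis by (simp add: psiN_def add)
qed

text \<open>This is w g^T w with w the antidiagonal permutation matrix. Transposition reverses
  products but makes upper triangular matrices lower triangular; conjugation by w brings
  \<open>N\<close> back and only reverses the order of the superdiagonal, which \<open>psiN\<close>
  does not see.\<close>

definition tau :: "'f mat \<Rightarrow> 'f mat" where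
  "tau g = mat n n (\<lambda>(i,j). g $$ (n - 1 - j, n - 1 - i))"

lemma tau_carrier [simp, intro]: "tau g \<in> carrier_mat n n"
  by (simp add: tau_def)

lemma tau_tau: "g \<in> carrier_mat n n \<Longrightarrow> tau (tau g) = g"
  by (intro eq_matI) (auto simp: tau_def)

lemma tau_one: "tau (1\<^sub>m n) = 1\<^sub>m n"
  by (intro eq_matI) (auto simp: tau_def)

lemma tau_mult:
  assumes a: "a \<in> carrier_mat n n" and b: "b \<in> carrier_mat n n"
  shows "tau (a * b) = tau b * tau a"
proof (rule eq_matI)
  fix i j assume "i < dim_row (tau b * tau a)" "j < dim_col (tau b * tau a)"
  then have ij: "i < n" "j < n" by (auto simp: tau_def)
  have "tau (a * b) $$ (i,j) = (\<Sum>k\<in>{0..<n}. a $$ (n-1-j,k) * b $$ (k,n-1-i))"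
    using ij a b by (simp add: tau_def scalar_prod_def)
  also have "\<dots> = (\<Sum>k\<in>{0..<n}. b $$ (n-1-k,n-1-i) * a $$ (n-1-j,n-1-k))"
    using ij by (intro sum.reindex_bij_witness[of _ "\<lambda>k. n-1-k" "\<lambda>k. n-1-k"]) (auto simp: mult.commute)
  also have "\<dots> = (tau b * tau a) $$ (i,j)"
    using ij by (simp add: tau_def scalar_prod_def)
  finally show "tau (a * b) $$ (i,j) = (tau b * tau a) $$ (i,j)" .
qed (auto simp: tau_def)

lemma tau_G [simp, intro]:
  assumes g: "g \<in> G"
  shows "tau g \<in> G"
proof (rule G_I[of _ "tau (ginv g)"])
  show "tau g * tau (ginv g) = 1\<^sub>m n"
    using tau_mult[of "ginv g" g] g by (simp add: tau_one G_carrier)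
qed auto

lemma tau_inv: "g \<in> G \<Longrightarrow> tau (ginv g) = ginv (tau g)"
  by (rule ginv_unique[symmetric]) (auto simp: tau_mult[symmetric] tau_one G_carrier)

lemma tau_N [simp, intro]: "u \<in> N \<Longrightarrow> tau u \<in> N"
  by (auto simp: Nn_def tau_def)

lemma psiN_tau: "psiN \<psi> n (tau u) = psiN \<psi> n u"
proof -
  have "(\<Sum>i<n-1. tau u $$ (i,i+1)) = (\<Sum>i<n-1. u $$ (i,i+1))"
    by (rule sum.reindex_bij_witness[of _ "\<lambda>k. n-2-k" "\<lambda>k. n-2-k"]) (auto simp: tau_def Suc_diff_Suc numeral_2_eq_2)
  then show ?thesis by (simp add: psiN_def)
qed

lemma sum_G_tau: "(\<Sum>x\<in>G. F (tau x)) = sum F G"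
  by (rule sum.reindex_bij_witness[of _ tau tau]) (auto simp: tau_tau G_carrier)

text \<open>The identity plus the vector \<open>c\<close> in column \<open>i\<close>: left
  multiplication performs all row operations with pivot row \<open>i\<close> at once.
  \<open>colop\<close> does the same from the right with pivot column \<open>k\<close>.\<close>

definition rowop :: "(nat \<Rightarrow> 'f) \<Rightarrow> nat \<Rightarrow> 'f mat" where
  "rowop c i = mat n n (\<lambda>(a,b). (if a = b then 1 else 0) + (if b = i then c a else 0))"

definition colop :: "(nat \<Rightarrow> 'f) \<Rightarrow> nat \<Rightarrow> 'f mat" where
  "colop c k = mat n n (\<lambda>(a,b). (if a = b then 1 else 0) + (if a = k then c b else 0))"

lemma rowop_N: "(\<And>a. i \<le> a \<Longrightarrow> c a = 0) \<Longrightarrow> rowop c i \<in> N"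
  by (auto simp: Nn_def rowop_def)

lemma colop_N: "(\<And>b. b \<le> k \<Longrightarrow> c b = 0) \<Longrightarrow> colop c k \<in> N"
  by (auto simp: Nn_def colop_def)

lemma rowop_entry:
  assumes m: "m \<in> carrier_mat n n" and "a < n" "b < n" "i < n"
  shows "(rowop c i * m) $$ (a,b) = m $$ (a,b) + c a * m $$ (i,b)"
proof -
  have "(rowop c i * m) $$ (a,b) =
    (\<Sum>k\<in>{0..<n}. (if a = k then m $$ (k,b) else 0) + (if k = i then c a * m $$ (k,b) else 0))"
    using assms by (auto simp: rowop_def scalar_prod_def algebra_simps intro!: sum.cong)
  then show ?thesis using assms by (simp add: sum.distrib)
qed

lemma colop_entry:
  assumes m: "m \<in> carrier_mat n n" and "a < n" "b < n" "k < n"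
  shows "(m * colop c k) $$ (a,b) = m $$ (a,b) + m $$ (a,k) * c b"
proof -
  have "(m * colop c k) $$ (a,b) =
    (\<Sum>j\<in>{0..<n}. (if j = b then m $$ (a,j) else 0) + (if j = k then m $$ (a,j) * c b else 0))"
    using assms by (auto simp: colop_def scalar_prod_def algebra_simps intro!: sum.cong)
  then show ?thesis using assms by (simp add: sum.distrib)
qed

lemma psiN_rowop: "i + 1 < n \<Longrightarrow> psiN \<psi> n (rowop c (i+1)) = \<psi> (c i)"
proof -
  assume i: "i + 1 < n"
  have "(\<Sum>a<n-1. rowop c (i+1) $$ (a,a+1)) = (\<Sum>a<n-1. if a = i then c a else 0)"
    by (intro sum.cong) (auto simp: rowop_def)
  moreover have "i < n - 1" using i by simp
  ultimately show ?thesis by (simp add: psiN_def)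
qed

lemma psiN_colop: "k + 1 < n \<Longrightarrow> psiN \<psi> n (colop c k) = \<psi> (c (k+1))"
proof -
  assume k: "k + 1 < n"
  have "(\<Sum>a<n-1. colop c k $$ (a,a+1)) = (\<Sum>a<n-1. if a = k then c (a+1) else 0)"
    by (intro sum.cong) (auto simp: colop_def)
  moreover have "k < n - 1" using k by simp
  ultimately show ?thesis by (simp add: psiN_def)
qed

definition monomial_perm :: "(nat \<Rightarrow> nat) \<Rightarrow> 'f mat \<Rightarrow> bool" where
  "monomial_perm \<sigma> m \<longleftrightarrow> m \<in> carrier_mat n n \<and> inj_on \<sigma> {..<n} \<and> (\<forall>i<n. \<sigma> i < n) \<and>
     (\<forall>i<n. \<forall>j<n. m $$ (i,j) \<noteq> 0 \<longleftrightarrow> j = \<sigma> i)"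

text \<open>Bruhat decomposition by Gaussian elimination, one column at a time: the lowest nonzero entry
  of the column is used to clear the column above it and the row to its right.\<close>
lemma bruhat:
  assumes g: "g \<in> G"
  shows "\<exists>u\<in>N. \<exists>v\<in>N. \<exists>\<sigma>. monomial_perm \<sigma> (u * g * v)"
proof -
  \<comment> \<open>In the first \<open>k\<close> columns each column \<open>c\<close> has its only
    nonzero entry in row \<open>r c\<close>, and that row has no other nonzero entry.\<close>
  define Cl where "Cl = (\<lambda>k m r. \<forall>c<k. r c < n \<and> (\<forall>i<n. (m :: 'f mat) $$ (i,c) \<noteq> 0 \<longleftrightarrow> i = r c) \<and>
    (\<forall>j<n. m $$ (r c,j) \<noteq> 0 \<longleftrightarrow> j = c))"
  have "\<exists>u\<in>N. \<exists>v\<in>N. \<exists>r. Cl k (u * g * v) r" if "k \<le> n" for k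
    using that
  proof (induction k)
    case 0
    show ?case by (intro bexI[of _ "1\<^sub>m n"]) (auto simp: Cl_def)
  next
    case (Suc k)
    then obtain u v r where uv: "u \<in> N" "v \<in> N" and "Cl k (u * g * v) r" by auto
    moreover define m where "m = u * g * v"
    ultimately have r: "\<And>c. c < k \<Longrightarrow> r c < n" and
      col: "\<And>c i. c < k \<Longrightarrow> i < n \<Longrightarrow> m $$ (i,c) \<noteq> 0 \<longleftrightarrow> i = r c" and
      row: "\<And>c j. c < k \<Longrightarrow> j < n \<Longrightarrow> m $$ (r c,j) \<noteq> 0 \<longleftrightarrow> j = c" by (auto simp: Cl_def)
    have k: "k < n" using Suc by simp
    have mG: "m \<in> G" using uv g by (auto simp: m_def)
    have mc: "m \<in> carrier_mat n n" using mG by (rule G_carrier)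
    define I where "I = {i. i < n \<and> m $$ (i,k) \<noteq> 0}"
    have fI: "finite I" by (simp add: I_def)
    have "I \<noteq> {}"
    proof
      assume e: "I = {}"
      have ic: "ginv m \<in> carrier_mat n n" using mG by (auto intro: G_carrier)
      have "(ginv m * m) $$ (k,k) = (\<Sum>i\<in>{0..<n}. ginv m $$ (k,i) * m $$ (i,k))"
        using mc ic k by (simp add: scalar_prod_def)
      also have "\<dots> = 0" using e by (intro sum.neutral) (auto simp: I_def)
      finally show False using mG k by simp
    qed
    \<comment> \<open>The pivot must be the lowest nonzero entry: left multiplication by
      \<open>N\<close> adds multiples of a row only to the rows above it.\<close>
    define i where "i = Max I"
    have i: "i < n" "m $$ (i,k) \<noteq> 0" using Max_in[OF fI \<open>I \<noteq> {}\<close>] by (auto simp: i_def I_def)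
    have below: "m $$ (a,k) = 0" if "i < a" "a < n" for a
      using that Max_ge[OF fI, of a] by (auto simp: i_def I_def not_le[symmetric])
    have ri: "r c \<noteq> i" if "c < k" for c using row[OF that k] i that by auto
    have mi0: "m $$ (i,c) = 0" if "c < k" for c using col[OF that i(1)] ri[OF that] by auto
    define cu where "cu = (\<lambda>a. if a < i then - m $$ (a,k) / m $$ (i,k) else 0)"
    define cv where "cv = (\<lambda>b. if k < b then - m $$ (i,b) / m $$ (i,k) else 0)"
    define U where "U = rowop cu i"
    define V where "V = colop cv k"
    have UV: "U \<in> N" "V \<in> N" by (auto simp: U_def V_def cu_def cv_def intro: rowop_N colop_N)
    define Z where "Z = U * m"
    have Zc: "Z \<in> carrier_mat n n" using UV mc by (auto simp: Z_def dest: N_carrier)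
    have Z: "Z $$ (a,b) = m $$ (a,b) + cu a * m $$ (i,b)" if "a < n" "b < n" for a b
      unfolding Z_def U_def using rowop_entry[OF mc that i(1)] .
    have M: "(Z * V) $$ (a,b) = Z $$ (a,b) + Z $$ (a,k) * cv b" if "a < n" "b < n" for a b
      unfolding V_def using colop_entry[OF Zc that k] .
    have Zk: "Z $$ (a,k) = (if a = i then m $$ (i,k) else 0)" if "a < n" for a
      using Z[OF that k] below[of a] i that by (auto simp: cu_def)
    have Zi: "Z $$ (i,b) = m $$ (i,b)" if "b < n" for b using Z[OF i(1) that] by (simp add: cu_def)
    define r' where "r' = r(k := i)"
    have "Cl (Suc k) (Z * V) r'"
      unfolding Cl_def
    proof (intro allI impI)
      fix c assume "c < Suc k"
      then consider "c = k" | "c < k" by linarith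
      then show "r' c < n \<and> (\<forall>a<n. (Z * V) $$ (a,c) \<noteq> 0 \<longleftrightarrow> a = r' c) \<and>
        (\<forall>j<n. (Z * V) $$ (r' c,j) \<noteq> 0 \<longleftrightarrow> j = c)"
      proof cases
        case 1
        have "(Z * V) $$ (a,k) \<noteq> 0 \<longleftrightarrow> a = i" if "a < n" for a
          using M[OF that k] Zk[OF that] i by (simp add: cv_def)
        moreover have "(Z * V) $$ (i,b) \<noteq> 0 \<longleftrightarrow> b = k" if "b < n" for b
        proof -
          have "(Z * V) $$ (i,b) = m $$ (i,b) + m $$ (i,k) * cv b"
            using M[OF i(1) that] Zi[OF that] Zi[OF k] by simp
          then show ?thesis using mi0[of b] i by (cases "b = k"; cases "b < k") (auto simp: cv_def)
        qed
        ultimately show ?thesis using 1 i by (simp add: r'_def)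
      next
        case 2
        \<comment> \<open>The cleared part survives: the new pivot row is zero in the old columns,
          and an old pivot row is zero in column \<open>k\<close>, so its multiplier
          \<open>cu\<close> vanishes.\<close>
        have rc: "r' c = r c" using 2 by (simp add: r'_def)
        have "(Z * V) $$ (a,c) = m $$ (a,c)" if "a < n" for a
          using M[OF that, of c] Z[OF that, of c] mi0[OF 2] 2 k by (simp add: cv_def)
        moreover have "(Z * V) $$ (r c,b) = m $$ (r c,b)" if "b < n" for b
        proof -
          have "m $$ (r c,k) = 0" using row[OF 2 k] 2 by auto
          then have "cu (r c) = 0" by (simp add: cu_def)
          moreover have "Z $$ (r c,k) = 0" using Zk[OF r[OF 2]] ri[OF 2] by simp
          ultimately show ?thesis using M[OF r[OF 2] that] Z[OF r[OF 2] that] by simp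
        qed
        ultimately show ?thesis unfolding rc using r[OF 2] col[OF 2] row[OF 2] by auto
      qed
    qed
    moreover have "Z * V = (U * u) * g * (v * V)"
      unfolding Z_def m_def using UV uv g by (simp add: G_assoc)
    ultimately show ?case using UV uv by (metis N_mult)
  qed
  then obtain u v r where uv: "u \<in> N" "v \<in> N" and "Cl n (u * g * v) r" by blast
  moreover define m where "m = u * g * v"
  ultimately have r: "\<And>c. c < n \<Longrightarrow> r c < n" and
    col: "\<And>c i. c < n \<Longrightarrow> i < n \<Longrightarrow> m $$ (i,c) \<noteq> 0 \<longleftrightarrow> i = r c" and
    row: "\<And>c j. c < n \<Longrightarrow> j < n \<Longrightarrow> m $$ (r c,j) \<noteq> 0 \<longleftrightarrow> j = c"
    unfolding Cl_def m_def by blast+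
  have mc: "m \<in> carrier_mat n n" using uv g by (auto simp: m_def intro!: G_carrier)
  have ir: "inj_on r {..<n}"
  proof (rule inj_onI)
    fix a b assume "a \<in> {..<n}" "b \<in> {..<n}" "r a = r b"
    then show "a = b" using row[of a a] row[of b a] by auto
  qed
  \<comment> \<open>\<open>r\<close> sends columns to pivot rows, while \<open>monomial_perm\<close>
    wants the map from rows to columns.\<close>
  define \<sigma> where "\<sigma> = inv_into {..<n} r"
  have im: "r ` {..<n} = {..<n}" using inj_selfmap_surj[OF ir r] .
  have "\<sigma> i < n \<and> r (\<sigma> i) = i" if "i < n" for i
  proof -
    have "i \<in> r ` {..<n}" using im that by simp
    then show ?thesis using inv_into_into[of i r "{..<n}"] f_inv_into_f[of i r "{..<n}"] by (simp add: \<sigma>_def)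
  qed
  then have s: "\<And>i. i < n \<Longrightarrow> \<sigma> i < n" "\<And>i. i < n \<Longrightarrow> r (\<sigma> i) = i" by auto
  have "inj_on \<sigma> {..<n}" by (rule inj_onI) (metis s(2) lessThan_iff)
  moreover have "m $$ (i,j) \<noteq> 0 \<longleftrightarrow> j = \<sigma> i" if "i < n" "j < n" for i j
    using row[of "\<sigma> i" j] s that by simp
  ultimately have "monomial_perm \<sigma> m" using mc s by (simp add: monomial_perm_def)
  then show ?thesis using uv unfolding m_def by blast
qed

text \<open>A description of the corner algebra of the Whittaker idempotent that does not mention
  the idempotent; values outside \<open>G\<close> are left free.\<close>

definition bi_equivariant :: "('f \<Rightarrow> 'k::field) \<Rightarrow> ('f mat \<Rightarrow> 'k) \<Rightarrow> bool" where
  "bi_equivariant \<psi> a \<longleftrightarrow>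
     (\<forall>u\<in>N. \<forall>v\<in>N. \<forall>g\<in>G. a (u * g * v) = psiN \<psi> n u * psiN \<psi> n v * a g)"

text \<open>If an equivariant function does not vanish at a monomial matrix \<open>m\<close>, then comparing
  \<open>x m = m x'\<close> for \<open>x\<close> in a simple root subgroup shows that all ascents of \<open>m\<close> are consecutive with
  equal entries.\<close>
lemma monomial_tau_fixed:
  fixes \<psi> :: "'f \<Rightarrow> 'k::field"
  assumes psi: "nontriv_add_char \<psi>" and a: "bi_equivariant \<psi> a"
    and m: "monomial_perm \<sigma> m" "m \<in> G" and nz: "a m \<noteq> 0"
  shows "tau m = m"
proof -
  have mc: "m \<in> carrier_mat n n" and inj: "inj_on \<sigma> {..<n}" and less: "\<And>i. i < n \<Longrightarrow> \<sigma> i < n"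
    and ent: "\<And>i j. i < n \<Longrightarrow> j < n \<Longrightarrow> m $$ (i,j) \<noteq> 0 \<longleftrightarrow> j = \<sigma> i"
    using m by (auto simp: monomial_perm_def)
  have add: "\<And>x y. \<psi> (x + y) = \<psi> x * \<psi> y" and nz\<psi>: "\<And>x. \<psi> x \<noteq> 0" and nt: "\<exists>x. \<psi> x \<noteq> 1"
    using psi by (auto simp: nontriv_add_char_def)
  have \<psi>0: "\<psi> 0 = 1" using add[of 0 0] nz\<psi>[of 0] by simp
  have injD: "\<And>i j. i < n \<Longrightarrow> j < n \<Longrightarrow> \<sigma> i = \<sigma> j \<Longrightarrow> i = j" using inj by (auto dest: inj_onD)
  define t where "t = (\<lambda>i. m $$ (i,\<sigma> i))"
  have step: "\<sigma> (i+1) < \<sigma> i \<or> (\<sigma> (i+1) = \<sigma> i + 1 \<and> t (i+1) = t i)" if i: "i + 1 < n" for i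
  proof (rule ccontr)
    assume neg: "\<not> ?thesis"
    have lt: "\<sigma> i < \<sigma> (i+1)" using neg injD[of i "i+1"] i by (metis add_diff_cancel_left' add_lessD1 diff_is_0_eq' le_add1 linorder_neqE_nat one_neq_zero)
    have l1: "\<sigma> (i+1) < n" using less[OF i] .
    have ti: "t i \<noteq> 0" using ent[of i "\<sigma> i"] less i by (simp add: t_def)
    \<comment> \<open>With \<open>R\<close> equal to the identity plus \<open>x\<close> at
      \<open>(i, i+1)\<close>, conjugation by the monomial matrix \<open>m\<close> gives the
      identity plus \<open>x * t (i+1) / t i\<close> at \<open>(\<sigma> i, \<sigma> (i+1))\<close>.
      An ascent makes this an element \<open>C\<close> of \<open>N\<close>, and \<open>psiN\<close>
      sees the entry only if it lies on the superdiagonal. Equivariance of \<open>a\<close> on the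
      two sides of \<open>R * m = m * C\<close> compares the characters, because \<open>a m\<close>
      is nonzero.\<close>
    have key: "\<psi> x = \<psi> (if \<sigma> (i+1) = \<sigma> i + 1 then x * t (i+1) / t i else 0)" for x
    proof -
      define R where "R = rowop (\<lambda>p. if p = i then x else 0) (i+1)"
      define c where "c = (\<lambda>q. if q = \<sigma> (i+1) then x * t (i+1) / t i else 0)"
      define C where "C = colop c (\<sigma> i)"
      have RC: "R \<in> N" "C \<in> N" using lt by (auto simp: R_def C_def c_def intro: rowop_N colop_N)
      have "R * m = m * C"
      proof (rule eq_matI)
        fix p q assume "p < dim_row (m * C)" "q < dim_col (m * C)"
        then have pq: "p < n" "q < n" using mc RC(2) by (auto dest: N_carrier)
        have e1: "(R * m) $$ (p,q) = m $$ (p,q) + (if p = i then x else 0) * m $$ (i+1,q)"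
          unfolding R_def by (rule rowop_entry[OF mc pq i])
        have e2: "(m * C) $$ (p,q) = m $$ (p,q) + m $$ (p,\<sigma> i) * c q"
          unfolding C_def using less i by (intro colop_entry[OF mc pq]) auto
        have "(if p = i then x else 0) * m $$ (i+1,q) = m $$ (p,\<sigma> i) * c q"
        proof (cases "p = i")
          case True
          then show ?thesis
            using ent[OF i pq(2)] ti by (auto simp: c_def t_def)
        next
          case False
          have "i < n" using i by simp
          then have "\<sigma> i \<noteq> \<sigma> p" using injD[OF _ pq(1), of i] False by metis
          then have "m $$ (p,\<sigma> i) = 0" using ent[OF pq(1) less[OF \<open>i < n\<close>]] by blast
          then show ?thesis using False by simp
        qed
        then show "(R * m) $$ (p,q) = (m * C) $$ (p,q)" using e1 e2 by simp
      qed (use mc RC in \<open>auto dest: N_carrier\<close>)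
      moreover have "a (R * m) = psiN \<psi> n R * a m"
      proof -
        have "a (R * m * 1\<^sub>m n) = psiN \<psi> n R * psiN \<psi> n (1\<^sub>m n) * a m"
          using a RC m(2) N_one unfolding bi_equivariant_def by blast
        moreover have "psiN \<psi> n (1\<^sub>m n) = 1" by (simp add: psiN_def \<psi>0)
        ultimately show ?thesis using RC m(2) by simp
      qed
      moreover have "a (m * C) = psiN \<psi> n C * a m"
      proof -
        have "a (1\<^sub>m n * m * C) = psiN \<psi> n (1\<^sub>m n) * psiN \<psi> n C * a m"
          using a RC m(2) N_one unfolding bi_equivariant_def by blast
        moreover have "psiN \<psi> n (1\<^sub>m n) = 1" by (simp add: psiN_def \<psi>0)
        ultimately show ?thesis using RC m(2) by simp
      qed
      ultimately have "psiN \<psi> n R = psiN \<psi> n C" using nz by simp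
      moreover have "psiN \<psi> n R = \<psi> x" unfolding R_def psiN_rowop[OF i] by simp
      moreover have "psiN \<psi> n C = \<psi> (c (\<sigma> i + 1))"
        unfolding C_def using lt l1 by (intro psiN_colop) simp
      ultimately show ?thesis by (auto simp: c_def)
    qed
    show False
    proof (cases "\<sigma> (i+1) = \<sigma> i + 1")
      case False
      then have "\<psi> x = 1" for x using key[of x] \<psi>0 by simp
      then show False using nt by simp
    next
      case True
      then have tn: "t (i+1) \<noteq> t i" using neg by simp
      \<comment> \<open>The equality of characters says that \<open>\<psi>\<close> is trivial on all
        multiples of \<open>s\<close>; for \<open>s\<close> nonzero these exhaust the field.\<close>
      define s where "s = 1 - t (i+1) / t i"
      have "s \<noteq> 0" using tn ti by (simp add: s_def field_simps)
      have "\<psi> (x * s) = 1" for x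
      proof -
        have "x * s + x * t (i+1) / t i = x" by (simp add: s_def algebra_simps)
        then have "\<psi> x = \<psi> (x * s) * \<psi> (x * t (i+1) / t i)" by (metis add)
        moreover have "\<psi> x = \<psi> (x * t (i+1) / t i)" using key[of x] True by simp
        ultimately show ?thesis using nz\<psi>[of "x * t (i+1) / t i"] by simp
      qed
      then have "\<psi> ((x / s) * s) = 1" for x by blast
      then have "\<psi> x = 1" for x using \<open>s \<noteq> 0\<close> by simp
      then show False using nt by simp
    qed
  qed
  note sym = consecutive_ascents_symmetric[of \<sigma> n t, OF inj less step]
  show ?thesis
  proof (rule eq_matI)
    fix i j assume "i < dim_row m" "j < dim_col m"
    then have ij: "i < n" "j < n" using mc by auto
    show "tau m $$ (i,j) = m $$ (i,j)"
    proof (cases "j = \<sigma> i")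
      case True
      have "tau m $$ (i,j) = m $$ (n-1-\<sigma> i, n-1-i)" using ij True by (simp add: tau_def)
      also have "\<dots> = t (n-1-\<sigma> i)" using sym(1)[OF _ _ ij(1)] by (simp add: t_def)
      finally show ?thesis using sym(2)[OF _ _ ij(1)] True by (simp add: t_def)
    next
      case False
      have "m $$ (n-1-j, n-1-i) = 0"
      proof (rule ccontr)
        assume "m $$ (n-1-j, n-1-i) \<noteq> 0"
        then have "\<sigma> (n-1-j) = n-1-i" using ent[of "n-1-j" "n-1-i"] ij by simp
        also have "\<dots> = \<sigma> (n-1-\<sigma> i)" using sym(1)[OF _ _ ij(1)] by simp
        finally have "\<sigma> (n-1-j) = \<sigma> (n-1-\<sigma> i)" .
        moreover have "n-1-j < n" "n-1-\<sigma> i < n" using ij by auto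
        ultimately have "n-1-j = n-1-\<sigma> i" by (rule injD[rotated 2])
        then show False using False ij less[OF ij(1)] by simp
      qed
      then show ?thesis using ent[OF ij] False ij by (simp add: tau_def)
    qed
  qed (use mc in \<open>auto simp: tau_def\<close>)
qed

text \<open>Both \<open>a\<close> and its composite with \<open>tau\<close> are equivariant, so by
  the Bruhat decomposition they need to be compared only at monomial matrices. At such a matrix
  either \<open>tau\<close> fixes it or both functions vanish.\<close>

lemma bi_equivariant_tau:
  fixes \<psi> :: "'f \<Rightarrow> 'k::field"
  assumes psi: "nontriv_add_char \<psi>" and a: "bi_equivariant \<psi> a" and g: "g \<in> G"
  shows "a (tau g) = a g"
proof -
  define b where "b = (\<lambda>x. a (tau x))"
  have tm: "tau (u * x * v) = tau v * tau x * tau u" if "u \<in> N" "v \<in> N" "x \<in> G" for u v x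
  proof -
    have "tau (u * x * v) = tau v * tau (u * x)" using that by (intro tau_mult G_carrier) auto
    also have "tau (u * x) = tau x * tau u" using that by (intro tau_mult G_carrier) auto
    finally show ?thesis using that by (simp add: G_assoc)
  qed
  have b: "bi_equivariant \<psi> b"
    using a unfolding bi_equivariant_def b_def by (simp add: tm psiN_tau mult_ac)
  obtain u v \<sigma> where uv: "u \<in> N" "v \<in> N" and mon: "monomial_perm \<sigma> (u * g * v)"
    using bruhat[OF g] by blast
  have mG: "u * g * v \<in> G" using uv g by auto
  have "a (u * g * v) = b (u * g * v)"
  proof (cases "tau (u * g * v) = u * g * v")
    case True
    then show ?thesis by (simp add: b_def)
  next
    case False
    then show ?thesis
      using monomial_tau_fixed[OF psi a mon mG] monomial_tau_fixed[OF psi b mon mG] by metis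
  qed
  moreover have "psiN \<psi> n u * psiN \<psi> n v \<noteq> 0" using psi by (simp add: nontriv_add_char_def psiN_def)
  ultimately show ?thesis using a b uv g unfolding bi_equivariant_def b_def by simp
qed

text \<open>Gelfand's trick: \<open>tau\<close> is an anti-automorphism fixing every equivariant function.\<close>
theorem gelfand_graev_commute:
  fixes \<psi> :: "'f \<Rightarrow> 'k::field"
  assumes psi: "nontriv_add_char \<psi>" and a: "bi_equivariant \<psi> a" and b: "bi_equivariant \<psi> b"
    and ab: "bi_equivariant \<psi> (a \<star> b)"
  shows "a \<star> b = b \<star> a"
proof
  fix g
  show "(a \<star> b) g = (b \<star> a) g"
  proof (cases "g \<in> G")
    case g: True
    have "(a \<star> b) g = (a \<star> b) (tau g)" using bi_equivariant_tau[OF psi ab g] by simp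
    also have "\<dots> = (\<Sum>h\<in>G. a h * b (ginv h * tau g))" using g by (simp add: conv_def)
    also have "\<dots> = (\<Sum>h\<in>G. a (tau h) * b (g * ginv (tau h)))"
    proof (rule sum.cong[OF refl])
      fix h assume h: "h \<in> G"
      have "b (ginv h * tau g) = b (tau (ginv h * tau g))"
        using bi_equivariant_tau[OF psi b] h g by simp
      also have "tau (ginv h * tau g) = g * ginv (tau h)"
        using h g by (simp add: tau_mult G_carrier tau_tau tau_inv)
      finally show "a h * b (ginv h * tau g) = a (tau h) * b (g * ginv (tau h))"
        using bi_equivariant_tau[OF psi a h] by simp
    qed
    also have "\<dots> = (\<Sum>h\<in>G. a h * b (g * ginv h))" by (rule sum_G_tau)
    \<comment> \<open>The substitution of \<open>ginv h * g\<close> for \<open>h\<close> turns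
      \<open>g * ginv h\<close> into \<open>h\<close> and so exchanges the roles of \<open>a\<close>
      and \<open>b\<close>.\<close>
    also have "\<dots> = (\<Sum>h\<in>G. a (ginv h * g) * b (g * ginv (ginv h * g)))"
    proof -
      have "(\<Sum>h\<in>G. a h * b (g * ginv h)) = (\<Sum>h\<in>G. a (h * g) * b (g * ginv (h * g)))"
        by (rule sum_G_right[OF g, symmetric])
      also have "\<dots> = (\<Sum>h\<in>G. a (ginv h * g) * b (g * ginv (ginv h * g)))"
        by (rule sum_G_inv[symmetric])
      finally show ?thesis .
    qed
    also have "\<dots> = (\<Sum>h\<in>G. b h * a (ginv h * g))"
      using g by (intro sum.cong refl) (auto simp: ginv_mult G_assoc[symmetric] mult.commute)
    also have "\<dots> = (b \<star> a) g" using g by (simp add: conv_def)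
    finally show ?thesis .
  qed (simp add: conv_def)
qed

end

section \<open>Left ideals generated by primitive idempotents\<close>

context gl
begin

lemma conv_smult_left: "(\<lambda>x. c * a x) \<star> b = (\<lambda>x. c * (a \<star> b) x)"
  by (simp add: conv_def fun_eq_iff sum_distrib_left mult.assoc)

lemma ract_lincomb:
  assumes r: "is_rep n d \<rho>" and v: "v \<in> carrier_vec d"
  shows "ract d \<rho> (\<lambda>x. \<Sum>j\<in>J. c j * a j x) *\<^sub>v v = vec d (\<lambda>i. \<Sum>j\<in>J. c j * (ract d \<rho> (a j) *\<^sub>v v) $ i)"
proof (rule eq_vecI)
  fix i assume "i < dim_vec (vec d (\<lambda>i. \<Sum>j\<in>J. c j * (ract d \<rho> (a j) *\<^sub>v v) $ i))"
  then have i: "i < d" by simp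
  have c: "dim_vec (\<rho> g *\<^sub>v v) = d" if "g \<in> G" for g using is_repD(1)[OF r that] by auto
  have e: "(ract d \<rho> b *\<^sub>v v) $ i = (\<Sum>g\<in>G. b g * (\<rho> g *\<^sub>v v) $ i)" for b
    unfolding ract_vec[OF r v] using i c by (auto intro!: sum.cong)
  have "(\<Sum>g\<in>G. (\<Sum>j\<in>J. c j * a j g) * (\<rho> g *\<^sub>v v) $ i) =
    (\<Sum>j\<in>J. \<Sum>g\<in>G. c j * a j g * (\<rho> g *\<^sub>v v) $ i)"
    unfolding sum_distrib_right by (rule sum.swap)
  then show "(ract d \<rho> (\<lambda>x. \<Sum>j\<in>J. c j * a j x) *\<^sub>v v) $ i =
    vec d (\<lambda>i. \<Sum>j\<in>J. c j * (ract d \<rho> (a j) *\<^sub>v v) $ i) $ i"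
    using i by (simp add: e sum_distrib_left mult.assoc)
qed (simp add: ract_def)

text \<open>\<open>cyc f d \<rho> p\<close> says that \<open>\<rho>\<close> is a model of the left ideal \<open>k[G] f\<close>, the vector \<open>p\<close>
  corresponding to \<open>f\<close>.\<close>
definition cyc :: "('f mat \<Rightarrow> 'k::field) \<Rightarrow> nat \<Rightarrow> ('f mat \<Rightarrow> 'k mat) \<Rightarrow> 'k vec \<Rightarrow> bool" where
  "cyc f d \<rho> p \<longleftrightarrow> is_rep n d \<rho> \<and> p \<in> carrier_vec d \<and> ract d \<rho> f *\<^sub>v p = p \<and>
     (\<forall>v\<in>carrier_vec d. \<exists>a. v = ract d \<rho> a *\<^sub>v p) \<and>
     (\<forall>a. ract d \<rho> a *\<^sub>v p = 0\<^sub>v d \<longrightarrow> a \<star> f = (\<lambda>x. 0))"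

lemma cycD:
  assumes "cyc f d \<rho> p"
  shows "is_rep n d \<rho>" "p \<in> carrier_vec d" "ract d \<rho> f *\<^sub>v p = p"
    "v \<in> carrier_vec d \<Longrightarrow> \<exists>a. v = ract d \<rho> a *\<^sub>v p"
    "ract d \<rho> a *\<^sub>v p = 0\<^sub>v d \<Longrightarrow> a \<star> f = (\<lambda>x. 0)"
  using assms by (auto simp: cyc_def)

text \<open>The left regular representation, written in coordinates by an enumeration of
  \<open>G\<close>, is restricted to the image of right convolution by \<open>f\<close>. Idempotency
  puts \<open>f\<close> itself into this image and makes \<open>f\<close> fix the generator.\<close>

lemma cyc_exists:
  fixes f :: "'f mat \<Rightarrow> 'k::field"
  assumes f: "f \<star> f = f"
  shows "\<exists>d \<rho> p. cyc f d \<rho> p"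
proof -
  define m where "m = card G"
  obtain en where en: "bij_betw en {0..<m} G" using ex_bij_betw_nat_finite[OF finite_G] m_def by auto
  define idx where "idx = inv_into {0..<m} en"
  have enG: "en i \<in> G" if "i < m" for i using en that by (auto simp: bij_betw_def)
  have idx: "idx x < m" "en (idx x) = x" if "x \<in> G" for x
    using bij_betw_inv_into_right[OF en that] bij_betwE[OF bij_betw_inv_into[OF en]] that
    by (auto simp: idx_def)
  define tv where "tv = (\<lambda>a :: 'f mat \<Rightarrow> 'k. vec m (\<lambda>i. a (en i)))"
  have tvc: "tv a \<in> carrier_vec m" for a by (simp add: tv_def)
  define L where "L = (\<lambda>g. mat m m (\<lambda>(i,j). if j = idx (ginv g * en i) then 1 else 0) :: 'k mat)"
  have Lc: "L g \<in> carrier_mat m m" for g by (simp add: L_def)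
  have Ld [simp]: "dim_row (L g) = m" "dim_col (L g) = m" for g by (simp_all add: L_def)
  have Lv: "(L g *\<^sub>v w) $ i = w $ idx (ginv g * en i)"
    if "i < m" "g \<in> G" "w \<in> carrier_vec m" for g w i
  proof -
    have "(L g *\<^sub>v w) $ i = (\<Sum>j\<in>{0..<m}. if j = idx (ginv g * en i) then w $ j else 0)"
      using that
      by (simp add: L_def scalar_prod_def if_distrib[of "\<lambda>t. t * _"] cong: if_cong)
    also have "\<dots> = w $ idx (ginv g * en i)" using idx(1)[of "ginv g * en i"] enG that by simp
    finally show ?thesis .
  qed
  have Lrep: "is_rep n m L"
    unfolding is_rep_def
  proof (intro conjI ballI)
    fix g h assume gh: "g \<in> G" "h \<in> G"
    show "L (g * h) = L g * L h"
    proof (rule mat_mult_vec_eq_imp_eq[of _ m m])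
      fix w :: "'k vec" assume w: "w \<in> carrier_vec m"
      have "L (g * h) *\<^sub>v w = L g *\<^sub>v (L h *\<^sub>v w)"
      proof (rule eq_vecI)
        fix i assume "i < dim_vec (L g *\<^sub>v (L h *\<^sub>v w))"
        then have i: "i < m" using Lc by auto
        have "(L g *\<^sub>v (L h *\<^sub>v w)) $ i = w $ idx (ginv h * en (idx (ginv g * en i)))"
          using Lv[OF i gh(1), of "L h *\<^sub>v w"] Lv[of "idx (ginv g * en i)" h w]
            idx(1)[of "ginv g * en i"] enG i gh w Lc by (simp add: mult_mat_vec_carrier[of _ m m])
        also have "\<dots> = (L (g * h) *\<^sub>v w) $ i"
          using Lv[of i "g * h" w] idx(2)[of "ginv g * en i"] enG i gh w
          by (simp add: ginv_mult G_assoc)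
        finally show "(L (g * h) *\<^sub>v w) $ i = (L g *\<^sub>v (L h *\<^sub>v w)) $ i" by simp
      qed (use Lc in auto)
      then show "L (g * h) *\<^sub>v w = (L g * L h) *\<^sub>v w"
        using assoc_mult_mat_vec[OF Lc Lc w] by simp
    qed (use Lc in auto)
  next
    have one: "ginv (1\<^sub>m n) = 1\<^sub>m n" by (rule ginv_unique) auto
    show "L (1\<^sub>m n) = 1\<^sub>m m"
    proof (rule mat_mult_vec_eq_imp_eq[of _ m m])
      fix w :: "'k vec" assume w: "w \<in> carrier_vec m"
      have ie: "idx (en i) = i" if "i < m" for i
        using bij_betw_inv_into_left[OF en] that by (simp add: idx_def)
      show "L (1\<^sub>m n) *\<^sub>v w = 1\<^sub>m m *\<^sub>v w"
        using w Lv[of _ "1\<^sub>m n" w] enG Lc[of "1\<^sub>m n"]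
        by (intro eq_vecI) (auto simp: one ie simp del: index_mult_mat_vec)
    qed (use Lc in auto)
  qed (use Lc in auto)
  have Ltv: "ract m L a *\<^sub>v tv b = tv (a \<star> b)" for a b
  proof (rule eq_vecI)
    fix i assume "i < dim_vec (tv (a \<star> b))"
    then have i: "i < m" by (simp add: tv_def)
    have "(ract m L a *\<^sub>v tv b) $ i = (\<Sum>g\<in>G. a g * (L g *\<^sub>v tv b) $ i)"
      unfolding ract_vec[OF Lrep tvc] using i Lc by (auto intro!: sum.cong)
    also have "\<dots> = (\<Sum>g\<in>G. a g * b (ginv g * en i))"
    proof (rule sum.cong[OF refl])
      fix g assume g: "g \<in> G"
      have "ginv g * en i \<in> G" using g enG i by auto
      then show "a g * (L g *\<^sub>v tv b) $ i = a g * b (ginv g * en i)"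
        using Lv[OF i g tvc] idx by (simp add: tv_def)
    qed
    finally show "(ract m L a *\<^sub>v tv b) $ i = tv (a \<star> b) $ i"
      using i enG by (simp add: tv_def conv_def)
  qed (simp add: tv_def ract_def)
  define U where "U = {tv (a \<star> f) | a. True}"
  have U: "ksubspace m U"
    unfolding ksubspace_def
  proof (intro conjI ballI allI)
    show "U \<subseteq> carrier_vec m" using tvc by (auto simp: U_def)
    have "tv ((\<lambda>x. 0) \<star> f) = 0\<^sub>v m" by (auto simp: tv_def)
    then show "0\<^sub>v m \<in> U" unfolding U_def by (smt (verit) mem_Collect_eq)
  next
    fix v w assume "v \<in> U" "w \<in> U"
    then obtain a b where ab: "v = tv (a \<star> f)" "w = tv (b \<star> f)" by (auto simp: U_def)
    have "tv ((\<lambda>x. a x + b x) \<star> f) = v + w" unfolding ab conv_add_left by (auto simp: tv_def)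
    then show "v + w \<in> U" unfolding U_def by (smt (verit) mem_Collect_eq)
  next
    fix c v assume "v \<in> U"
    then obtain a where a: "v = tv (a \<star> f)" by (auto simp: U_def)
    have "tv ((\<lambda>x. c * a x) \<star> f) = c \<cdot>\<^sub>v v" unfolding a conv_smult_left by (auto simp: tv_def)
    then show "c \<cdot>\<^sub>v v \<in> U" unfolding U_def by (smt (verit) mem_Collect_eq)
  qed
  obtain d B C where B: "B \<in> carrier_mat m d" and C: "C \<in> carrier_mat d m" and CB: "C * B = 1\<^sub>m d"
    and UB: "U = {B *\<^sub>v w | w. w \<in> carrier_vec d}" using ksubspace_parametrization[OF U] .
  have CBv: "C *\<^sub>v (B *\<^sub>v w) = w" if "w \<in> carrier_vec d" for w
  proof -
    have "C *\<^sub>v (B *\<^sub>v w) = (C * B) *\<^sub>v w" using B C that by simp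
    then show ?thesis using CB that by simp
  qed
  have BCv: "B *\<^sub>v (C *\<^sub>v x) = x" if "x \<in> U" for x using that CBv unfolding UB by auto
  \<comment> \<open>\<open>B\<close> embeds the coordinates of the ideal and \<open>B * C\<close> is
    the identity on \<open>U\<close>. As \<open>U\<close> is stable under \<open>L\<close>, this
    compression of \<open>L\<close> is its restriction to \<open>U\<close> and therefore
    multiplicative.\<close>
  define \<rho> where "\<rho> = (\<lambda>g. C * (L g * B))"
  have rc: "\<rho> g \<in> carrier_mat d d" for g using B C Lc[of g] by (auto simp: \<rho>_def)
  have Br: "B * \<rho> g = L g * B" if g: "g \<in> G" for g
  proof (rule mat_mult_vec_eq_imp_eq[of _ m d])
    fix w :: "'k vec" assume w: "w \<in> carrier_vec d"
    then have "B *\<^sub>v w \<in> U" by (auto simp: UB)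
    then obtain a where a: "B *\<^sub>v w = tv (a \<star> f)" by (auto simp: U_def)
    have "L g *\<^sub>v (B *\<^sub>v w) = ract m L (dl g) *\<^sub>v tv (a \<star> f)" using a ract_dl[OF Lrep g] by simp
    also have "\<dots> = tv ((dl g \<star> a) \<star> f)" unfolding Ltv conv_assoc ..
    finally have "L g *\<^sub>v (B *\<^sub>v w) \<in> U" by (auto simp: U_def)
    then have "B *\<^sub>v (C *\<^sub>v (L g *\<^sub>v (B *\<^sub>v w))) = L g *\<^sub>v (B *\<^sub>v w)" by (rule BCv)
    moreover have "(B * \<rho> g) *\<^sub>v w = B *\<^sub>v (C *\<^sub>v (L g *\<^sub>v (B *\<^sub>v w)))"
    proof -
      have "(B * \<rho> g) *\<^sub>v w = B *\<^sub>v (\<rho> g *\<^sub>v w)" using B rc w by (intro assoc_mult_mat_vec)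
      also have "\<rho> g *\<^sub>v w = C *\<^sub>v ((L g * B) *\<^sub>v w)"
        unfolding \<rho>_def using B C Lc w by (intro assoc_mult_mat_vec) auto
      also have "(L g * B) *\<^sub>v w = L g *\<^sub>v (B *\<^sub>v w)" using B Lc w by (intro assoc_mult_mat_vec) auto
      finally show ?thesis .
    qed
    moreover have "(L g * B) *\<^sub>v w = L g *\<^sub>v (B *\<^sub>v w)" using B Lc w by (intro assoc_mult_mat_vec) auto
    ultimately show "(B * \<rho> g) *\<^sub>v w = (L g * B) *\<^sub>v w" by simp
  qed (use B rc Lc in auto)
  have rep: "is_rep n d \<rho>"
    unfolding is_rep_def
  proof (intro conjI ballI)
    fix g h assume gh: "g \<in> G" "h \<in> G"
    have "\<rho> g * \<rho> h = C * (L g * B * \<rho> h)"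
      unfolding \<rho>_def[THEN fun_cong, of g] using B C Lc rc by (intro assoc_mult_mat) auto
    also have "L g * B * \<rho> h = L g * (B * \<rho> h)" using B Lc rc by (intro assoc_mult_mat) auto
    also have "\<dots> = L g * (L h * B)" using Br gh by simp
    also have "\<dots> = (L g * L h) * B" using B Lc by (intro assoc_mult_mat[symmetric]) auto
    also have "L g * L h = L (g * h)" using is_repD(2)[OF Lrep] gh by simp
    finally show "\<rho> (g * h) = \<rho> g * \<rho> h" by (simp add: \<rho>_def)
  next
    show "\<rho> (1\<^sub>m n) = 1\<^sub>m d" unfolding \<rho>_def using is_repD(3)[OF Lrep] B CB by simp
  qed (use rc in auto)
  have gB: "gmap n d \<rho> m L B" using B Br by (simp add: gmap_def)
  define p where "p = C *\<^sub>v tv f"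
  have pc: "p \<in> carrier_vec d" using mult_mat_vec_carrier[OF C tvc] by (simp add: p_def)
  have fU: "tv f \<in> U" using f unfolding U_def by (metis (mono_tags, lifting) mem_Collect_eq)
  have Bp: "B *\<^sub>v p = tv f" unfolding p_def by (rule BCv[OF fU])
  have Ba: "B *\<^sub>v (ract d \<rho> a *\<^sub>v p) = tv (a \<star> f)" for a
    unfolding gmap_ract_vec[OF rep Lrep gB pc] Bp by (rule Ltv)
  have Binj: "v = w" if "v \<in> carrier_vec d" "w \<in> carrier_vec d" "B *\<^sub>v v = B *\<^sub>v w" for v w
    using CBv that by metis
  have rpc: "ract d \<rho> a *\<^sub>v p \<in> carrier_vec d" for a using pc by (auto intro: mult_mat_vec_carrier)
  have "cyc f d \<rho> p"
    unfolding cyc_def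
  proof (intro conjI ballI allI impI)
    show "ract d \<rho> f *\<^sub>v p = p" by (rule Binj[OF rpc pc]) (simp add: Ba f Bp)
  next
    fix v :: "'k vec" assume v: "v \<in> carrier_vec d"
    then have "B *\<^sub>v v \<in> U" by (auto simp: UB)
    then obtain a where "B *\<^sub>v v = tv (a \<star> f)" by (auto simp: U_def)
    then show "\<exists>a. v = ract d \<rho> a *\<^sub>v p" using Binj[OF v rpc] Ba by metis
  next
    fix a assume "ract d \<rho> a *\<^sub>v p = 0\<^sub>v d"
    then have "tv (a \<star> f) = 0\<^sub>v m" using Ba[of a] B by (simp add: mat_mult_zero_vec)
    then have z: "(a \<star> f) (en i) = 0" if "i < m" for i using that
      by (metis index_vec index_zero_vec(1) tv_def)
    show "a \<star> f = (\<lambda>x. 0)"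
    proof
      fix x show "(a \<star> f) x = 0"
        using z[of "idx x"] idx[of x] supp_conv[of a f] by (cases "x \<in> G") (auto simp: supp_def)
    qed
  qed (use rep pc in auto)
  then show ?thesis by blast
qed

section \<open>Homomorphisms out of a left ideal and projectivity\<close>

lemma gmap_comp:
  fixes \<rho>1 \<rho>2 \<rho>3 :: "'f mat \<Rightarrow> 'k::field mat"
  assumes "gmap n d1 \<rho>1 d2 \<rho>2 A" "gmap n d2 \<rho>2 d3 \<rho>3 B" "is_rep n d1 \<rho>1" "is_rep n d2 \<rho>2" "is_rep n d3 \<rho>3"
  shows "gmap n d1 \<rho>1 d3 \<rho>3 (B * A)"
  unfolding gmap_def
proof (intro conjI ballI)
  have A: "A \<in> carrier_mat d2 d1" and B: "B \<in> carrier_mat d3 d2" using assms by (auto simp: gmap_def)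
  then show "B * A \<in> carrier_mat d3 d1" by auto
  fix g assume g: "g \<in> G"
  have c: "\<rho>1 g \<in> carrier_mat d1 d1" "\<rho>2 g \<in> carrier_mat d2 d2" "\<rho>3 g \<in> carrier_mat d3 d3"
    using assms g by (auto simp: is_rep_def)
  have "B * A * \<rho>1 g = B * (A * \<rho>1 g)" using A B c by (intro assoc_mult_mat) auto
  also have "A * \<rho>1 g = \<rho>2 g * A" using assms g by (simp add: gmap_def)
  also have "B * (\<rho>2 g * A) = (B * \<rho>2 g) * A" using A B c by (intro assoc_mult_mat[symmetric]) auto
  also have "B * \<rho>2 g = \<rho>3 g * B" using assms g by (simp add: gmap_def)
  also have "\<rho>3 g * B * A = \<rho>3 g * (B * A)" using A B c by (intro assoc_mult_mat) auto
  finally show "B * A * \<rho>1 g = \<rho>3 g * (B * A)" .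
qed

lemma cyc_unique:
  assumes c: "cyc f d \<rho> p" and r: "is_rep n d2 \<rho>2"
    and A: "gmap n d \<rho> d2 \<rho>2 A" and B: "gmap n d \<rho> d2 \<rho>2 B" and e: "A *\<^sub>v p = B *\<^sub>v p"
  shows "A = (B :: 'k::field mat)"
proof (rule mat_mult_vec_eq_imp_eq[of _ d2 d])
  fix v :: "'k vec" assume "v \<in> carrier_vec d"
  then obtain a where "v = ract d \<rho> a *\<^sub>v p" using cycD(4)[OF c] by blast
  then show "A *\<^sub>v v = B *\<^sub>v v"
    using gmap_ract_vec[OF cycD(1)[OF c] r _ cycD(2)[OF c]] A B e by simp
qed (use A B in \<open>auto simp: gmap_def\<close>)

text \<open>Hom(k[G] f, V) is f V by evaluation at the generator. The map sending \<open>a\<close>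
  applied to \<open>p\<close> to \<open>a\<close> applied to \<open>w\<close> is well defined:
  whatever annihilates \<open>p\<close> annihilates \<open>f\<close>, hence also \<open>w\<close>,
  which is fixed by \<open>f\<close>.\<close>

lemma cyc_map:
  fixes f :: "'f mat \<Rightarrow> 'k::field"
  assumes c: "cyc f d \<rho> p" and r: "is_rep n d2 \<rho>2" and w: "w \<in> carrier_vec d2"
    and fw: "ract d2 \<rho>2 f *\<^sub>v w = w"
  shows "\<exists>\<Phi>. gmap n d \<rho> d2 \<rho>2 \<Phi> \<and> \<Phi> *\<^sub>v p = w"
proof -
  note rep = cycD(1)[OF c] and pc = cycD(2)[OF c]
  \<comment> \<open>Algebra elements carrying \<open>p\<close> to the unit vectors prescribe the
    columns of the matrix; \<open>key\<close> shows that their choice does not matter.\<close>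
  obtain \<alpha> where \<alpha>: "\<And>j. ract d \<rho> (\<alpha> j) *\<^sub>v p = unit_vec d j"
    using cycD(4)[OF c unit_vec_carrier] by metis
  define \<Phi> where "\<Phi> = mat d2 d (\<lambda>(i,j). (ract d2 \<rho>2 (\<alpha> j) *\<^sub>v w) $ i)"
  have Pc: "\<Phi> \<in> carrier_mat d2 d" by (simp add: \<Phi>_def)
  have key: "\<Phi> *\<^sub>v (ract d \<rho> a *\<^sub>v p) = ract d2 \<rho>2 a *\<^sub>v w" for a
  proof -
    define v where "v = ract d \<rho> a *\<^sub>v p"
    have vc: "v \<in> carrier_vec d" unfolding v_def using pc by (auto intro: mult_mat_vec_carrier)
    \<comment> \<open>The combination of the chosen \<open>\<alpha> j\<close> that carries
      \<open>p\<close> to the same vector as \<open>a\<close>; on \<open>w\<close> it acts as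
      \<open>\<Phi>\<close> does on that vector.\<close>
    define b where "b = (\<lambda>x. \<Sum>j\<in>{0..<d}. v $ j * \<alpha> j x)"
    have "ract d \<rho> b *\<^sub>v p = v"
      unfolding b_def ract_lincomb[OF rep pc] \<alpha> using vc
      by (intro eq_vecI) (auto simp: if_distrib[of "\<lambda>t. _ * t"] unit_vec_def cong: if_cong)
    then have "ract d \<rho> (\<lambda>x. a x - b x) *\<^sub>v p = 0\<^sub>v d"
      unfolding ract_diff using vc pc
      by (subst minus_mult_distrib_mat_vec[of _ d d]) (auto simp: v_def)
    then have "(\<lambda>x. a x - b x) \<star> f = (\<lambda>x. 0)" by (rule cycD(5)[OF c])
    then have "ract d2 \<rho>2 (\<lambda>x. a x - b x) *\<^sub>v (ract d2 \<rho>2 f *\<^sub>v w) = 0\<^sub>m d2 d2 *\<^sub>v w"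
      using ract_conv_vec[OF r w] ract_zero by metis
    then have "ract d2 \<rho>2 a *\<^sub>v w - ract d2 \<rho>2 b *\<^sub>v w = 0\<^sub>v d2"
      unfolding fw ract_diff using w
      by (subst (asm) minus_mult_distrib_mat_vec[of _ d2 d2]) auto
    then have "ract d2 \<rho>2 a *\<^sub>v w = ract d2 \<rho>2 b *\<^sub>v w"
      using w by - (rule vec_minus_eq_zero[of _ d2], auto intro: mult_mat_vec_carrier)
    also have "\<dots> = \<Phi> *\<^sub>v v"
    proof (rule eq_vecI)
      fix i assume "i < dim_vec (\<Phi> *\<^sub>v v)"
      then have i: "i < d2" using Pc by simp
      have "(\<Phi> *\<^sub>v v) $ i = (\<Sum>j\<in>{0..<d}. \<Phi> $$ (i,j) * v $ j)"
        using Pc vc i by (simp add: scalar_prod_def)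
      also have "\<dots> = (\<Sum>j\<in>{0..<d}. v $ j * (ract d2 \<rho>2 (\<alpha> j) *\<^sub>v w) $ i)"
        using i by (intro sum.cong refl) (simp add: \<Phi>_def mult.commute del: index_mult_mat_vec)
      finally show "(ract d2 \<rho>2 b *\<^sub>v w) $ i = (\<Phi> *\<^sub>v v) $ i"
        unfolding b_def ract_lincomb[OF r w] using i by simp
    qed (use Pc in \<open>simp add: ract_def\<close>)
    finally show ?thesis by (simp add: v_def)
  qed
  have "gmap n d \<rho> d2 \<rho>2 \<Phi>"
    unfolding gmap_def
  proof (intro conjI ballI)
    fix g assume g: "g \<in> G"
    have gc: "\<rho> g \<in> carrier_mat d d" "\<rho>2 g \<in> carrier_mat d2 d2" using rep r g by (auto simp: is_rep_def)
    show "\<Phi> * \<rho> g = \<rho>2 g * \<Phi>"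
    proof (rule mat_mult_vec_eq_imp_eq[of _ d2 d])
      fix v :: "'k vec" assume v: "v \<in> carrier_vec d"
      then obtain a where a: "v = ract d \<rho> a *\<^sub>v p" using cycD(4)[OF c] by blast
      have "(\<Phi> * \<rho> g) *\<^sub>v v = \<Phi> *\<^sub>v (ract d \<rho> (dl g) *\<^sub>v (ract d \<rho> a *\<^sub>v p))"
        using Pc gc v a ract_dl[OF rep g] by simp
      also have "\<dots> = ract d2 \<rho>2 (dl g) *\<^sub>v (ract d2 \<rho>2 a *\<^sub>v w)"
        unfolding ract_conv_vec[OF rep pc, symmetric] key ract_conv_vec[OF r w] ..
      also have "\<dots> = (\<rho>2 g * \<Phi>) *\<^sub>v v"
        using Pc gc v key[of a] ract_dl[OF r g] by (simp add: a)
      finally show "(\<Phi> * \<rho> g) *\<^sub>v v = (\<rho>2 g * \<Phi>) *\<^sub>v v" .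
    qed (use Pc gc in auto)
  qed (rule Pc)
  moreover have "\<Phi> *\<^sub>v p = w" using key[of f] fw cycD(3)[OF c] by simp
  ultimately show ?thesis by blast
qed

text \<open>To lift \<open>F\<close>, any preimage of \<open>F *\<^sub>v p\<close> is multiplied by
  \<open>f\<close>. It remains a preimage because \<open>f\<close> fixes \<open>p\<close>, and it
  becomes an admissible image of the generator.\<close>

lemma cyc_projective:
  fixes f :: "'f mat \<Rightarrow> 'k::field"
  assumes f: "f \<star> f = f" and c: "cyc f d \<rho> p"
  shows "projective_rep n d \<rho>"
  unfolding projective_rep_def
proof (intro conjI allI impI)
  note rep = cycD(1)[OF c] and pc = cycD(2)[OF c]
  show "is_rep n d \<rho>" by (rule rep)
  fix d1 \<rho>1 d2 \<rho>2 B F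
  assume "is_rep n d1 \<rho>1 \<and> is_rep n d2 \<rho>2 \<and> gmap n d1 \<rho>1 d2 \<rho>2 B \<and> surj_mat d1 d2 B \<and> gmap n d \<rho> d2 \<rho>2 F"
  then have r1: "is_rep n d1 \<rho>1" and r2: "is_rep n d2 \<rho>2" and B: "gmap n d1 \<rho>1 d2 \<rho>2 B"
    and s: "surj_mat d1 d2 B" and F: "gmap n d \<rho> d2 \<rho>2 F" by auto
  have Bc: "B \<in> carrier_mat d2 d1" and Fc: "F \<in> carrier_mat d2 d" using B F by (auto simp: gmap_def)
  have "F *\<^sub>v p \<in> carrier_vec d2" using Fc pc by auto
  then obtain v where v: "v \<in> carrier_vec d1" "B *\<^sub>v v = F *\<^sub>v p" using s by (auto simp: surj_mat_def)
  define v' where "v' = ract d1 \<rho>1 f *\<^sub>v v"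
  have v': "v' \<in> carrier_vec d1" using v by (auto simp: v'_def intro: mult_mat_vec_carrier)
  have fv': "ract d1 \<rho>1 f *\<^sub>v v' = v'" unfolding v'_def ract_conv_vec[OF r1 v(1), symmetric] f ..
  have "B *\<^sub>v v' = ract d2 \<rho>2 f *\<^sub>v (F *\<^sub>v p)"
    unfolding v'_def gmap_ract_vec[OF r1 r2 B v(1)] v(2) ..
  also have "\<dots> = F *\<^sub>v p" using gmap_ract_vec[OF rep r2 F pc, of f] cycD(3)[OF c] by simp
  finally have Bv': "B *\<^sub>v v' = F *\<^sub>v p" .
  obtain h where h: "gmap n d \<rho> d1 \<rho>1 h" "h *\<^sub>v p = v'" using cyc_map[OF c r1 v' fv'] by blast
  have "h \<in> carrier_mat d1 d" using h by (simp add: gmap_def)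
  then have "(B * h) *\<^sub>v p = F *\<^sub>v p" using Bc pc h Bv' by simp
  then have "B * h = F" using cyc_unique[OF c r2 gmap_comp[OF h(1) B rep r1 r2] F] by simp
  then show "\<exists>h. gmap n d \<rho> d1 \<rho>1 h \<and> B * h = F" using h by blast
qed

text \<open>The family has \<open>card G + 1\<close> members, indexed from 0. Their values on
  \<open>G\<close> together with an extra row of zeros form a square singular matrix.\<close>

lemma linear_dependence:
  fixes q :: "nat \<Rightarrow> 'f mat \<Rightarrow> 'k::field"
  assumes q: "\<And>j. supp (q j)"
  shows "\<exists>c r. r \<le> card G \<and> c r \<noteq> 0 \<and> (\<forall>x. (\<Sum>j\<le>card G. c j * q j x) = 0)"
proof -
  define m where "m = card G"
  obtain en where en: "bij_betw en {0..<m} G" using ex_bij_betw_nat_finite[OF finite_G] m_def by auto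
  define M where "M = mat (Suc m) (Suc m) (\<lambda>(i,j). if i < m then q j (en i) else 0)"
  have Mc: "M \<in> carrier_mat (Suc m) (Suc m)" by (simp add: M_def)
  have "det M = 0"
  proof (rule ccontr)
    assume "det M \<noteq> 0"
    then have "M \<in> Units (ring_mat TYPE('k) (Suc m) ())" using det_non_zero_imp_unit[OF Mc] by simp
    then obtain B where B: "B \<in> carrier_mat (Suc m) (Suc m)" "M * B = 1\<^sub>m (Suc m)"
      by (auto simp: Units_def ring_mat_def)
    have "(M * B) $$ (m,m) = (\<Sum>k\<in>{0..<Suc m}. M $$ (m,k) * B $$ (k,m))"
      using Mc B(1) by (simp add: scalar_prod_def)
    also have "\<dots> = 0" by (intro sum.neutral) (auto simp: M_def)
    finally show False using B by simp
  qed
  then obtain v where v: "v \<in> carrier_vec (Suc m)" "v \<noteq> 0\<^sub>v (Suc m)" "M *\<^sub>v v = 0\<^sub>v (Suc m)"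
    using det_0_iff_vec_prod_zero_field[OF Mc] by auto
  then obtain r where r: "r < Suc m" "v $ r \<noteq> 0"
    by (metis carrier_vecD eq_vecI index_zero_vec(1) index_zero_vec(2))
  have "(\<Sum>j\<le>m. v $ j * q j x) = 0" for x
  proof (cases "x \<in> G")
    case True
    then have "x \<in> en ` {0..<m}" using en by (simp add: bij_betw_def)
    then obtain i where i: "i < m" "x = en i" by auto
    have "(M *\<^sub>v v) $ i = 0" using v(3) i by simp
    moreover have "(M *\<^sub>v v) $ i = (\<Sum>j\<in>{0..<Suc m}. q j x * v $ j)"
      using i v(1) by (auto simp: M_def scalar_prod_def)
    ultimately show ?thesis by (simp add: atLeast0LessThan lessThan_Suc_atMost mult.commute)
  qed (use q in \<open>simp add: supp_def\<close>)
  then show ?thesis using r unfolding m_def[symmetric] by (intro exI[of _ "\<lambda>j. v $ j"] exI[of _ r]) auto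
qed

text \<open>Powers in the corner algebra f k[G] f, whose unit is \<open>f\<close>; hence the start
  at \<open>f\<close>.\<close>

primrec apow :: "('f mat \<Rightarrow> 'k::field) \<Rightarrow> ('f mat \<Rightarrow> 'k) \<Rightarrow> nat \<Rightarrow> 'f mat \<Rightarrow> 'k" where
  "apow f a 0 = f"
| "apow f a (Suc j) = a \<star> apow f a j"

definition primitive_idem :: "('f mat \<Rightarrow> 'k::field) \<Rightarrow> bool" where
  "primitive_idem f \<longleftrightarrow> f \<star> f = f \<and> f \<noteq> (\<lambda>x. 0) \<and>
     (\<forall>g. g \<star> g = g \<longrightarrow> f \<star> g = g \<longrightarrow> g \<star> f = g \<longrightarrow> g = (\<lambda>x. 0) \<or> g = f)"

text \<open>Fitting's lemma: a linear dependence between the powers of \<open>a\<close> yields \<open>t\<close> with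
  \<open>a\<^sup>r = a\<^sup>2\<^sup>r\<^sup>+\<^sup>1 t\<close>, and then \<open>a\<^sup>r\<^sup>+\<^sup>1 t\<close> is idempotent.\<close>
lemma fitting:
  assumes f: "primitive_idem f" and fa: "f \<star> a = a" and af: "a \<star> f = a"
  shows "(\<exists>m. apow f a m = (\<lambda>x. 0)) \<or> (\<exists>s. s \<star> a = f)"
proof -
  have ff: "f \<star> f = f" using f by (simp add: primitive_idem_def)
  define q where "q = apow f a"
  have q0: "q 0 = f" and qS: "q (Suc j) = a \<star> q j" for j by (auto simp: q_def)
  have fq: "f \<star> q j = q j" for j by (induction j) (auto simp: q0 qS ff conv_assoc[symmetric] fa)
  have qf: "q j \<star> f = q j" for j by (induction j) (auto simp: q0 qS ff conv_assoc)
  have qa: "q j \<star> a = a \<star> q j" for j by (induction j) (auto simp: q0 qS fa af conv_assoc)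
  have qadd: "q (i + j) = q i \<star> q j" for i j
    by (induction i) (auto simp: q0 qS fq conv_assoc)
  have "supp (q j)" for j using fq[of j] supp_conv[of f "q j"] by simp
  then obtain c r0 where r0: "r0 \<le> card G" "c r0 \<noteq> 0" and dep: "\<And>x. (\<Sum>j\<le>card G. c j * q j x) = 0"
    using linear_dependence by metis
  \<comment> \<open>The lowest power that occurs in the relation. Solving for it expresses
    \<open>a\<close>^r through higher powers, that is, as \<open>a\<close>^(r+1) times the
    polynomial \<open>s\<close> in \<open>a\<close>.\<close>
  define r where "r = (LEAST j. c j \<noteq> 0)"
  have cr: "c r \<noteq> 0" unfolding r_def by (rule LeastI[of _ r0]) (rule r0(2))
  have rle: "r \<le> card G" using Least_le[of "\<lambda>j. c j \<noteq> 0" r0] r0 by (simp add: r_def)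
  have c0: "c j = 0" if "j < r" for j using not_less_Least[of j "\<lambda>j. c j \<noteq> 0"] that by (auto simp: r_def)
  define J where "J = {Suc r..card G}"
  define s where "s = (\<lambda>x. \<Sum>j\<in>J. (- c j / c r) * q (j - Suc r) x)"
  have "q r x = (q (Suc r) \<star> s) x" for x
  proof -
    have "0 = (\<Sum>j\<le>card G. c j * q j x)" using dep by simp
    also have "\<dots> = (\<Sum>j\<in>insert r J. c j * q j x)"
      using rle c0 by (intro sum.mono_neutral_right) (auto simp: J_def not_le le_less_Suc_eq not_less_eq_eq)
    also have "\<dots> = c r * q r x + (\<Sum>j\<in>J. c j * q j x)" by (subst sum.insert) (auto simp: J_def)
    finally have "q r x = - (\<Sum>j\<in>J. c j * q j x) / c r" using cr by (simp add: field_simps eq_neg_iff_add_eq_0)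
    also have "\<dots> = (\<Sum>j\<in>J. (- c j / c r) * q j x)"
      by (simp add: sum_divide_distrib sum_negf[symmetric])
    also have "\<dots> = (\<Sum>j\<in>J. (- c j / c r) * (q (Suc r) \<star> q (j - Suc r)) x)"
      by (intro sum.cong refl) (auto simp: qadd[symmetric] J_def)
    also have "\<dots> = (q (Suc r) \<star> s) x" unfolding s_def conv_sum_right ..
    finally show ?thesis .
  qed
  then have qr: "q r = q (Suc r) \<star> s" by blast
  have sa: "s \<star> a = a \<star> s" unfolding s_def conv_sum_left conv_sum_right qa ..
  have fs: "f \<star> s = s" unfolding s_def conv_sum_right fq ..
  \<comment> \<open>Substituting the relation into itself raises the exponent at will. The value
    \<open>i = r + 1\<close> is used, giving the exponent 2r+1.\<close>
  have "\<exists>t. t \<star> a = a \<star> t \<and> f \<star> t = t \<and> t \<star> f = t \<and> q r = q (r + i) \<star> t" for i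
  proof (induction i)
    case 0
    show ?case using ff fa af qf by (intro exI[of _ f]) auto
  next
    case (Suc i)
    then obtain t where t: "t \<star> a = a \<star> t" "f \<star> t = t" "t \<star> f = t" "q r = q (r + i) \<star> t" by blast
    have "q r = q i \<star> (q r \<star> t)" using t(4) by (simp add: add.commute[of r] qadd conv_assoc)
    also have "\<dots> = q i \<star> (q (Suc r) \<star> (s \<star> t))" by (subst qr) (simp add: conv_assoc)
    also have "\<dots> = q (r + Suc i) \<star> (s \<star> t)"
      by (simp add: add.commute[of r] qadd conv_assoc flip: add_Suc_right)
    finally have "q r = q (r + Suc i) \<star> (s \<star> t)" .
    moreover have "(s \<star> t) \<star> a = a \<star> (s \<star> t)" by (metis conv_assoc t(1) sa)
    moreover have "f \<star> (s \<star> t) = s \<star> t" "(s \<star> t) \<star> f = s \<star> t"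
      by (auto simp: conv_assoc t(3)) (simp add: conv_assoc[symmetric] fs)
    ultimately show ?case by blast
  qed
  then obtain t where t: "t \<star> a = a \<star> t" "f \<star> t = t" "t \<star> f = t" "q r = q (r + Suc r) \<star> t" by blast
  have tq: "t \<star> q j = q j \<star> t" for j
  proof (induction j)
    case (Suc j)
    then show ?case by (metis conv_assoc qS t(1))
  qed (simp add: q0 t)
  \<comment> \<open>From \<open>q r \<star> \<epsilon> = q r\<close> idempotency follows, as
    \<open>\<epsilon>\<close> has \<open>q r\<close> as a factor. Primitivity leaves two cases:
    \<open>\<epsilon> = 0\<close> makes \<open>a\<close> nilpotent, and
    \<open>\<epsilon> = f\<close> exhibits a left inverse of \<open>a\<close>.\<close>
  define \<epsilon> where "\<epsilon> = q (Suc r) \<star> t"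
  have qre: "q r \<star> \<epsilon> = q r" unfolding \<epsilon>_def conv_assoc[symmetric] qadd[symmetric] using t(4) by simp
  have "\<epsilon> \<star> \<epsilon> = \<epsilon>"
  proof -
    have e: "\<epsilon> = a \<star> (t \<star> q r)" unfolding \<epsilon>_def qS conv_assoc tq ..
    have "\<epsilon> \<star> \<epsilon> = a \<star> (t \<star> (q r \<star> \<epsilon>))" by (subst (1) e) (simp add: conv_assoc)
    then show ?thesis using qre e by simp
  qed
  moreover have "f \<star> \<epsilon> = \<epsilon>" "\<epsilon> \<star> f = \<epsilon>"
    unfolding \<epsilon>_def by (simp add: conv_assoc[symmetric] fq) (simp add: conv_assoc t(3))
  ultimately consider "\<epsilon> = (\<lambda>x. 0)" | "\<epsilon> = f" using f unfolding primitive_idem_def by blast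
  then show ?thesis
  proof cases
    case 1
    then have "q r = (\<lambda>x. 0)" using qre by simp
    then show ?thesis unfolding q_def by blast
  next
    case 2
    have "\<epsilon> = (q r \<star> t) \<star> a" unfolding \<epsilon>_def qS by (metis conv_assoc qa t(1))
    then show ?thesis using 2 by metis
  qed
qed

text \<open>An irreducible quotient of \<open>k[G] f\<close> is a nonzero quotient of least dimension.\<close>
lemma cyc_cover:
  fixes f :: "'f mat \<Rightarrow> 'k::field"
  assumes f: "primitive_idem f" and c: "cyc f d \<rho> p"
  shows "\<exists>d\<pi> \<rho>\<pi> e. irreducible_rep n d\<pi> \<rho>\<pi> \<and> projective_cover n d\<pi> \<rho>\<pi> d \<rho> e \<and> e *\<^sub>v p \<noteq> 0\<^sub>v d\<pi>"
proof -
  note rep = cycD(1)[OF c] and pc = cycD(2)[OF c]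
  have ff: "f \<star> f = f" and fnz: "f \<noteq> (\<lambda>x. 0)" using f by (auto simp: primitive_idem_def)
  have sf: "supp f" using supp_conv[of f f] ff by simp
  have "p \<noteq> 0\<^sub>v d"
  proof
    assume "p = 0\<^sub>v d"
    then have "ract d \<rho> (dl (1\<^sub>m n)) *\<^sub>v p = 0\<^sub>v d" using ract_one[OF rep] by simp
    then have "dl (1\<^sub>m n) \<star> f = (\<lambda>x. 0)" by (rule cycD(5)[OF c])
    then show False using conv_one_left[OF sf] fnz by simp
  qed
  then have dpos: "d > 0" using pc by (metis carrier_vecD eq_vecI gr0I index_zero_vec(2) not_less0)
  define Q where "Q = (\<lambda>d'. d' > 0 \<and> (\<exists>\<rho>' e. is_rep n d' \<rho>' \<and> gmap n d \<rho> d' \<rho>' e \<and> surj_mat d d' (e :: 'k mat)))"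
  have "Q d"
  proof -
    have "gmap n d \<rho> d \<rho> (1\<^sub>m d)" using rep by (auto simp: gmap_def is_rep_def)
    moreover have "surj_mat d d (1\<^sub>m d :: 'k mat)" unfolding surj_mat_def by (metis one_mult_mat_vec)
    ultimately show ?thesis using rep dpos unfolding Q_def by blast
  qed
  define d' where "d' = (LEAST x. Q x)"
  have Qd': "Q d'" unfolding d'_def by (rule LeastI) (rule \<open>Q d\<close>)
  have least: "Q x \<Longrightarrow> d' \<le> x" for x unfolding d'_def by (rule Least_le)
  obtain \<rho>' e where d'pos: "d' > 0" and r': "is_rep n d' \<rho>'" and e: "gmap n d \<rho> d' \<rho>' e"
    and s: "surj_mat d d' e" using Qd' unfolding Q_def by blast
  have ec: "e \<in> carrier_mat d' d" using e by (simp add: gmap_def)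
  have irr: "irreducible_rep n d' \<rho>'"
    unfolding irreducible_rep_def
  proof (intro conjI allI impI)
    fix U assume "invariant_subspace n d' \<rho>' U"
    then have U: "ksubspace d' U" and inv: "\<And>g v. g \<in> G \<Longrightarrow> v \<in> U \<Longrightarrow> \<rho>' g *\<^sub>v v \<in> U"
      by (auto simp: invariant_subspace_def)
    obtain d2 A S where A: "A \<in> carrier_mat d2 d'" and S: "S \<in> carrier_mat d' d2" and AS: "A * S = 1\<^sub>m d2"
      and ker: "\<And>v. v \<in> carrier_vec d' \<Longrightarrow> A *\<^sub>v v = 0\<^sub>v d2 \<longleftrightarrow> v \<in> U"
      by (rule ksubspace_quotient[OF U], rule that, auto)
    have Uc: "U \<subseteq> carrier_vec d'" using U by (simp add: ksubspace_def)
    define \<rho>2 where "\<rho>2 = (\<lambda>g. A * (\<rho>' g * S))"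
    have gc: "\<rho>' g \<in> carrier_mat d' d'" if "g \<in> G" for g using is_repD(1)[OF r' that] .
    have r2c: "\<rho>2 g \<in> carrier_mat d2 d2" if "g \<in> G" for g using A S gc[OF that] by (auto simp: \<rho>2_def)
    have AG: "A * \<rho>' g = \<rho>2 g * A" if g: "g \<in> G" for g
    proof (rule mat_mult_vec_eq_imp_eq[of _ d2 d'])
      fix v :: "'k vec" assume v: "v \<in> carrier_vec d'"
      define x where "x = v - S *\<^sub>v (A *\<^sub>v v)"
      have Sc: "S *\<^sub>v (A *\<^sub>v v) \<in> carrier_vec d'" using S A v by auto
      have xc: "x \<in> carrier_vec d'" using v Sc by (auto simp: x_def)
      have "A *\<^sub>v (S *\<^sub>v (A *\<^sub>v v)) = (A * S) *\<^sub>v (A *\<^sub>v v)" using A S v by simp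
      also have "\<dots> = A *\<^sub>v v" using AS A v by simp
      finally have "A *\<^sub>v x = 0\<^sub>v d2"
        unfolding x_def using A v Sc by (simp add: mult_minus_distrib_mat_vec[of _ d2 d'])
      then have "x \<in> U" using ker xc by blast
      then have "\<rho>' g *\<^sub>v x \<in> U" using inv g by blast
      then have z: "A *\<^sub>v (\<rho>' g *\<^sub>v x) = 0\<^sub>v d2" using ker Uc by blast
      have "\<rho>' g *\<^sub>v x = \<rho>' g *\<^sub>v v - \<rho>' g *\<^sub>v (S *\<^sub>v (A *\<^sub>v v))"
        unfolding x_def using gc[OF g] v Sc by (rule mult_minus_distrib_mat_vec)
      then have "A *\<^sub>v (\<rho>' g *\<^sub>v v) - A *\<^sub>v (\<rho>' g *\<^sub>v (S *\<^sub>v (A *\<^sub>v v))) = 0\<^sub>v d2"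
        using z A gc[OF g] v Sc by (simp add: mult_minus_distrib_mat_vec[of _ d2 d'])
      then have "A *\<^sub>v (\<rho>' g *\<^sub>v v) = A *\<^sub>v (\<rho>' g *\<^sub>v (S *\<^sub>v (A *\<^sub>v v)))"
        using A gc[OF g] v Sc by - (rule vec_minus_eq_zero[of _ d2], auto)
      moreover have "(\<rho>2 g * A) *\<^sub>v v = A *\<^sub>v (\<rho>' g *\<^sub>v (S *\<^sub>v (A *\<^sub>v v)))"
      proof -
        have "(\<rho>2 g * A) *\<^sub>v v = \<rho>2 g *\<^sub>v (A *\<^sub>v v)" using r2c[OF g] A v by simp
        also have "\<dots> = A *\<^sub>v ((\<rho>' g * S) *\<^sub>v (A *\<^sub>v v))"
          unfolding \<rho>2_def using A S v gc[OF g] by (intro assoc_mult_mat_vec) auto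
        also have "(\<rho>' g * S) *\<^sub>v (A *\<^sub>v v) = \<rho>' g *\<^sub>v (S *\<^sub>v (A *\<^sub>v v))"
          using A S v gc[OF g] by (intro assoc_mult_mat_vec) auto
        finally show ?thesis .
      qed
      moreover have "(A * \<rho>' g) *\<^sub>v v = A *\<^sub>v (\<rho>' g *\<^sub>v v)"
        using A v gc[OF g] by (intro assoc_mult_mat_vec) auto
      ultimately show "(A * \<rho>' g) *\<^sub>v v = (\<rho>2 g * A) *\<^sub>v v" by simp
    qed (use A gc[OF g] r2c[OF g] in auto)
    have rep2: "is_rep n d2 \<rho>2"
      unfolding is_rep_def
    proof (intro conjI ballI)
      fix g h assume gh: "g \<in> G" "h \<in> G"
      note gc = gc[OF gh(1)] gc[OF gh(2)] and r2c = r2c[OF gh(1)] r2c[OF gh(2)]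
      have "\<rho>2 g * \<rho>2 h = (\<rho>2 g * A) * (\<rho>' h * S)"
        unfolding \<rho>2_def[THEN fun_cong, of h] using r2c gh A gc S
        by (intro assoc_mult_mat[symmetric, of _ d2 d2 _ d' _ d2]) auto
      also have "\<rho>2 g * A = A * \<rho>' g" using AG gh by simp
      also have "A * \<rho>' g * (\<rho>' h * S) = A * (\<rho>' g * (\<rho>' h * S))"
        using gh A gc S by (intro assoc_mult_mat[of _ d2 d' _ d' _ d2]) auto
      also have "\<rho>' g * (\<rho>' h * S) = (\<rho>' g * \<rho>' h) * S"
        using gh gc S by (intro assoc_mult_mat[symmetric, of _ d' d' _ d' _ d2]) auto
      also have "\<rho>' g * \<rho>' h = \<rho>' (g * h)" using is_repD(2)[OF r'] gh by simp
      finally show "\<rho>2 (g * h) = \<rho>2 g * \<rho>2 h" by (simp add: \<rho>2_def)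
    next
      show "\<rho>2 (1\<^sub>m n) = 1\<^sub>m d2" unfolding \<rho>2_def using is_repD(3)[OF r'] S AS by simp
    qed (use r2c in auto)
    have gA: "gmap n d' \<rho>' d2 \<rho>2 A" using A AG by (simp add: gmap_def)
    have surjA: "\<exists>v\<in>carrier_vec d'. A *\<^sub>v v = w" if w: "w \<in> carrier_vec d2" for w
    proof (intro bexI)
      have "A *\<^sub>v (S *\<^sub>v w) = (A * S) *\<^sub>v w" using A S w by simp
      then show "A *\<^sub>v (S *\<^sub>v w) = w" using AS w by simp
      show "S *\<^sub>v w \<in> carrier_vec d'" using S w by auto
    qed
    show "U = {0\<^sub>v d'} \<or> U = carrier_vec d'"
    proof (cases "d2 = 0")
      case True
      then have "A *\<^sub>v v = 0\<^sub>v d2" for v using A by (intro eq_vecI) auto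
      then show ?thesis using ker Uc by blast
    next
      case False
      have "surj_mat d d2 (A * e)"
        unfolding surj_mat_def
      proof
        fix w :: "'k vec" assume "w \<in> carrier_vec d2"
        then obtain v where v: "v \<in> carrier_vec d'" "A *\<^sub>v v = w" using surjA by blast
        then obtain u where u: "u \<in> carrier_vec d" "e *\<^sub>v u = v" using s by (auto simp: surj_mat_def)
        then have "(A * e) *\<^sub>v u = w" using A ec v by simp
        then show "\<exists>v\<in>carrier_vec d. A * e *\<^sub>v v = w" using u by blast
      qed
      \<comment> \<open>A nonzero quotient of the target by \<open>U\<close> is again a nonzero
        quotient of k[G] f. Minimality of \<open>d'\<close> makes the quotient map \<open>A\<close>
        square, hence injective, and its kernel \<open>U\<close> is zero.\<close>
      then have "Q d2" using False rep2 gmap_comp[OF e gA rep r' rep2] unfolding Q_def by blast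
      then have "d' \<le> d2" by (rule least)
      then have dd: "d2 = d'" using right_inverse_dim_le[OF A S AS] by simp
      have sA: "surj_mat d' d' A" using surjA unfolding surj_mat_def dd by blast
      have "v = 0\<^sub>v d'" if "v \<in> U" for v
        using surj_mat_square_inj[OF _ sA] A ker[of v] that Uc unfolding dd by blast
      moreover have "0\<^sub>v d' \<in> U" using U by (simp add: ksubspace_def)
      ultimately show ?thesis by blast
    qed
  qed (use r' d'pos in auto)
  have enz: "e *\<^sub>v p \<noteq> 0\<^sub>v d'"
  proof
    assume z: "e *\<^sub>v p = 0\<^sub>v d'"
    obtain v where v: "v \<in> carrier_vec d" "e *\<^sub>v v = unit_vec d' 0"
      using s unfolding surj_mat_def by (meson unit_vec_carrier)
    obtain a where "v = ract d \<rho> a *\<^sub>v p" using cycD(4)[OF c v(1)] by blast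
    then have "e *\<^sub>v v = ract d' \<rho>' a *\<^sub>v 0\<^sub>v d'" using gmap_ract_vec[OF rep r' e pc] z by simp
    then have "e *\<^sub>v v = 0\<^sub>v d'" by (simp add: mat_mult_zero_vec[OF ract_carrier])
    then show False using v(2) d'pos by (metis index_unit_vec(1) index_zero_vec(1) zero_neq_one)
  qed
  have "U = carrier_vec d"
    if U: "invariant_subspace n d \<rho> U" and onto: "\<forall>w\<in>carrier_vec d'. \<exists>v\<in>U. e *\<^sub>v v = w" for U
  proof -
    have Uc: "U \<subseteq> carrier_vec d" using U by (auto simp: invariant_subspace_def ksubspace_def)
    have "e *\<^sub>v p \<in> carrier_vec d'" using ec pc by auto
    then obtain v0 where v0: "v0 \<in> U" "e *\<^sub>v v0 = e *\<^sub>v p" using onto by blast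
    obtain b where b: "v0 = ract d \<rho> b *\<^sub>v p" using cycD(4)[OF c] v0 Uc by blast
    \<comment> \<open>Cutting by \<open>f\<close> on both sides places \<open>a\<close> in the
      corner algebra without changing the image under \<open>e\<close>, since \<open>f\<close> fixes
      \<open>p\<close> and hence its image.\<close>
    define a where "a = f \<star> (b \<star> f)"
    have fa: "f \<star> a = a" unfolding a_def by (simp add: conv_assoc[symmetric] ff)
    have af: "a \<star> f = a" unfolding a_def by (simp add: conv_assoc ff)
    define v where "v = ract d \<rho> a *\<^sub>v p"
    have v: "v = ract d \<rho> f *\<^sub>v v0"
      unfolding v_def a_def ract_conv_vec[OF rep pc] b cycD(3)[OF c] by simp
    have vU: "v \<in> U" unfolding v by (rule ract_invariant[OF rep U v0(1)])
    have v0c: "v0 \<in> carrier_vec d" using v0 Uc by auto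
    have ev: "e *\<^sub>v v = e *\<^sub>v p"
      unfolding v gmap_ract_vec[OF rep r' e v0c] v0(2)
      unfolding gmap_ract_vec[OF rep r' e pc, symmetric] cycD(3)[OF c] ..
    have epow: "e *\<^sub>v (ract d \<rho> (apow f a j) *\<^sub>v p) = e *\<^sub>v p" for j
    proof (induction j)
      case 0
      then show ?case by (simp add: cycD(3)[OF c])
    next
      case (Suc j)
      have "e *\<^sub>v (ract d \<rho> (apow f a (Suc j)) *\<^sub>v p) = ract d' \<rho>' a *\<^sub>v (e *\<^sub>v (ract d \<rho> (apow f a j) *\<^sub>v p))"
        unfolding apow.simps ract_conv_vec[OF rep pc]
        by (rule gmap_ract_vec[OF rep r' e]) (use pc in \<open>auto intro: mult_mat_vec_carrier\<close>)
      also have "\<dots> = e *\<^sub>v v"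
        unfolding Suc by (simp only: v_def gmap_ract_vec[OF rep r' e pc])
      finally show ?case using ev by simp
    qed
    \<comment> \<open>All powers of \<open>a\<close> carry \<open>p\<close> to vectors with the
      nonzero image of \<open>p\<close>, so \<open>a\<close> is not nilpotent and must have a left
      inverse.\<close>
    have "apow f a m \<noteq> (\<lambda>x. 0)" for m
    proof
      assume "apow f a m = (\<lambda>x. 0)"
      then have "e *\<^sub>v (0\<^sub>m d d *\<^sub>v p) = e *\<^sub>v p" using epow[of m] ract_zero by metis
      moreover have "0\<^sub>m d d *\<^sub>v p = 0\<^sub>v d" using pc by auto
      ultimately show False using enz ec by (simp add: mat_mult_zero_vec)
    qed
    then obtain s where sa: "s \<star> a = f" using fitting[OF f fa af] by blast
    have "p = ract d \<rho> s *\<^sub>v v" unfolding v_def ract_conv_vec[OF rep pc, symmetric] sa cycD(3)[OF c] ..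
    then have pU: "p \<in> U" using ract_invariant[OF rep U vU] by simp
    have "w \<in> U" if "w \<in> carrier_vec d" for w
      using cycD(4)[OF c that] ract_invariant[OF rep U pU] by blast
    then show ?thesis using Uc by blast
  qed
  then have "projective_cover n d' \<rho>' d \<rho> e"
    unfolding projective_cover_def using r' cyc_projective[OF ff c] e s by blast
  then show ?thesis using irr enz by blast
qed

end

section \<open>The Whittaker idempotent\<close>

text \<open>Sylow's theorem in the additive group gives a subgroup of order \<open>l\<close>, hence
  a nonzero \<open>x\<close> with \<open>l\<close> times \<open>x\<close> zero. Cancelling
  \<open>x\<close> shows that \<open>l\<close> vanishes in the field. This converts the assumption
  that the two characteristics differ into invertibility of the order of \<open>N\<close>.\<close>

lemma prime_dvd_card_field_imp_eq_CHAR: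
  assumes l: "prime l" and dvd: "l dvd CARD('f::{finite,field})"
  shows "l = CHAR('f)"
proof -
  define A :: "'f monoid" where "A = \<lparr>carrier = UNIV, monoid.mult = (+), one = 0\<rparr>"
  have grp: "group A"
  proof (rule groupI)
    fix x assume "x \<in> carrier A"
    show "\<exists>y\<in>carrier A. y \<otimes>\<^bsub>A\<^esub> x = \<one>\<^bsub>A\<^esub>" by (rule bexI[of _ "- x"]) (auto simp: A_def)
  qed (auto simp: A_def add.assoc)
  obtain m where "CARD('f) = l ^ 1 * m" using dvd by (auto elim: dvdE)
  then have ord: "Coset.order A = l ^ 1 * m" by (simp add: Coset.order_def A_def)
  have "finite (carrier A)" by (simp add: A_def)
  then obtain H where H: "subgroup H A" "card H = l"
    using sylow_thm[OF l grp ord] by auto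
  have "H \<noteq> {0}" using H(2) l by auto
  moreover have "0 \<in> H" using subgroup.one_closed[OF H(1)] by (simp add: A_def)
  ultimately obtain x where x: "x \<in> H" "x \<noteq> 0" by blast
  have pw: "x [^]\<^bsub>A\<^esub> (k::nat) = of_nat k * x" for k
    by (induction k) (auto simp: A_def nat_pow_def algebra_simps)
  interpret S: group "A\<lparr>carrier := H\<rparr>" using subgroup.subgroup_is_group[OF H(1) grp] .
  have "x [^]\<^bsub>A\<lparr>carrier := H\<rparr>\<^esub> Coset.order (A\<lparr>carrier := H\<rparr>) = \<one>\<^bsub>A\<lparr>carrier := H\<rparr>\<^esub>"
    using x by (intro S.pow_order_eq_1) auto
  then have "x [^]\<^bsub>A\<^esub> l = 0"
    using H(2) by (simp add: Coset.order_def nat_pow_def) (simp add: A_def)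
  then have "of_nat l = (0 :: 'f)" using pw x by simp
  then have "CHAR('f) dvd l" by (simp add: of_nat_eq_0_iff_char_dvd)
  then show ?thesis using l by (metis CHAR_not_1' One_nat_def prime_nat_iff)
qed

context gl
begin

text \<open>The entries above the diagonal are free. Only the prime divisors of the order of
  \<open>N\<close> matter later, so the exponent stays implicit.\<close>

lemma card_N_power: "\<exists>e. card N = CARD('f) ^ e"
proof -
  define S where "S = {(i,j). i < j \<and> j < n}"
  have "S \<subseteq> {..<n} \<times> {..<n}" by (auto simp: S_def)
  then have fS: "finite S" by (rule finite_subset) auto
  define F where "F = (\<lambda>u :: 'f mat. restrict (\<lambda>ij. u $$ ij) S)"
  have "bij_betw F N (PiE S (\<lambda>_. UNIV))"
  proof (rule bij_betw_imageI)
    show "inj_on F N"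
    proof (rule inj_onI)
      fix u v assume uv: "u \<in> N" "v \<in> N" and e: "F u = F v"
      show "u = v"
      proof (rule eq_matI)
        fix i j assume "i < dim_row v" "j < dim_col v"
        then have ij: "i < n" "j < n" using N_carrier[OF uv(2)] by auto
        consider "i < j" | "i = j" | "j < i" by linarith
        then show "u $$ (i,j) = v $$ (i,j)"
        proof cases
          case 1
          then have "(i,j) \<in> S" using ij by (simp add: S_def)
          then show ?thesis using fun_cong[OF e, of "(i,j)"] by (simp add: F_def)
        qed (use uv ij in \<open>auto simp: Nn_def\<close>)
      qed (use N_carrier[OF uv(1)] N_carrier[OF uv(2)] in auto)
    qed
    show "F ` N = PiE S (\<lambda>_. UNIV)"
    proof
      show "F ` N \<subseteq> PiE S (\<lambda>_. UNIV)" by (auto simp: F_def)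
      show "PiE S (\<lambda>_. UNIV) \<subseteq> F ` N"
      proof
        fix \<phi> :: "nat \<times> nat \<Rightarrow> 'f" assume p: "\<phi> \<in> PiE S (\<lambda>_. UNIV)"
        define u where "u = mat n n (\<lambda>(i,j). if i = j then 1 else if i < j then \<phi> (i,j) else 0)"
        have "u \<in> N" by (auto simp: u_def Nn_def)
        moreover have "F u = \<phi>"
        proof
          fix ij show "F u ij = \<phi> ij"
          proof (cases "ij \<in> S")
            case True
            then obtain i j where "ij = (i,j)" "i < j" "j < n" by (auto simp: S_def)
            then show ?thesis using True by (simp add: F_def u_def)
          next
            case False
            then show ?thesis using PiE_arb[OF p False] by (simp add: F_def)
          qed
        qed
        ultimately show "\<phi> \<in> F ` N" by blast
      qed
    qed
  qed
  then have "card N = card (PiE S (\<lambda>_. UNIV :: 'f set))" by (rule bij_betw_same_card)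
  also have "\<dots> = CARD('f) ^ card S" using fS by (simp add: card_PiE)
  finally show ?thesis by blast
qed

lemma conv_dl_right: "g \<in> G \<Longrightarrow> x \<in> G \<Longrightarrow> (a \<star> dl g) x = a (x * ginv g)"
proof -
  assume g: "g \<in> G" and x: "x \<in> G"
  have "ginv h * x = g \<longleftrightarrow> h = x * ginv g" if h: "h \<in> G" for h
    using ginv_cancel_left'[OF h x] h g x by (auto simp: G_assoc ginv_mult)
  then have "(\<Sum>h\<in>G. a h * dl g (ginv h * x)) = (\<Sum>h\<in>G. if h = x * ginv g then a h else 0)"
    by (intro sum.cong refl) (auto simp: dl_def)
  then show ?thesis using g x by (simp add: conv_def)
qed

lemma ract_smult: "ract d \<rho> (\<lambda>x. c * a x) = c \<cdot>\<^sub>m ract d \<rho> a"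
  by (intro eq_matI) (auto simp: ract_def sum_distrib_left mult.assoc)

text \<open>The coefficient at the identity is a symmetric trace form on k[G]; it allows the
  idempotent to be moved from one end of a product to the other.\<close>

lemma conv_trace: "(a \<star> b) (1\<^sub>m n) = (b \<star> a) (1\<^sub>m n)"
proof -
  have "(a \<star> b) (1\<^sub>m n) = (\<Sum>h\<in>G. a h * b (ginv h))" by (simp add: conv_def)
  also have "\<dots> = (\<Sum>h\<in>G. a (ginv h) * b (ginv (ginv h)))" by (rule sum_G_inv[symmetric])
  also have "\<dots> = (\<Sum>h\<in>G. b h * a (ginv h))" by (intro sum.cong refl) (auto simp: mult.commute)
  also have "\<dots> = (b \<star> a) (1\<^sub>m n)" by (simp add: conv_def)
  finally show ?thesis .
qed

text \<open>Links the sum over chosen coset representatives in \<open>sum_NG\<close> with the sum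
  over all of \<open>G\<close> that occurs in the group algebra action. Invariance under
  \<open>N\<close> makes the choice of representatives immaterial.\<close>

lemma sum_right_cosets:
  fixes F :: "'f mat \<Rightarrow> 'k::field"
  assumes F: "\<And>u g. u \<in> N \<Longrightarrow> g \<in> G \<Longrightarrow> F (u * g) = F g"
  shows "(\<Sum>g\<in>G. F g) = of_nat (card N) * (\<Sum>C\<in>right_cosets_N n. F (coset_rep C))"
proof -
  define c where "c = (\<lambda>g :: 'f mat. (\<lambda>u. u * g) ` N)"
  have cosets: "right_cosets_N n = c ` G" by (simp add: right_cosets_N_def c_def)
  have self: "g \<in> c g" if "g \<in> G" for g
    unfolding c_def using that by (intro image_eqI[of _ _ "1\<^sub>m n"]) auto
  have cG: "c g \<subseteq> G" if "g \<in> G" for g using that by (auto simp: c_def)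
  have ceq: "c x = c y" if y: "y \<in> G" and x: "x \<in> c y" for x y
  proof -
    obtain u where u: "u \<in> N" "x = u * y" using x by (auto simp: c_def)
    show ?thesis
    proof
      show "c x \<subseteq> c y"
      proof
        fix z assume "z \<in> c x"
        then obtain w where w: "w \<in> N" "z = w * x" by (auto simp: c_def)
        then have "z = (w * u) * y" using u y by (simp add: G_assoc)
        then show "z \<in> c y" using w u by (auto simp: c_def)
      qed
      show "c y \<subseteq> c x"
      proof
        fix z assume "z \<in> c y"
        then obtain w where w: "w \<in> N" "z = w * y" by (auto simp: c_def)
        then have "z = (w * ginv u) * x" using u y by (simp add: G_assoc)
        then show "z \<in> c x" using w u by (auto simp: c_def)
      qed
    qed
  qed
  have "(\<Sum>g\<in>G. F g) = (\<Sum>C\<in>c ` G. \<Sum>x\<in>{x\<in>G. c x = C}. F x)" by (rule sum.image_gen) simp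
  also have "\<dots> = (\<Sum>C\<in>c ` G. of_nat (card N) * F (coset_rep C))"
  proof (rule sum.cong[OF refl])
    fix C assume "C \<in> c ` G"
    then obtain g where g: "g \<in> G" "C = c g" by blast
    have fib: "{x\<in>G. c x = C} = C" using self ceq g cG by blast
    have "coset_rep C \<in> C" unfolding coset_rep_def using self[OF g(1)] g(2) by (auto intro: someI)
    then obtain u0 where u0: "u0 \<in> N" "coset_rep C = u0 * g" using g by (auto simp: c_def)
    have const: "F x = F (coset_rep C)" if "x \<in> C" for x
      using that g u0 F by (auto simp: c_def)
    have "inj_on (\<lambda>u. u * g) N"
      using g by (metis (no_types, lifting) N_G ginv_cancel_right inj_onI)
    then have "card C = card N" unfolding g(2) c_def by (rule card_image)
    then show "(\<Sum>x\<in>{x\<in>G. c x = C}. F x) = of_nat (card N) * F (coset_rep C)"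
      unfolding fib using const by simp
  qed
  finally show ?thesis by (simp add: cosets sum_distrib_left)
qed

end

locale gelfand_graev = gl n ty for n :: nat and ty :: "'f::{finite,field} itself" +
  fixes \<psi> :: "'f \<Rightarrow> 'k::field"
  assumes psi: "nontriv_add_char \<psi>"
    and card_N_nonzero: "of_nat (card N) \<noteq> (0 :: 'k)"
begin

definition add_char :: "('f \<Rightarrow> 'k) \<Rightarrow> bool" where
  "add_char \<phi> \<longleftrightarrow> (\<forall>a b. \<phi> (a + b) = \<phi> a * \<phi> b) \<and> (\<forall>a. \<phi> a \<noteq> 0)"

lemma add_char_psi: "add_char \<psi>"
  using psi by (auto simp: add_char_def nontriv_add_char_def)

lemma add_char_inverse: "add_char \<phi> \<Longrightarrow> add_char (\<lambda>a. inverse (\<phi> a))"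
  by (auto simp: add_char_def)

lemma psiN_inverse: "psiN (\<lambda>a. inverse (\<phi> a)) n u = inverse (psiN \<phi> n u)"
  by (simp add: psiN_def)

lemma psiN_N:
  assumes "add_char \<phi>"
  shows "u \<in> N \<Longrightarrow> v \<in> N \<Longrightarrow> psiN \<phi> n (u * v) = psiN \<phi> n u * psiN \<phi> n v"
    "psiN \<phi> n u \<noteq> 0" "psiN \<phi> n (1\<^sub>m n) = 1"
    "u \<in> N \<Longrightarrow> psiN \<phi> n (ginv u) = inverse (psiN \<phi> n u)"
proof -
  have nz: "psiN \<phi> n u \<noteq> 0" for u using assms by (simp add: psiN_def add_char_def)
  have mult: "u \<in> N \<Longrightarrow> v \<in> N \<Longrightarrow> psiN \<phi> n (u * v) = psiN \<phi> n u * psiN \<phi> n v" for u v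
    using assms by (intro psiN_mult) (auto simp: add_char_def)
  show "u \<in> N \<Longrightarrow> v \<in> N \<Longrightarrow> psiN \<phi> n (u * v) = psiN \<phi> n u * psiN \<phi> n v" by (rule mult)
  show "psiN \<phi> n u \<noteq> 0" by (rule nz)
  have "psiN \<phi> n (1\<^sub>m n) * psiN \<phi> n (1\<^sub>m n) = psiN \<phi> n (1\<^sub>m n)"
    using mult[OF N_one N_one] by simp
  then show one: "psiN \<phi> n (1\<^sub>m n) = 1" using nz by simp
  assume u: "u \<in> N"
  then have "psiN \<phi> n u * psiN \<phi> n (ginv u) = 1" using mult[of u "ginv u"] one by simp
  then show "psiN \<phi> n (ginv u) = inverse (psiN \<phi> n u)" by (metis inverse_unique)
qed

text \<open>The idempotent \<open>eid \<phi>\<close> projects onto the vectors on which \<open>N\<close> acts by the character of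
  the inverse of \<open>\<phi>\<close>.\<close>
definition eid :: "('f \<Rightarrow> 'k) \<Rightarrow> 'f mat \<Rightarrow> 'k" where
  "eid \<phi> = (\<lambda>x. if x \<in> N then psiN \<phi> n x / of_nat (card N) else 0)"

lemma N_mult_left_iff: "u \<in> N \<Longrightarrow> x \<in> G \<Longrightarrow> u * x \<in> N \<longleftrightarrow> x \<in> N"
  by (metis N_G N_inv N_mult ginv_cancel_left)

lemma N_mult_right_iff: "u \<in> N \<Longrightarrow> x \<in> G \<Longrightarrow> x * u \<in> N \<longleftrightarrow> x \<in> N"
  by (metis N_G N_inv N_mult ginv_cancel_right)

lemma eid_left: "add_char \<phi> \<Longrightarrow> u \<in> N \<Longrightarrow> x \<in> G \<Longrightarrow> eid \<phi> (u * x) = psiN \<phi> n u * eid \<phi> x"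
  by (simp add: eid_def N_mult_left_iff psiN_N(1))

lemma eid_right: "add_char \<phi> \<Longrightarrow> u \<in> N \<Longrightarrow> x \<in> G \<Longrightarrow> eid \<phi> (x * u) = psiN \<phi> n u * eid \<phi> x"
  by (simp add: eid_def N_mult_right_iff psiN_N(1))

lemma supp_eid [simp, intro]: "supp (eid \<phi>)"
  by (auto simp: supp_def eid_def)

lemma eid_conv_left:
  assumes p: "add_char \<phi>" and u: "u \<in> N" and x: "x \<in> G"
  shows "(eid \<phi> \<star> a) (u * x) = psiN \<phi> n u * (eid \<phi> \<star> a) x"
proof -
  have uG: "u \<in> G" using u by auto
  have "(eid \<phi> \<star> a) (u * x) = (\<Sum>h\<in>G. eid \<phi> h * a (ginv h * (u * x)))"
    using uG x by (simp add: conv_def)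
  also have "\<dots> = (\<Sum>h\<in>G. eid \<phi> (u * h) * a (ginv (u * h) * (u * x)))"
    by (rule sum_G_left[OF uG, symmetric])
  also have "\<dots> = (\<Sum>h\<in>G. psiN \<phi> n u * (eid \<phi> h * a (ginv h * x)))"
    using uG x by (intro sum.cong refl) (auto simp: eid_left[OF p u] ginv_mult G_assoc)
  also have "\<dots> = psiN \<phi> n u * (eid \<phi> \<star> a) x" using x by (simp add: conv_def sum_distrib_left)
  finally show ?thesis .
qed

lemma eid_conv_right:
  assumes p: "add_char \<phi>" and u: "u \<in> N" and x: "x \<in> G"
  shows "(a \<star> eid \<phi>) (x * u) = psiN \<phi> n u * (a \<star> eid \<phi>) x"
proof -
  have "(a \<star> eid \<phi>) (x * u) = (\<Sum>h\<in>G. a h * eid \<phi> ((ginv h * x) * u))"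
    using u x by (auto simp: conv_def G_assoc intro!: sum.cong)
  also have "\<dots> = (\<Sum>h\<in>G. psiN \<phi> n u * (a h * eid \<phi> (ginv h * x)))"
    using x by (intro sum.cong refl) (simp add: eid_right[OF p u])
  also have "\<dots> = psiN \<phi> n u * (a \<star> eid \<phi>) x" using x by (simp add: conv_def sum_distrib_left)
  finally show ?thesis .
qed

text \<open>For equivariant \<open>a\<close> the character in \<open>eid\<close> cancels the one
  produced by translation, so the average over \<open>N\<close> has equal terms.\<close>

lemma eid_absorb:
  assumes p: "add_char \<phi>" and s: "supp a"
    and a: "\<And>u x. u \<in> N \<Longrightarrow> x \<in> G \<Longrightarrow> a (u * x) = psiN \<phi> n u * a x"
  shows "eid \<phi> \<star> a = a"
proof
  fix x
  show "(eid \<phi> \<star> a) x = a x"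
  proof (cases "x \<in> G")
    case x: True
    have "(eid \<phi> \<star> a) x = (\<Sum>h\<in>G. eid \<phi> h * a (ginv h * x))" using x by (simp add: conv_def)
    also have "\<dots> = (\<Sum>h\<in>N. eid \<phi> h * a (ginv h * x))"
      by (rule sum.mono_neutral_right) (auto simp: eid_def)
    also have "\<dots> = (\<Sum>h\<in>N. a x / of_nat (card N))"
    proof (rule sum.cong[OF refl])
      fix h assume h: "h \<in> N"
      have "eid \<phi> h * a (ginv h * x) = psiN \<phi> n h / of_nat (card N) * (inverse (psiN \<phi> n h) * a x)"
        using a[of "ginv h" x] h x psiN_N(4)[OF p h] by (simp add: eid_def)
      also have "\<dots> = a x / of_nat (card N)" using psiN_N(2)[OF p, of h] by (simp add: field_simps)
      finally show "eid \<phi> h * a (ginv h * x) = a x / of_nat (card N)" .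
    qed
    also have "\<dots> = a x" using card_N_nonzero by simp
    finally show ?thesis .
  qed (use s in \<open>simp add: conv_def supp_def\<close>)
qed

lemma eid_idem: "add_char \<phi> \<Longrightarrow> eid \<phi> \<star> eid \<phi> = eid \<phi>"
  by (rule eid_absorb) (auto simp: eid_left)

lemma eid_dl:
  assumes p: "add_char \<phi>" and u: "u \<in> N"
  shows "eid \<phi> \<star> dl u = (\<lambda>x. inverse (psiN \<phi> n u) * eid \<phi> x)"
proof
  fix x
  show "(eid \<phi> \<star> dl u) x = inverse (psiN \<phi> n u) * eid \<phi> x"
  proof (cases "x \<in> G")
    case x: True
    have "(eid \<phi> \<star> dl u) x = eid \<phi> (x * ginv u)" by (rule conv_dl_right[OF N_G[OF u] x])
    also have "\<dots> = inverse (psiN \<phi> n u) * eid \<phi> x"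
      unfolding eid_right[OF p N_inv[OF u] x] psiN_N(4)[OF p u] ..
    finally show ?thesis .
  next
    case False
    then show ?thesis using supp_eid[of \<phi>] by (auto simp: conv_def supp_def)
  qed
qed

lemma eid_act_N:
  assumes p: "add_char \<phi>" and r: "is_rep n d \<rho>" and u: "u \<in> N" and v: "v \<in> carrier_vec d"
  shows "ract d \<rho> (eid \<phi>) *\<^sub>v (\<rho> u *\<^sub>v v) = inverse (psiN \<phi> n u) \<cdot>\<^sub>v (ract d \<rho> (eid \<phi>) *\<^sub>v v)"
proof -
  have "ract d \<rho> (eid \<phi>) *\<^sub>v (\<rho> u *\<^sub>v v) = ract d \<rho> (eid \<phi> \<star> dl u) *\<^sub>v v"
    using ract_conv_vec[OF r v] ract_dl[OF r] u by (metis N_G)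
  also have "\<dots> = inverse (psiN \<phi> n u) \<cdot>\<^sub>v (ract d \<rho> (eid \<phi>) *\<^sub>v v)"
    unfolding eid_dl[OF p u] ract_smult using v by (intro eq_vecI) (auto simp: ract_def)
  finally show ?thesis .
qed

section \<open>Coinvariants as the image of the idempotent\<close>

lemma coinv_kernel_generators_carrier:
  assumes "is_rep n d \<rho>"
  shows "{\<rho> u *\<^sub>v v - psiN \<phi> n u \<cdot>\<^sub>v v | u v. u \<in> N \<and> v \<in> carrier_vec d} \<subseteq> carrier_vec d"
proof
  fix x assume "x \<in> {\<rho> u *\<^sub>v v - psiN \<phi> n u \<cdot>\<^sub>v v | u v. u \<in> N \<and> v \<in> carrier_vec d}"
  then obtain u v where x: "x = \<rho> u *\<^sub>v v - psiN \<phi> n u \<cdot>\<^sub>v v" and u: "u \<in> N" and v: "v \<in> carrier_vec d"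
    by blast
  have "\<rho> u \<in> carrier_mat d d" by (rule is_repD(1)[OF assms N_G[OF u]])
  then show "x \<in> carrier_vec d" unfolding x using v by auto
qed

text \<open>The kernel of the idempotent is a subspace, so only the generators need checking, and on
  them the scalars from \<open>eid_act_N\<close> cancel. Together with
  \<open>minus_eid_coinv_kernel\<close> this identifies the coinvariants for the inverse of
  \<open>\<phi>\<close> with the image of \<open>eid \<phi>\<close>.\<close>

lemma eid_coinv_kernel:
  assumes p: "add_char \<phi>" and r: "is_rep n d \<rho>" and v: "v \<in> coinv_kernel n (\<lambda>a. inverse (\<phi> a)) d \<rho>"
  shows "ract d \<rho> (eid \<phi>) *\<^sub>v v = 0\<^sub>v d"
proof -
  define U where "U = {v \<in> carrier_vec d. ract d \<rho> (eid \<phi>) *\<^sub>v v = 0\<^sub>v d}"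
  have "ksubspace d U"
    unfolding ksubspace_def U_def
    by (auto simp: mat_mult_zero_vec[OF ract_carrier] mult_add_distrib_mat_vec[OF ract_carrier]
        mult_mat_vec[OF ract_carrier])
  moreover have "{\<rho> u *\<^sub>v v - psiN (\<lambda>a. inverse (\<phi> a)) n u \<cdot>\<^sub>v v | u v. u \<in> N \<and> v \<in> carrier_vec d} \<subseteq> U"
  proof
    fix x assume "x \<in> {\<rho> u *\<^sub>v v - psiN (\<lambda>a. inverse (\<phi> a)) n u \<cdot>\<^sub>v v | u v. u \<in> N \<and> v \<in> carrier_vec d}"
    then obtain u w where x: "x = \<rho> u *\<^sub>v w - inverse (psiN \<phi> n u) \<cdot>\<^sub>v w" and u: "u \<in> N" and w: "w \<in> carrier_vec d"
      by (auto simp: psiN_inverse)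
    have uc: "\<rho> u *\<^sub>v w \<in> carrier_vec d" using is_repD(1)[OF r, of u] u w by auto
    have "ract d \<rho> (eid \<phi>) *\<^sub>v x = ract d \<rho> (eid \<phi>) *\<^sub>v (\<rho> u *\<^sub>v w) -
      ract d \<rho> (eid \<phi>) *\<^sub>v (inverse (psiN \<phi> n u) \<cdot>\<^sub>v w)"
      unfolding x using uc w by (intro mult_minus_distrib_mat_vec[OF ract_carrier]) auto
    also have "\<dots> = 0\<^sub>v d"
      unfolding eid_act_N[OF p r u w] mult_mat_vec[OF ract_carrier w]
      by (intro eq_vecI) (auto simp: ract_def)
    finally show "x \<in> U" unfolding U_def using uc w x by auto
  qed
  ultimately have "coinv_kernel n (\<lambda>a. inverse (\<phi> a)) d \<rho> \<subseteq> U"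
    unfolding coinv_kernel_def by (rule kspan_minimal)
  then show ?thesis using v by (auto simp: U_def)
qed

lemma minus_eid_coinv_kernel:
  assumes p: "add_char \<phi>" and r: "is_rep n d \<rho>" and v: "v \<in> carrier_vec d"
  shows "v - ract d \<rho> (eid \<phi>) *\<^sub>v v \<in> coinv_kernel n (\<lambda>a. inverse (\<phi> a)) d \<rho>"
proof -
  define K where "K = coinv_kernel n (\<lambda>a. inverse (\<phi> a)) d \<rho>"
  have K: "ksubspace d K"
    unfolding K_def coinv_kernel_def by (rule kspan_ksubspace[OF coinv_kernel_generators_carrier[OF r]])
  \<comment> \<open>The weights are chosen so that the terms in \<open>\<rho> u *\<^sub>v v\<close>
    sum to minus the projection of \<open>v\<close>, while each term in \<open>v\<close> has weight
    one over the order of \<open>N\<close>.\<close>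
  define F where "F = (\<lambda>u. (- (psiN \<phi> n u / of_nat (card N))) \<cdot>\<^sub>v
    (\<rho> u *\<^sub>v v - psiN (\<lambda>a. inverse (\<phi> a)) n u \<cdot>\<^sub>v v))"
  have FK: "F u \<in> K" if "u \<in> N" for u
  proof -
    have "\<rho> u *\<^sub>v v - psiN (\<lambda>a. inverse (\<phi> a)) n u \<cdot>\<^sub>v v \<in> K"
      unfolding K_def coinv_kernel_def using that v
      by (intro subsetD[OF kspan_superset]) blast
    then show ?thesis using K unfolding F_def ksubspace_def by blast
  qed
  have "v - ract d \<rho> (eid \<phi>) *\<^sub>v v = vec d (\<lambda>i. \<Sum>u\<in>N. F u $ i)"
  proof (rule eq_vecI)
    fix i assume "i < dim_vec (vec d (\<lambda>i. \<Sum>u\<in>N. F u $ i))"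
    then have i: "i < d" by simp
    have c: "dim_vec (\<rho> g *\<^sub>v v) = d" if "g \<in> G" for g using is_repD(1)[OF r that] by auto
    have "(ract d \<rho> (eid \<phi>) *\<^sub>v v) $ i = (\<Sum>g\<in>G. eid \<phi> g * (\<rho> g *\<^sub>v v) $ i)"
      unfolding ract_vec[OF r v] using i c by (auto intro!: sum.cong)
    also have "\<dots> = (\<Sum>u\<in>N. eid \<phi> u * (\<rho> u *\<^sub>v v) $ i)"
      by (rule sum.mono_neutral_right) (auto simp: eid_def)
    finally have e: "(ract d \<rho> (eid \<phi>) *\<^sub>v v) $ i = (\<Sum>u\<in>N. eid \<phi> u * (\<rho> u *\<^sub>v v) $ i)" .
    have "F u $ i = v $ i / of_nat (card N) - eid \<phi> u * (\<rho> u *\<^sub>v v) $ i" if u: "u \<in> N" for u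
    proof -
      have "F u $ i = - (psiN \<phi> n u / of_nat (card N)) * ((\<rho> u *\<^sub>v v) $ i - inverse (psiN \<phi> n u) * v $ i)"
        unfolding F_def psiN_inverse using i c[OF N_G[OF u]] v by (simp del: index_mult_mat_vec)
      also have "\<dots> = v $ i / of_nat (card N) - eid \<phi> u * (\<rho> u *\<^sub>v v) $ i"
        using u psiN_N(2)[OF p, of u] card_N_nonzero by (simp add: eid_def field_simps del: index_mult_mat_vec)
      finally show ?thesis .
    qed
    then have "(\<Sum>u\<in>N. F u $ i) = (\<Sum>u\<in>N. v $ i / of_nat (card N)) - (\<Sum>u\<in>N. eid \<phi> u * (\<rho> u *\<^sub>v v) $ i)"
      by (simp add: sum_subtractf)
    also have "(\<Sum>u\<in>N. v $ i / of_nat (card N)) = v $ i" using card_N_nonzero by simp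
    finally show "(v - ract d \<rho> (eid \<phi>) *\<^sub>v v) $ i = vec d (\<lambda>i. \<Sum>u\<in>N. F u $ i) $ i"
      using i v e by (simp add: ract_def del: index_mult_mat_vec)
  qed (simp add: ract_def)
  then show ?thesis using ksubspace_sum[OF K finite_N FK] by (simp add: K_def)
qed

abbreviation e\<psi> :: "'f mat \<Rightarrow> 'k" where "e\<psi> \<equiv> eid \<psi>"

lemma hecke_commute:
  assumes a: "e\<psi> \<star> a = a" "a \<star> e\<psi> = a" and b: "e\<psi> \<star> b = b" "b \<star> e\<psi> = b"
  shows "a \<star> b = b \<star> a"
proof -
  have bi: "bi_equivariant \<psi> c" if c: "e\<psi> \<star> c = c" "c \<star> e\<psi> = c" for c
    unfolding bi_equivariant_def
  proof (intro ballI)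
    fix u v g assume "u \<in> N" "v \<in> N" "g \<in> G"
    then show "c (u * g * v) = psiN \<psi> n u * psiN \<psi> n v * c g"
      using eid_conv_left[OF add_char_psi, of u "g * v" c] eid_conv_right[OF add_char_psi, of v g c] c
      by (simp add: G_assoc)
  qed
  have "e\<psi> \<star> (a \<star> b) = a \<star> b" "(a \<star> b) \<star> e\<psi> = a \<star> b"
    by (simp add: conv_assoc[symmetric] a) (simp add: conv_assoc b)
  then show ?thesis using gelfand_graev_commute[OF psi bi bi bi] a b by blast
qed

text \<open>Evaluation at \<open>p\<close> identifies the endomorphism ring with f P. As e P lies in
  f P, each projected vector equals \<open>\<Lambda> v *\<^sub>v p\<close> for a unique endomorphism
  \<open>\<Lambda> v\<close>, and uniqueness makes \<open>\<Lambda>\<close> linear over the ring. It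
  generates the dual because modulo the coinvariant kernel every vector is such an endomorphism
  applied to \<open>p\<close>.\<close>

lemma cyc_dual_generator:
  assumes fe: "e\<psi> \<star> f = f" "f \<star> e\<psi> = f" and ff: "f \<star> f = f" and c: "cyc f d \<rho> p"
  shows "\<exists>\<Lambda>. coinv_dual_generator n (\<lambda>a. inverse (\<psi> a)) d \<rho> \<Lambda> \<and>
    (\<forall>v\<in>carrier_vec d. \<Lambda> v *\<^sub>v p = ract d \<rho> e\<psi> *\<^sub>v v)"
proof -
  note rep = cycD(1)[OF c] and pc = cycD(2)[OF c]
  let ?R = "endo_ring n d \<rho>"
  have rc: "ract d \<rho> a *\<^sub>v v \<in> carrier_vec d" if "v \<in> carrier_vec d" for a v
    using that by (auto intro: mult_mat_vec_carrier)
  \<comment> \<open>The projected vector is \<open>x\<close> applied to \<open>p\<close> for some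
    \<open>x\<close> in e k[G] f. Both \<open>x\<close> and \<open>f\<close> lie in the commutative
    corner of \<open>e\<psi>\<close>, so \<open>f \<star> x = x \<star> f = x\<close>.\<close>
  have fE: "ract d \<rho> f *\<^sub>v (ract d \<rho> e\<psi> *\<^sub>v v) = ract d \<rho> e\<psi> *\<^sub>v v" if v: "v \<in> carrier_vec d" for v
  proof -
    obtain a where a: "v = ract d \<rho> a *\<^sub>v p" using cycD(4)[OF c v] by blast
    define x where "x = e\<psi> \<star> (a \<star> f)"
    have "e\<psi> \<star> x = x" "x \<star> e\<psi> = x" "x \<star> f = x"
      unfolding x_def
        apply (simp add: conv_assoc[symmetric] eid_idem[OF add_char_psi])
       apply (simp add: conv_assoc fe)
      apply (simp add: conv_assoc ff)
      done
    then have fx: "f \<star> x = x" using hecke_commute[of f x] fe by simp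
    have "ract d \<rho> x *\<^sub>v p = ract d \<rho> e\<psi> *\<^sub>v v"
      unfolding x_def a ract_conv_vec[OF rep pc] cycD(3)[OF c] ..
    then show ?thesis using ract_conv_vec[OF rep pc, of f x] fx by simp
  qed
  have ex: "\<forall>v. \<exists>\<Phi>. v \<in> carrier_vec d \<longrightarrow> gmap n d \<rho> d \<rho> \<Phi> \<and> \<Phi> *\<^sub>v p = ract d \<rho> e\<psi> *\<^sub>v v"
    using cyc_map[OF c rep] rc fE by blast
  obtain \<Lambda> where L1: "\<And>v. v \<in> carrier_vec d \<Longrightarrow> gmap n d \<rho> d \<rho> (\<Lambda> v)"
    and L2: "\<And>v. v \<in> carrier_vec d \<Longrightarrow> \<Lambda> v *\<^sub>v p = ract d \<rho> e\<psi> *\<^sub>v v"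
    using choice[OF ex] by blast
  have RD: "A \<in> carrier_mat d d" if "A \<in> ?R" for A using that by (simp add: endo_ring_def gmap_def)
  have Rm: "A * B \<in> ?R" if "A \<in> ?R" "B \<in> ?R" for A B
    using that gmap_comp[OF _ _ rep rep rep] by (auto simp: endo_ring_def)
  have Ra: "A + B \<in> ?R" if AB: "A \<in> ?R" "B \<in> ?R" for A B
    unfolding endo_ring_def gmap_def
  proof (intro CollectI conjI ballI)
    show "A + B \<in> carrier_mat d d" using RD AB by auto
    fix g assume g: "g \<in> G"
    have gc: "\<rho> g \<in> carrier_mat d d" using is_repD(1)[OF rep g] .
    have "A * \<rho> g = \<rho> g * A" "B * \<rho> g = \<rho> g * B" using AB g by (auto simp: endo_ring_def gmap_def)
    then show "(A + B) * \<rho> g = \<rho> g * (A + B)"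
      using add_mult_distrib_mat[OF RD[OF AB(1)] RD[OF AB(2)] gc]
        mult_add_distrib_mat[OF gc RD[OF AB(1)] RD[OF AB(2)]] by simp
  qed
  have Req: "A = B" if "A \<in> ?R" "B \<in> ?R" "A *\<^sub>v p = B *\<^sub>v p" for A B
    using cyc_unique[OF c rep] that by (auto simp: endo_ring_def)
  have LR: "\<Lambda> v \<in> ?R" if "v \<in> carrier_vec d" for v using L1[OF that] by (simp add: endo_ring_def)
  \<comment> \<open>An endomorphism commutes with \<open>f\<close>, so its value at \<open>p\<close>
    comes from an element of f k[G] f, which lies in the Hecke algebra. Commutativity of that
    algebra then passes to the endomorphism ring.\<close>
  have Rp: "\<exists>a. e\<psi> \<star> a = a \<and> a \<star> e\<psi> = a \<and> A *\<^sub>v p = ract d \<rho> a *\<^sub>v p" if A: "A \<in> ?R" for A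
  proof -
    have gA: "gmap n d \<rho> d \<rho> A" using A by (simp add: endo_ring_def)
    have "A *\<^sub>v p \<in> carrier_vec d" using RD[OF A] pc by auto
    then obtain a where a: "A *\<^sub>v p = ract d \<rho> a *\<^sub>v p" using cycD(4)[OF c] by blast
    have "A *\<^sub>v p = ract d \<rho> f *\<^sub>v (A *\<^sub>v p)"
      using gmap_ract_vec[OF rep rep gA pc, of f] cycD(3)[OF c] by simp
    also have "\<dots> = ract d \<rho> (f \<star> (a \<star> f)) *\<^sub>v p"
      unfolding a ract_conv_vec[OF rep pc] cycD(3)[OF c] ..
    finally have "A *\<^sub>v p = ract d \<rho> (f \<star> (a \<star> f)) *\<^sub>v p" .
    moreover have "e\<psi> \<star> (f \<star> (a \<star> f)) = f \<star> (a \<star> f)" by (simp add: conv_assoc[symmetric] fe)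
    moreover have "(f \<star> (a \<star> f)) \<star> e\<psi> = f \<star> (a \<star> f)" by (simp add: conv_assoc fe)
    ultimately show ?thesis by blast
  qed
  have Rcomm: "A * B = B * A" if A: "A \<in> ?R" and B: "B \<in> ?R" for A B
  proof -
    obtain a where a: "e\<psi> \<star> a = a" "a \<star> e\<psi> = a" "A *\<^sub>v p = ract d \<rho> a *\<^sub>v p" using Rp[OF A] by blast
    obtain b where b: "e\<psi> \<star> b = b" "b \<star> e\<psi> = b" "B *\<^sub>v p = ract d \<rho> b *\<^sub>v p" using Rp[OF B] by blast
    have gA: "gmap n d \<rho> d \<rho> A" and gB: "gmap n d \<rho> d \<rho> B" using A B by (auto simp: endo_ring_def)
    have "(A * B) *\<^sub>v p = A *\<^sub>v (ract d \<rho> b *\<^sub>v p)" using RD[OF A] RD[OF B] pc b(3) by simp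
    also have "\<dots> = ract d \<rho> (b \<star> a) *\<^sub>v p"
      unfolding gmap_ract_vec[OF rep rep gA pc] a(3) ract_conv_vec[OF rep pc] ..
    also have "b \<star> a = a \<star> b" using hecke_commute a b by blast
    also have "ract d \<rho> (a \<star> b) *\<^sub>v p = B *\<^sub>v (ract d \<rho> a *\<^sub>v p)"
      unfolding gmap_ract_vec[OF rep rep gB pc] b(3) ract_conv_vec[OF rep pc] ..
    also have "\<dots> = (B * A) *\<^sub>v p" using RD[OF A] RD[OF B] pc a(3) by simp
    finally show ?thesis using Req Rm A B by blast
  qed
  have zR: "0\<^sub>m d d \<in> ?R"
    unfolding endo_ring_def gmap_def
  proof (intro CollectI conjI ballI)
    fix g assume "g \<in> G"
    then have "\<rho> g \<in> carrier_mat d d" by (rule is_repD(1)[OF rep])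
    then show "0\<^sub>m d d * \<rho> g = \<rho> g * 0\<^sub>m d d" by simp
  qed simp
  have kc: "v \<in> carrier_vec d" if "v \<in> coinv_kernel n (\<lambda>a. inverse (\<psi> a)) d \<rho>" for v
    using that kspan_ksubspace[OF coinv_kernel_generators_carrier[OF rep]]
    unfolding coinv_kernel_def ksubspace_def by blast
  have dual: "coinv_dual n (\<lambda>a. inverse (\<psi> a)) d \<rho> \<Lambda>"
    unfolding coinv_dual_def
  proof (intro conjI ballI)
    fix v w :: "'k vec" assume v: "v \<in> carrier_vec d" and w: "w \<in> carrier_vec d"
    have "\<Lambda> (v + w) *\<^sub>v p = (\<Lambda> v + \<Lambda> w) *\<^sub>v p"
      using v w L2 mult_add_distrib_mat_vec[OF ract_carrier v w]
        add_mult_distrib_mat_vec[OF RD[OF LR[OF v]] RD[OF LR[OF w]] pc] by simp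
    then show "\<Lambda> (v + w) = \<Lambda> v + \<Lambda> w" using Req LR Ra v w by simp
  next
    fix A and v :: "'k vec" assume A: "A \<in> ?R" and v: "v \<in> carrier_vec d"
    have gA: "gmap n d \<rho> d \<rho> A" using A by (simp add: endo_ring_def)
    have Av: "A *\<^sub>v v \<in> carrier_vec d" using RD[OF A] v by auto
    have "\<Lambda> (A *\<^sub>v v) *\<^sub>v p = A *\<^sub>v (\<Lambda> v *\<^sub>v p)"
      unfolding L2[OF Av] L2[OF v] gmap_ract_vec[OF rep rep gA v] ..
    also have "\<dots> = (A * \<Lambda> v) *\<^sub>v p" using RD[OF A] RD[OF LR[OF v]] pc by simp
    finally show "\<Lambda> (A *\<^sub>v v) = A * \<Lambda> v" using Req LR Rm A v Av by blast
  next
    fix v assume v: "v \<in> coinv_kernel n (\<lambda>a. inverse (\<psi> a)) d \<rho>"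
    have "\<Lambda> v *\<^sub>v p = 0\<^sub>v d" using L2[OF kc[OF v]] eid_coinv_kernel[OF add_char_psi rep v] by simp
    also have "\<dots> = 0\<^sub>m d d *\<^sub>v p" using pc by auto
    finally show "\<Lambda> v = 0\<^sub>m d d" using Req LR kc v zR by blast
  qed (rule LR)
  have gen: "\<exists>r\<in>?R. \<forall>v\<in>carrier_vec d. \<mu> v = r * \<Lambda> v"
    if \<mu>: "coinv_dual n (\<lambda>a. inverse (\<psi> a)) d \<rho> \<mu>" for \<mu>
  proof (intro bexI ballI)
    have mR: "\<And>v. v \<in> carrier_vec d \<Longrightarrow> \<mu> v \<in> ?R"
      and madd: "\<And>v w. v \<in> carrier_vec d \<Longrightarrow> w \<in> carrier_vec d \<Longrightarrow> \<mu> (v + w) = \<mu> v + \<mu> w"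
      and mlin: "\<And>A v. A \<in> ?R \<Longrightarrow> v \<in> carrier_vec d \<Longrightarrow> \<mu> (A *\<^sub>v v) = A * \<mu> v"
      and mker: "\<And>v. v \<in> coinv_kernel n (\<lambda>a. inverse (\<psi> a)) d \<rho> \<Longrightarrow> \<mu> v = 0\<^sub>m d d"
      using \<mu> unfolding coinv_dual_def by blast+
    show "\<mu> p \<in> ?R" by (rule mR[OF pc])
    fix v :: "'k vec" assume v: "v \<in> carrier_vec d"
    define w where "w = ract d \<rho> e\<psi> *\<^sub>v v"
    have w: "w \<in> carrier_vec d" unfolding w_def by (rule rc[OF v])
    have k: "v - w \<in> coinv_kernel n (\<lambda>a. inverse (\<psi> a)) d \<rho>"
      unfolding w_def by (rule minus_eid_coinv_kernel[OF add_char_psi rep v])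
    \<comment> \<open>\<open>v - w\<close> is in the coinvariant kernel and \<open>w\<close> is
      \<open>\<Lambda> v\<close> applied to \<open>p\<close>; so \<open>\<mu>\<close> is determined
      by \<open>\<mu> p\<close>, and commutativity puts this factor on the left.\<close>
    have "v = w + (v - w)" using v w by (intro eq_vecI) auto
    then have "\<mu> v = \<mu> w + \<mu> (v - w)" using madd[OF w kc[OF k]] by simp
    also have "\<dots> = \<mu> w" using mker[OF k] RD[OF mR[OF w]] by simp
    also have "w = \<Lambda> v *\<^sub>v p" using L2[OF v] by (simp add: w_def)
    also have "\<mu> (\<Lambda> v *\<^sub>v p) = \<Lambda> v * \<mu> p" by (rule mlin[OF LR[OF v] pc])
    also have "\<dots> = \<mu> p * \<Lambda> v" by (rule Rcomm[OF LR[OF v] mR[OF pc]])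
    finally show "\<mu> v = \<mu> p * \<Lambda> v" .
  qed
  have "coinv_dual_generator n (\<lambda>a. inverse (\<psi> a)) d \<rho> \<Lambda>"
    unfolding coinv_dual_generator_def using dual gen by blast
  then show ?thesis using L2 by blast
qed

text \<open>Conjugation by \<open>diag(1,-1,1,\<dots>)\<close> exchanges the characters of \<open>\<psi>\<close> and of its inverse, so
  genericity may be tested with either.\<close>
lemma eid_inverse_conj:
  obtains D where "D \<in> G" "dl D \<star> (eid (\<lambda>a. inverse (\<psi> a)) \<star> dl D) = e\<psi>"
proof -
  \<comment> \<open>Conjugation multiplies the entry \<open>(i, j)\<close> by
    \<open>(-1) ^ (i + j)\<close> and thus negates the superdiagonal. In characteristic two
    \<open>D\<close> is the identity and \<open>\<psi>\<close> is its own inverse.\<close>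
  define D where "D = mat n n (\<lambda>(i,j). if i = j then (-1) ^ i else (0::'f))"
  have Dc: "D \<in> carrier_mat n n" by (simp add: D_def)
  have left: "(D * x) $$ (i,j) = (-1) ^ i * x $$ (i,j)" if "x \<in> carrier_mat n n" "i < n" "j < n" for x i j
    using that by (simp add: D_def scalar_prod_def if_distrib[of "\<lambda>t. t * _"] cong: if_cong)
  have right: "(x * D) $$ (i,j) = x $$ (i,j) * (-1) ^ j" if "x \<in> carrier_mat n n" "i < n" "j < n" for x i j
    using that by (simp add: D_def scalar_prod_def if_distrib[of "\<lambda>t. _ * t"] cong: if_cong)
  have DD: "D * D = 1\<^sub>m n"
  proof (rule eq_matI)
    fix i j assume "i < dim_row (1\<^sub>m n :: 'f mat)" "j < dim_col (1\<^sub>m n :: 'f mat)"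
    then have ij: "i < n" "j < n" by auto
    show "(D * D) $$ (i,j) = 1\<^sub>m n $$ (i,j)"
      using left[OF Dc ij] ij by (simp add: D_def power_add[symmetric] mult_2[symmetric])
  qed (use Dc in auto)
  have DG: "D \<in> G" using G_I[OF Dc Dc DD] .
  have Dinv: "ginv D = D" using ginv_unique[OF DG DG DD] .
  have ent: "(D * (x * D)) $$ (i,j) = (-1) ^ (i + j) * x $$ (i,j)"
    if "x \<in> carrier_mat n n" "i < n" "j < n" for x i j
    using left[of "x * D" i j] right[OF that] that Dc by (simp add: power_add)
  have cN: "D * (u * D) \<in> N" if u: "u \<in> N" for u
  proof -
    have uc: "u \<in> carrier_mat n n" using u by (rule N_carrier)
    have "D * (u * D) \<in> carrier_mat n n" using uc Dc by auto
    moreover have "(D * (u * D)) $$ (i,i) = 1" if "i < n" for i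
      using ent[OF uc that that] u that by (simp add: Nn_def mult_2[symmetric])
    moreover have "(D * (u * D)) $$ (i,j) = 0" if "i < n" "j < i" for i j
      using ent[OF uc, of i j] u that by (simp add: Nn_def)
    ultimately show ?thesis by (auto simp: Nn_def)
  qed
  have cN': "u \<in> N" if "u \<in> G" "D * (u * D) \<in> N" for u
  proof -
    have "D * ((D * (u * D)) * D) = u" using that(1) DG DD by (simp add: G_assoc) (simp add: G_assoc[symmetric])
    then show ?thesis using cN[OF that(2)] by simp
  qed
  have psiD: "psiN \<psi> n (D * (u * D)) = inverse (psiN \<psi> n u)" if u: "u \<in> N" for u
  proof -
    have "(\<Sum>i<n-1. (D * (u * D)) $$ (i,i+1)) = (\<Sum>i<n-1. - (u $$ (i,i+1)))"
      using ent[OF N_carrier[OF u]] by (intro sum.cong refl) (simp add: mult_2[symmetric])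
    also have "\<dots> = - (\<Sum>i<n-1. u $$ (i,i+1))" by (rule sum_negf)
    finally have s: "(\<Sum>i<n-1. (D * (u * D)) $$ (i,i+1)) = - (\<Sum>i<n-1. u $$ (i,i+1))" .
    have neg: "\<psi> (- x) = inverse (\<psi> x)" for x
    proof -
      have "\<psi> 0 = \<psi> 0 * \<psi> 0" "\<psi> 0 \<noteq> 0" "\<psi> 0 = \<psi> x * \<psi> (- x)"
        using add_char_psi unfolding add_char_def by (metis add.right_neutral add.right_inverse)+
      then have "\<psi> x * \<psi> (- x) = 1" by simp
      then show ?thesis by (metis inverse_unique)
    qed
    show ?thesis unfolding psiN_def s neg ..
  qed
  have "dl D \<star> (eid (\<lambda>a. inverse (\<psi> a)) \<star> dl D) = e\<psi>"
  proof
    fix x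
    show "(dl D \<star> (eid (\<lambda>a. inverse (\<psi> a)) \<star> dl D)) x = e\<psi> x"
    proof (cases "x \<in> G")
      case x: True
      have "(dl D \<star> (eid (\<lambda>a. inverse (\<psi> a)) \<star> dl D)) x = eid (\<lambda>a. inverse (\<psi> a)) (D * x * D)"
        using conv_dl_left[OF DG x, of "eid (\<lambda>a. inverse (\<psi> a)) \<star> dl D"]
          conv_dl_right[OF DG, of "D * x" "eid (\<lambda>a. inverse (\<psi> a))"] DG x by (simp add: Dinv)
      also have "D * x * D = D * (x * D)" using DG x by (simp add: G_assoc)
      also have "eid (\<lambda>a. inverse (\<psi> a)) (D * (x * D)) = e\<psi> x"
        using cN[of x] cN'[OF x] psiD[of x] by (auto simp: eid_def psiN_inverse)
      finally show ?thesis .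
    next
      case False
      then show ?thesis using supp_eid[of \<psi>] by (auto simp: conv_def supp_def)
    qed
  qed
  then show ?thesis using that DG by blast
qed

text \<open>Vanishing \<open>\<psi>\<close>-coinvariants mean that the idempotent of the inverse
  character acts as zero; then so does its conjugate \<open>e\<psi>\<close>.\<close>

lemma coinv_nonzero_if_eid:
  assumes r: "is_rep n d \<rho>" and v: "v \<in> carrier_vec d" "ract d \<rho> e\<psi> *\<^sub>v v \<noteq> 0\<^sub>v d"
  shows "coinv_nonzero n \<psi> d \<rho>"
  unfolding coinv_nonzero_def
proof
  assume K: "coinv_kernel n \<psi> d \<rho> = carrier_vec d"
  let ?\<phi> = "\<lambda>a. inverse (\<psi> a)"
  obtain D where D: "D \<in> G" "dl D \<star> (eid ?\<phi> \<star> dl D) = e\<psi>" by (rule eid_inverse_conj)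
  have w: "ract d \<rho> (dl D) *\<^sub>v v \<in> carrier_vec d" using v by (auto intro: mult_mat_vec_carrier)
  have "coinv_kernel n (\<lambda>a. inverse (?\<phi> a)) d \<rho> = carrier_vec d" using K by simp
  then have "ract d \<rho> (eid ?\<phi>) *\<^sub>v (ract d \<rho> (dl D) *\<^sub>v v) = 0\<^sub>v d"
    using eid_coinv_kernel[OF add_char_inverse[OF add_char_psi] r] w by blast
  then have "ract d \<rho> e\<psi> *\<^sub>v v = ract d \<rho> (dl D) *\<^sub>v 0\<^sub>v d"
    unfolding D(2)[symmetric] ract_conv_vec[OF r v(1)] by simp
  then show False using v(2) by (simp add: mat_mult_zero_vec[OF ract_carrier])
qed

text \<open>Among the idempotents of the Hecke algebra that are not killed in the sense of
  \<open>good\<close>, one whose left ideal has least dimension is taken. If it splits as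
  \<open>g + g'\<close>, one summand is again good, and by minimality its left ideal leaves no room
  for the other.\<close>

lemma exists_primitive:
  assumes h: "h \<star> (a \<star> e\<psi>) \<noteq> (\<lambda>x. 0)"
  shows "\<exists>f d \<rho> p b. primitive_idem f \<and> e\<psi> \<star> f = f \<and> f \<star> e\<psi> = f \<and> cyc f d \<rho> p \<and>
    h \<star> (b \<star> f) \<noteq> (\<lambda>x. 0)"
proof -
  define good where "good = (\<lambda>f. f \<star> f = f \<and> e\<psi> \<star> f = f \<and> f \<star> e\<psi> = f \<and> (\<exists>a. h \<star> (a \<star> f) \<noteq> (\<lambda>x. 0)))"
  define Q where "Q = (\<lambda>d. \<exists>f \<rho> p. good f \<and> cyc f d \<rho> p)"
  have "good e\<psi>" using h eid_idem[OF add_char_psi] by (auto simp: good_def)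
  then have "\<exists>d. Q d" using cyc_exists[OF eid_idem[OF add_char_psi]] unfolding Q_def by blast
  define d where "d = (LEAST d. Q d)"
  have "Q d" unfolding d_def using \<open>\<exists>d. Q d\<close> by (rule LeastI_ex)
  have least: "Q x \<Longrightarrow> d \<le> x" for x unfolding d_def by (rule Least_le)
  obtain f \<rho> p where f: "good f" and c: "cyc f d \<rho> p" using \<open>Q d\<close> unfolding Q_def by blast
  note rep = cycD(1)[OF c] and pc = cycD(2)[OF c]
  have ff: "f \<star> f = f" and fe: "e\<psi> \<star> f = f" "f \<star> e\<psi> = f" using f by (auto simp: good_def)
  \<comment> \<open>Right multiplication by \<open>g\<close> maps k[G] f onto k[G] g. Minimality of
    \<open>d\<close> forces equal dimensions, so the map is injective; it kills \<open>g'\<close>,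
    which therefore vanishes.\<close>
  have split: "g' = (\<lambda>x. 0)"
    if g: "good g" "f \<star> g = g" and g': "g' \<star> f = g'" "g' \<star> g = (\<lambda>x. 0)" for g g'
  proof -
    have gg: "g \<star> g = g" using g by (simp add: good_def)
    obtain d1 \<rho>1 p1 where c1: "cyc g d1 \<rho>1 p1" using cyc_exists[OF gg] by blast
    note rep1 = cycD(1)[OF c1] and pc1 = cycD(2)[OF c1]
    have "ract d1 \<rho>1 f *\<^sub>v p1 = p1"
      using ract_conv_vec[OF rep1 pc1, of f g] g(2) cycD(3)[OF c1] by simp
    then obtain \<Phi> where P: "gmap n d \<rho> d1 \<rho>1 \<Phi>" "\<Phi> *\<^sub>v p = p1" using cyc_map[OF c rep1 pc1] by blast
    have Pc: "\<Phi> \<in> carrier_mat d1 d" using P by (simp add: gmap_def)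
    have Pa: "\<Phi> *\<^sub>v (ract d \<rho> a *\<^sub>v p) = ract d1 \<rho>1 a *\<^sub>v p1" for a
      using gmap_ract_vec[OF rep rep1 P(1) pc] P(2) by simp
    have rc: "ract d \<rho> a *\<^sub>v p \<in> carrier_vec d" for a using pc by (auto intro: mult_mat_vec_carrier)
    have s: "surj_mat d d1 \<Phi>" unfolding surj_mat_def using cycD(4)[OF c1] Pa rc by metis
    have "Q d1" using g(1) c1 unfolding Q_def by blast
    then have dd: "d1 = d" using least surj_mat_dim_le[OF Pc s] by force
    have "\<Phi> *\<^sub>v (ract d \<rho> g' *\<^sub>v p) = ract d1 \<rho>1 (g' \<star> g) *\<^sub>v p1"
      unfolding Pa ract_conv_vec[OF rep1 pc1] cycD(3)[OF c1] ..
    also have "\<dots> = 0\<^sub>v d1" unfolding g'(2) ract_zero using pc1 by auto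
    finally have "ract d \<rho> g' *\<^sub>v p = 0\<^sub>v d"
      using surj_mat_square_inj[of \<Phi> d] Pc s rc unfolding dd by blast
    then show ?thesis using cycD(5)[OF c] g'(1) by metis
  qed
  have "primitive_idem f"
    unfolding primitive_idem_def
  proof (intro conjI allI impI)
    show "f \<noteq> (\<lambda>x. 0)" using f by (auto simp: good_def)
    fix g assume gg: "g \<star> g = g" and fg: "f \<star> g = g" and gf: "g \<star> f = g"
    define g' where "g' = (\<lambda>x. f x - g x)"
    have fg': "f \<star> g' = g'" and gf': "g' \<star> f = g'" and g'g: "g' \<star> g = (\<lambda>x. 0)" and gg': "g \<star> g' = (\<lambda>x. 0)"
      unfolding g'_def conv_diff_left conv_diff_right ff fg gf gg by auto
    have g'g': "g' \<star> g' = g'" by (subst (2) g'_def) (simp add: conv_diff_right gf' g'g)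
    \<comment> \<open>Sub-idempotents of \<open>f\<close> stay inside the corner of
      \<open>e\<psi>\<close>; hence testing within the Hecke algebra yields primitivity in the whole
      group algebra.\<close>
    have ee: "e\<psi> \<star> g = g" "g \<star> e\<psi> = g" "e\<psi> \<star> g' = g'" "g' \<star> e\<psi> = g'"
      by (metis conv_assoc fe fg gf fg' gf')+
    obtain b where b: "h \<star> (b \<star> f) \<noteq> (\<lambda>x. 0)" using f by (auto simp: good_def)
    have "h \<star> (b \<star> f) = (\<lambda>x. (h \<star> (b \<star> g)) x + (h \<star> (b \<star> g')) x)"
      unfolding conv_add_right[symmetric] by (simp add: g'_def)
    then have "h \<star> (b \<star> g) \<noteq> (\<lambda>x. 0) \<or> h \<star> (b \<star> g') \<noteq> (\<lambda>x. 0)" using b by auto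
    then have "good g \<or> good g'" using gg g'g' ee unfolding good_def by blast
    then have "g' = (\<lambda>x. 0) \<or> g = (\<lambda>x. 0)" using split[of g g'] split[of g' g] fg gf' g'g fg' gf gg' by blast
    moreover have "g = f" if "g' = (\<lambda>x. 0)" using fun_cong[OF that] by (auto simp: g'_def)
    ultimately show "g = (\<lambda>x. 0) \<or> g = f" by blast
  qed (rule ff)
  then show ?thesis using fe c f unfolding good_def by blast
qed

lemma eid_nondegenerate:
  assumes s: "supp h" and eh: "e\<psi> \<star> h = h" and z: "\<And>a. h \<star> (a \<star> e\<psi>) = (\<lambda>x. 0)"
  shows "h = (\<lambda>x. 0)"
proof
  fix x
  show "h x = 0"
  proof (cases "x \<in> G")
    case x: True
    \<comment> \<open>Right translation by the inverse of \<open>x\<close> moves the coefficient at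
      \<open>x\<close> to the identity, where the trace form applies.\<close>
    have "h x = (h \<star> dl (ginv x)) (1\<^sub>m n)" using conv_dl_right[of "ginv x" "1\<^sub>m n" h] x by simp
    also have "\<dots> = (e\<psi> \<star> (h \<star> dl (ginv x))) (1\<^sub>m n)" by (simp add: conv_assoc[symmetric] eh)
    also have "\<dots> = ((h \<star> dl (ginv x)) \<star> e\<psi>) (1\<^sub>m n)" by (rule conv_trace)
    also have "\<dots> = 0" unfolding conv_assoc z ..
    finally show ?thesis .
  qed (use s in \<open>simp add: supp_def\<close>)
qed

text \<open>Applying the vanishing matrix sum to the generator \<open>p\<close> replaces each
  \<open>\<Lambda> w\<close> by \<open>e\<psi>\<close> acting on \<open>w\<close>. The resulting sum
  over cosets, multiplied by the order of \<open>N\<close>, is the action of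
  \<open>e\<psi> \<star> h\<close>, that is of \<open>h\<close>, on \<open>v\<close>.\<close>

lemma sum_NG_zero_imp:
  fixes H :: "'f mat \<Rightarrow> 'k"
  assumes H: "in_Ind n \<psi> H" and h: "h = (\<lambda>x. if x \<in> G then H x else 0)" "e\<psi> \<star> h = h"
    and r: "is_rep n d \<rho>" and v: "v \<in> carrier_vec d" and p: "p \<in> carrier_vec d"
    and Lc: "\<And>w. w \<in> carrier_vec d \<Longrightarrow> \<Lambda> w \<in> carrier_mat d d"
    and L: "\<And>w. w \<in> carrier_vec d \<Longrightarrow> \<Lambda> w *\<^sub>v p = ract d \<rho> e\<psi> *\<^sub>v w"
    and z: "sum_NG n d H (\<lambda>g. \<Lambda> (\<rho> g *\<^sub>v v)) = 0\<^sub>m d d"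
  shows "ract d \<rho> h *\<^sub>v v = 0\<^sub>v d"
proof -
  let ?E = "ract d \<rho> e\<psi>"
  have rc: "\<rho> g *\<^sub>v v \<in> carrier_vec d" if "g \<in> G" for g using is_repD(1)[OF r that] v by auto
  have repG: "coset_rep C \<in> G" if C: "C \<in> right_cosets_N n" for C :: "'f mat set"
  proof -
    obtain g where g: "g \<in> G" "C = (\<lambda>u. u * g) ` N" using C by (auto simp: right_cosets_N_def)
    have "1\<^sub>m n * g \<in> C" unfolding g(2) by (rule imageI) simp
    then have "coset_rep C \<in> C" unfolding coset_rep_def by (rule someI)
    then show ?thesis using g by auto
  qed
  have "?E *\<^sub>v (ract d \<rho> h *\<^sub>v v) = 0\<^sub>v d"
  proof (rule eq_vecI)
    fix i assume "i < dim_vec (0\<^sub>v d :: 'k vec)"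
    then have i: "i < d" by simp
    define F where "F = (\<lambda>g. H g * (?E *\<^sub>v (\<rho> g *\<^sub>v v)) $ i)"
    \<comment> \<open>The character by which \<open>H\<close> transforms cancels the inverse
      character from \<open>eid_act_N\<close>, so the summand depends only on the coset.\<close>
    have Fu: "F (u * g) = F g" if u: "u \<in> N" and g: "g \<in> G" for u g
    proof -
      have uc: "\<rho> u \<in> carrier_mat d d" "\<rho> g \<in> carrier_mat d d" using is_repD(1)[OF r] u g by auto
      have "\<rho> (u * g) *\<^sub>v v = \<rho> u *\<^sub>v (\<rho> g *\<^sub>v v)" using is_repD(2)[OF r] u g uc v by simp
      then have "?E *\<^sub>v (\<rho> (u * g) *\<^sub>v v) = inverse (psiN \<psi> n u) \<cdot>\<^sub>v (?E *\<^sub>v (\<rho> g *\<^sub>v v))"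
        using eid_act_N[OF add_char_psi r u rc[OF g]] by simp
      then have "(?E *\<^sub>v (\<rho> (u * g) *\<^sub>v v)) $ i = inverse (psiN \<psi> n u) * (?E *\<^sub>v (\<rho> g *\<^sub>v v)) $ i"
        using i by (simp add: ract_def del: index_mult_mat_vec)
      moreover have "H (u * g) = psiN \<psi> n u * H g" using H u g by (simp add: in_Ind_def)
      ultimately show ?thesis using psiN_N(2)[OF add_char_psi, of u] by (simp add: F_def del: index_mult_mat_vec)
    qed
    have "0 = (\<Sum>j\<in>{0..<d}. sum_NG n d H (\<lambda>g. \<Lambda> (\<rho> g *\<^sub>v v)) $$ (i,j) * p $ j)"
      unfolding z using i by simp
    also have "\<dots> = (\<Sum>j\<in>{0..<d}. \<Sum>C\<in>right_cosets_N n.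
        H (coset_rep C) * (\<Lambda> (\<rho> (coset_rep C) *\<^sub>v v) $$ (i,j) * p $ j))"
      using i by (simp add: sum_NG_def sum_distrib_right mult.assoc)
    also have "\<dots> = (\<Sum>C\<in>right_cosets_N n. \<Sum>j\<in>{0..<d}.
        H (coset_rep C) * (\<Lambda> (\<rho> (coset_rep C) *\<^sub>v v) $$ (i,j) * p $ j))" by (rule sum.swap)
    also have "\<dots> = (\<Sum>C\<in>right_cosets_N n. F (coset_rep C))"
    proof (rule sum.cong[OF refl])
      fix C :: "'f mat set" assume "C \<in> right_cosets_N n"
      then have w: "\<rho> (coset_rep C) *\<^sub>v v \<in> carrier_vec d" using rc repG by blast
      have "(\<Sum>j\<in>{0..<d}. H (coset_rep C) * (\<Lambda> (\<rho> (coset_rep C) *\<^sub>v v) $$ (i,j) * p $ j)) =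
        H (coset_rep C) * (\<Lambda> (\<rho> (coset_rep C) *\<^sub>v v) *\<^sub>v p) $ i"
        using Lc[OF w] p i by (simp add: scalar_prod_def sum_distrib_left)
      then show "(\<Sum>j\<in>{0..<d}. H (coset_rep C) * (\<Lambda> (\<rho> (coset_rep C) *\<^sub>v v) $$ (i,j) * p $ j)) =
        F (coset_rep C)" unfolding L[OF w] F_def .
    qed
    finally have "(\<Sum>g\<in>G. F g) = 0" using sum_right_cosets[of F] Fu by simp
    moreover have "(?E *\<^sub>v (ract d \<rho> h *\<^sub>v v)) $ i = (\<Sum>g\<in>G. F g)"
    proof -
      have hc: "h g \<cdot>\<^sub>v (\<rho> g *\<^sub>v v) \<in> carrier_vec d" if "g \<in> G" for g using rc[OF that] by simp
      have "(?E *\<^sub>v (ract d \<rho> h *\<^sub>v v)) $ i = (\<Sum>g\<in>G. (?E *\<^sub>v (h g \<cdot>\<^sub>v (\<rho> g *\<^sub>v v))) $ i)"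
        unfolding ract_vec[OF r v, of h] using mat_mult_vec_sum[of ?E d d G "\<lambda>g. h g \<cdot>\<^sub>v (\<rho> g *\<^sub>v v)", OF ract_carrier hc] i
        by (simp del: index_mult_mat_vec)
      also have "\<dots> = (\<Sum>g\<in>G. F g)"
      proof (rule sum.cong[OF refl])
        fix g assume g: "g \<in> G"
        show "(?E *\<^sub>v (h g \<cdot>\<^sub>v (\<rho> g *\<^sub>v v))) $ i = F g"
          unfolding mult_mat_vec[OF ract_carrier rc[OF g]] F_def using i g h(1)
          by (simp add: ract_def del: index_mult_mat_vec)
      qed
      finally show ?thesis .
    qed
    ultimately show "(?E *\<^sub>v (ract d \<rho> h *\<^sub>v v)) $ i = 0\<^sub>v d $ i" using i by simp
  qed (simp add: ract_def)
  then show ?thesis using ract_conv_vec[OF r v, of e\<psi> h] h(2) by simp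
qed

end

theorem theorem4p4:
  fixes n :: nat
    and \<psi> :: "'f::{finite,field} \<Rightarrow> ('l::prime_card) mod_ring alg_closure"
    and H :: "'f mat \<Rightarrow> 'l mod_ring alg_closure"
  assumes n: "n \<ge> 1"
    and ell_ne_p: "CARD('l) \<noteq> CHAR('f)"
    and psi: "nontriv_add_char \<psi>"
    and H: "in_Ind n \<psi> H"
    and orth: "\<And>d\<pi> \<rho>\<pi> dP \<rho>P e \<Lambda> W.
       generic_irred n \<psi> d\<pi> \<rho>\<pi> \<Longrightarrow> projective_cover n d\<pi> \<rho>\<pi> dP \<rho>P e \<Longrightarrow>
       coinv_dual_generator n (\<lambda>a. inverse (\<psi> a)) dP \<rho>P \<Lambda> \<Longrightarrow>
       W \<in> whittaker_model n (\<lambda>a. inverse (\<psi> a)) dP \<rho>P \<Lambda> \<Longrightarrow>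
       sum_NG n dP H W = 0\<^sub>m dP dP"
  shows "\<forall>g\<in>GLn n. H g = 0"
proof -
  interpret gl n "TYPE('f)" .
  have pl: "prime CARD('l)" by (rule prime_card)
  \<comment> \<open>The order of \<open>N\<close> is a power of the order of the finite field, and
    \<open>CARD('l)\<close> is the characteristic of the coefficient field.\<close>
  have "of_nat (card N) \<noteq> (0 :: 'l mod_ring alg_closure)"
  proof
    assume "of_nat (card N) = (0 :: 'l mod_ring alg_closure)"
    then have "CARD('l) dvd card N" by (simp add: of_nat_eq_0_iff_char_dvd)
    then obtain e where "CARD('l) dvd CARD('f) ^ e" using card_N_power by metis
    then have "CARD('l) dvd CARD('f)" using pl prime_dvd_power by blast
    then show False using prime_dvd_card_field_imp_eq_CHAR[OF pl] ell_ne_p by blast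
  qed
  then interpret gelfand_graev n "TYPE('f)" \<psi> using psi by unfold_locales
  \<comment> \<open>\<open>H\<close> is unconstrained outside \<open>G\<close>; truncation makes it
    an element of the group algebra, on which \<open>e\<psi>\<close> can act as a left unit.\<close>
  define h where "h = (\<lambda>x. if x \<in> G then H x else 0)"
  have hs: "supp h" by (simp add: h_def supp_def)
  have eh: "e\<psi> \<star> h = h"
    using H by (intro eid_absorb[OF add_char_psi hs]) (auto simp: h_def in_Ind_def)
  have "h = (\<lambda>x. 0)"
  proof (rule ccontr)
    assume "h \<noteq> (\<lambda>x. 0)"
    then obtain a where "h \<star> (a \<star> e\<psi>) \<noteq> (\<lambda>x. 0)" using eid_nondegenerate[OF hs eh] by blast
    then obtain f d \<rho> p b where f: "primitive_idem f" and fe: "e\<psi> \<star> f = f" "f \<star> e\<psi> = f"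
      and c: "cyc f d \<rho> p" and b: "h \<star> (b \<star> f) \<noteq> (\<lambda>x. 0)" using exists_primitive by blast
    note rep = cycD(1)[OF c] and pc = cycD(2)[OF c]
    have ff: "f \<star> f = f" using f by (simp add: primitive_idem_def)
    obtain d\<pi> \<rho>\<pi> e where irr: "irreducible_rep n d\<pi> \<rho>\<pi>" and cov: "projective_cover n d\<pi> \<rho>\<pi> d \<rho> e"
      and enz: "e *\<^sub>v p \<noteq> 0\<^sub>v d\<pi>" using cyc_cover[OF f c] by blast
    have r\<pi>: "is_rep n d\<pi> \<rho>\<pi>" and ge: "gmap n d \<rho> d\<pi> \<rho>\<pi> e" using cov by (auto simp: projective_cover_def)
    have ep: "e *\<^sub>v p \<in> carrier_vec d\<pi>" using ge pc by (auto simp: gmap_def)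
    \<comment> \<open>The image of \<open>p\<close> is fixed by \<open>f\<close>, and
      \<open>f \<star> e\<psi> = f\<close>; so \<open>e\<psi>\<close> cannot kill this nonzero
      vector, which makes the irreducible quotient generic.\<close>
    have "ract d\<pi> \<rho>\<pi> f *\<^sub>v (ract d\<pi> \<rho>\<pi> e\<psi> *\<^sub>v (e *\<^sub>v p)) = e *\<^sub>v p"
      unfolding ract_conv_vec[OF r\<pi> ep, symmetric] fe
      unfolding gmap_ract_vec[OF rep r\<pi> ge pc, symmetric] cycD(3)[OF c] ..
    then have "ract d\<pi> \<rho>\<pi> e\<psi> *\<^sub>v (e *\<^sub>v p) \<noteq> 0\<^sub>v d\<pi>"
      using enz by (metis mat_mult_zero_vec ract_carrier)
    then have gen: "generic_irred n \<psi> d\<pi> \<rho>\<pi>"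
      using irr coinv_nonzero_if_eid[OF r\<pi> ep] by (simp add: generic_irred_def)
    obtain \<Lambda> where L: "coinv_dual_generator n (\<lambda>a. inverse (\<psi> a)) d \<rho> \<Lambda>"
      and Lp: "\<And>v. v \<in> carrier_vec d \<Longrightarrow> \<Lambda> v *\<^sub>v p = ract d \<rho> e\<psi> *\<^sub>v v"
      using cyc_dual_generator[OF fe ff c] by blast
    have Lc: "\<Lambda> v \<in> carrier_mat d d" if "v \<in> carrier_vec d" for v
      using L that by (simp add: coinv_dual_generator_def coinv_dual_def endo_ring_def gmap_def)
    have kill: "ract d \<rho> h *\<^sub>v v = 0\<^sub>v d" if v: "v \<in> carrier_vec d" for v
    proof (rule sum_NG_zero_imp[OF H h_def eh rep v pc Lc Lp])
      have "(\<lambda>g. \<Lambda> (\<rho> g *\<^sub>v v)) \<in> whittaker_model n (\<lambda>a. inverse (\<psi> a)) d \<rho> \<Lambda>"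
        using v by (auto simp: whittaker_model_def)
      then show "sum_NG n d H (\<lambda>g. \<Lambda> (\<rho> g *\<^sub>v v)) = 0\<^sub>m d d" by (rule orth[OF gen cov L])
    qed
    have "ract d \<rho> b *\<^sub>v p \<in> carrier_vec d" using pc by (auto intro: mult_mat_vec_carrier)
    \<comment> \<open>Annihilating the generator \<open>p\<close> is the same as annihilating
      \<open>f\<close>, so the vanishing on the module contradicts the choice of
      \<open>b\<close>.\<close>
    then have "ract d \<rho> (h \<star> b) *\<^sub>v p = 0\<^sub>v d" using kill ract_conv_vec[OF rep pc] by simp
    then have "(h \<star> b) \<star> f = (\<lambda>x. 0)" by (rule cycD(5)[OF c])
    then show False using b by (simp add: conv_assoc)
  qed
  then show ?thesis by (metis h_def)
qed

end
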